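(* Let $m,n$ be positive integers, let $(d(k))_{k\in\mathbb{Z}}$ be complex numbers (e.g. the Fourier coefficients of $f\in L^1(\mathbb{T})$, $f(z)=\sum_k d(k)z^k$), and let $R$ be a non-negative integer such that $D^{[2m]}_n(f)=D^{[2m]}_n(F_R)$, where $F_R(z)=\sum_{k\ge -R}d(k)z^k$ (e.g. any $R\ge m(n-1)$). Let $\gamma(f,n,m,R)$ be the coefficient of $Q^{(1/m)}_{(R^n)}(\mathbf{x}_1,\dots,\mathbf{x}_n)$ in the expansion of the formal power series $$S_f(\mathbf{x}_1,\dots,\mathbf{x}_n;R)=\prod_{k=1}^n\mathbf{x}_k^RF_R(\mathbf{x}_k)\in\mathbb{C}[[\mathbf{x}_1,\dots,\mathbf{x}_n]]$$ in terms of the Jack $Q$-polynomials $Q^{(1/m)}_\lambda(\mathbf{x}_1,\dots,\mathbf{x}_n)$. Then $$\widehat{D}^{[2m]}_n(f)=\gamma(f,n,m,R)\prod_{i=1}^n\prod_{j=1}^R\frac{im+j-1}{(i-1)m+j}.$$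
   Context: Toeplitz hyperdeterminant of a sequence/function with coefficients $d(k)$: $D^{[2m]}_n(f)=\mathrm{Det}^{[2m]}\big(d(i_1+\cdots+i_m-i_{m+1}-\cdots-i_{2m})\big)_{1\le i_1,\dots,i_{2m}\le n}$, where $\mathrm{Det}^{[2m]}(A):=\frac{1}{n!}\sum_{\sigma_1,\dots,\sigma_{2m}\in\mathfrak{S}_n}\prod_j\mathrm{sgn}(\sigma_j)\prod_{i=1}^nA(\sigma_1(i),\dots,\sigma_{2m}(i))$; normalized version $\widehat{D}^{[2m]}_n(f)=D^{[2m]}_n(f)/D^{[2m]}_n(\mathbf{1})$, where $\mathbf{1}$ is the constant function $1$ and $D^{[2m]}_n(\mathbf{1})=\frac{(mn)!}{n!(m!)^n}$. $(R^n)$ is the partition $(R,\dots,R)$ with $n$ parts. Jack functions (parameter $\alpha>0$): with power sums $p_k=\sum_i\mathbf{x}_i^k$, $p_\lambda=p_{\lambda_1}p_{\lambda_2}\cdots$, the scalar product $\langle p_\lambda,p_\mu\rangle_\alpha=\delta_{\lambda\mu}z_\lambda\alpha^{\ell(\lambda)}$ where $z_\lambda=\prod_{k\ge1}k^{m_k}m_k!$, $m_k=\#\{i:\lambda_i=k\}$. The Jack $P$-function $P^{(\alpha)}_\lambda$ is the unique homogeneous symmetric function of the form $m_\lambda+\sum_{\mu<\lambda}u_{\lambda\mu}m_\mu$ ($m_\mu$ monomial symmetric functions, $<$ the dominance order) with $\langle P^{(\alpha)}_\lambda,P^{(\alpha)}_\mu\rangle_\alpha=0$ for $\lambda\ne\mu$.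 With $c_\lambda(\alpha)=\prod_{(i,j)\in\lambda}(\alpha(\lambda_i-j)+\lambda'_j-i+1)$ and $c'_\lambda(\alpha)=\prod_{(i,j)\in\lambda}(\alpha(\lambda_i-j+1)+\lambda'_j-i)$ ($\lambda'$ the conjugate partition), $Q^{(\alpha)}_\lambda=c_\lambda(\alpha)c'_\lambda(\alpha)^{-1}P^{(\alpha)}_\lambda$. Jack polynomials are their specializations to finitely many variables; each homogeneous component of a symmetric formal power series in $\mathbf{x}_1,\dots,\mathbf{x}_n$ is expanded in $\{Q^{(\alpha)}_\lambda:\ell(\lambda)\le n\}$. *)

theory Defs
  imports Complex_Main "HOL-Library.Poly_Mapping" "HOL-Combinatorics.Permutations"
begin

definition hyperdet :: "nat \<Rightarrow> nat \<Rightarrow> (int \<Rightarrow> complex) \<Rightarrow> complex" where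
  "hyperdet m n d =
     (1 / of_nat (fact n)) *
     (\<Sum>s \<in> PiE {..<2*m} (\<lambda>_. {p. p permutes {1..n}}).
        (\<Prod>j<2*m. of_int (sign (s j))) *
        (\<Prod>i\<in>{1..n}. d ((\<Sum>j<m. int (s j i)) - (\<Sum>j<m. int (s (m + j) i)))))"

definition one_coeffs :: "int \<Rightarrow> complex" where
  "one_coeffs k = (if k = 0 then 1 else 0)"

definition hyperdet_norm :: "nat \<Rightarrow> nat \<Rightarrow> (int \<Rightarrow> complex) \<Rightarrow> complex" where
  "hyperdet_norm m n d = hyperdet m n d / hyperdet m n one_coeffs"

definition trunc_coeffs :: "nat \<Rightarrow> (int \<Rightarrow> complex) \<Rightarrow> int \<Rightarrow> complex" where
  "trunc_coeffs R d k = (if k \<ge> - int R then d k else 0)"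

type_synonym partition = "nat list"

definition is_partition :: "nat list \<Rightarrow> bool" where
  "is_partition lam \<longleftrightarrow> sorted_wrt (\<ge>) lam \<and> 0 \<notin> set lam"

definition part :: "nat list \<Rightarrow> nat \<Rightarrow> nat" where
  "part lam i = (if 1 \<le> i \<and> i \<le> length lam then lam ! (i - 1) else 0)"

definition conj_part :: "nat list \<Rightarrow> nat \<Rightarrow> nat" where
  "conj_part lam j = card {i. 1 \<le> i \<and> i \<le> length lam \<and> j \<le> part lam i}"

definition cells :: "nat list \<Rightarrow> (nat \<times> nat) set" where
  "cells lam = {(i, j). 1 \<le> i \<and> i \<le> length lam \<and> 1 \<le> j \<and> j \<le> part lam i}"

definition dominated :: "nat list \<Rightarrow> nat list \<Rightarrow> bool" where
  "dominated mu lam \<longleftrightarrow> sum_list mu = sum_list lam \<and>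
     (\<forall>k. (\<Sum>i=1..k. part mu i) \<le> (\<Sum>i=1..k. part lam i))"

definition rect :: "nat \<Rightarrow> nat \<Rightarrow> nat list" where
  "rect n R = (if R = 0 then [] else replicate n R)"

text \<open>Polynomials in variables indexed by nat: exponent vectors nat =>0 nat.\<close>
type_synonym cpoly = "(nat \<Rightarrow>\<^sub>0 nat) \<Rightarrow>\<^sub>0 complex"

definition cconst :: "complex \<Rightarrow> cpoly" where
  "cconst c = Poly_Mapping.single 0 c"

definition psum :: "nat \<Rightarrow> nat \<Rightarrow> cpoly" where
  "psum N k = (\<Sum>i<N. Poly_Mapping.single (Poly_Mapping.single i k) 1)"

definition exps_partition :: "nat \<Rightarrow> (nat \<Rightarrow>\<^sub>0 nat) \<Rightarrow> nat list" where
  "exps_partition N a = rev (sort (filter (\<lambda>x. x \<noteq> 0) (map (Poly_Mapping.lookup a) [0..<N])))"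

definition msym :: "nat \<Rightarrow> nat list \<Rightarrow> cpoly" where
  "msym N mu = (\<Sum>a \<in> {a. Poly_Mapping.keys a \<subseteq> {..<N} \<and> exps_partition N a = mu}.
                  Poly_Mapping.single a 1)"

text \<open>The ring of symmetric functions Lambda = C[p_1, p_2, ...] is represented as
  polynomials in the power sums: an element of type cpoly whose exponent vectors v
  (v k = multiplicity of p_k) avoid the index 0. The monomial with exponent vector v is
  p_lambda where lambda has m_k(lambda) = v k.\<close>

definition wdeg :: "(nat \<Rightarrow>\<^sub>0 nat) \<Rightarrow> nat" where
  "wdeg v = (\<Sum>k\<in>Poly_Mapping.keys v. k * Poly_Mapping.lookup v k)"

definition homog_symfun :: "nat \<Rightarrow> cpoly \<Rightarrow> bool" where
  "homog_symfun N f \<longleftrightarrow> (\<forall>v\<in>Poly_Mapping.keys f. 0 \<notin> Poly_Mapping.keys v \<and> wdeg v = N)"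

definition sf_eval :: "nat \<Rightarrow> cpoly \<Rightarrow> cpoly" where
  "sf_eval N f = (\<Sum>v\<in>Poly_Mapping.keys f. cconst (Poly_Mapping.lookup f v) * (\<Prod>k\<in>Poly_Mapping.keys v. psum N k ^ Poly_Mapping.lookup v k))"

definition zee :: "(nat \<Rightarrow>\<^sub>0 nat) \<Rightarrow> complex" where
  "zee v = (\<Prod>k\<in>Poly_Mapping.keys v. of_nat k ^ Poly_Mapping.lookup v k * of_nat (fact (Poly_Mapping.lookup v k)))"

definition plen :: "(nat \<Rightarrow>\<^sub>0 nat) \<Rightarrow> nat" where
  "plen v = (\<Sum>k\<in>Poly_Mapping.keys v. Poly_Mapping.lookup v k)"

definition jack_scal :: "complex \<Rightarrow> cpoly \<Rightarrow> cpoly \<Rightarrow> complex" where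
  "jack_scal \<alpha> f g = (\<Sum>v\<in>Poly_Mapping.keys f \<inter> Poly_Mapping.keys g. Poly_Mapping.lookup f v * Poly_Mapping.lookup g v * zee v * \<alpha> ^ plen v)"

text \<open>The family of Jack P-functions: P_lambda is homogeneous of degree |lambda|, of the form
  m_lambda + sum_(mu < lambda) u_(lambda mu) m_mu (checked on |lambda| variables, which is
  faithful in degree |lambda|), and the family is pairwise orthogonal.
  Non-partitions are sent to 0 to make the family unique.\<close>
definition jackP :: "complex \<Rightarrow> nat list \<Rightarrow> cpoly" where
  "jackP \<alpha> = (THE P.
     (\<forall>lam. \<not> is_partition lam \<longrightarrow> P lam = 0) \<and>
     (\<forall>lam. is_partition lam \<longrightarrow>
        homog_symfun (sum_list lam) (P lam) \<and>
        (\<exists>u. sf_eval (sum_list lam) (P lam) =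
               msym (sum_list lam) lam +
               (\<Sum>mu \<in> {mu. is_partition mu \<and> dominated mu lam \<and> mu \<noteq> lam}.
                   cconst (u mu) * msym (sum_list lam) mu))) \<and>
     (\<forall>lam mu. is_partition lam \<longrightarrow> is_partition mu \<longrightarrow> lam \<noteq> mu \<longrightarrow>
        jack_scal \<alpha> (P lam) (P mu) = 0))"

definition jack_c :: "complex \<Rightarrow> nat list \<Rightarrow> complex" where
  "jack_c \<alpha> lam = (\<Prod>(i, j)\<in>cells lam.
      \<alpha> * (of_nat (part lam i) - of_nat j) + of_nat (conj_part lam j) - of_nat i + 1)"

definition jack_c' :: "complex \<Rightarrow> nat list \<Rightarrow> complex" where
  "jack_c' \<alpha> lam = (\<Prod>(i, j)\<in>cells lam.
      \<alpha> * (of_nat (part lam i) - of_nat j + 1) + of_nat (conj_part lam j) - of_nat i)"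

definition jackQ :: "complex \<Rightarrow> nat list \<Rightarrow> cpoly" where
  "jackQ \<alpha> lam = cconst (jack_c \<alpha> lam / jack_c' \<alpha> lam) * jackP \<alpha> lam"

definition jackQ_poly :: "complex \<Rightarrow> nat \<Rightarrow> nat list \<Rightarrow> cpoly" where
  "jackQ_poly \<alpha> n lam = sf_eval n (jackQ \<alpha> lam)"

definition shiftF_coeff :: "(int \<Rightarrow> complex) \<Rightarrow> nat \<Rightarrow> nat \<Rightarrow> complex" where
  "shiftF_coeff d R j = trunc_coeffs R d (int j - int R)"

definition S_coeff :: "(int \<Rightarrow> complex) \<Rightarrow> nat \<Rightarrow> nat \<Rightarrow> (nat \<Rightarrow>\<^sub>0 nat) \<Rightarrow> complex" where
  "S_coeff d n R a = (if Poly_Mapping.keys a \<subseteq> {..<n} then (\<Prod>k<n. shiftF_coeff d R (Poly_Mapping.lookup a k)) else 0)"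

definition S_component :: "(int \<Rightarrow> complex) \<Rightarrow> nat \<Rightarrow> nat \<Rightarrow> nat \<Rightarrow> cpoly" where
  "S_component d n R N = (\<Sum>a \<in> {a. Poly_Mapping.keys a \<subseteq> {..<n} \<and> (\<Sum>k<n. Poly_Mapping.lookup a k) = N}.
                             Poly_Mapping.single a (S_coeff d n R a))"

definition gamma :: "(int \<Rightarrow> complex) \<Rightarrow> nat \<Rightarrow> nat \<Rightarrow> nat \<Rightarrow> complex" where
  "gamma d n m R = (THE c. \<exists>b.
      S_component d n R (n * R) =
        (\<Sum>lam \<in> {lam. is_partition lam \<and> sum_list lam = n * R \<and> length lam \<le> n}.
            cconst (b lam) * jackQ_poly (1 / of_nat m) n lam)
      \<and> b (rect n R) = c)"

end

theory Submission
  imports Defs "HOL-Combinatorics.List_Permutation" "HOL-Computational_Algebra.Polynomial_FPS"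
begin

text \<open>
  Expanding the alternating sums turns the hyperdeterminant into a constant term: up to
  \<open>n!\<close> it is the constant term of \<open>S\<^sub>f (x\<^sub>1 \<cdots> x\<^sub>n)\<^sup>-\<^sup>R\<close> against the torus weight
  \<open>\<Prod>\<^sub>i\<^sub>\<noteq>\<^sub>j (1 - x\<^sub>i / x\<^sub>j)\<^sup>m\<close>. In \<open>n\<close> variables the Jack polynomial of the rectangle \<open>(R\<^sup>n)\<close> is
  \<open>(x\<^sub>1 \<cdots> x\<^sub>n)\<^sup>R\<close>, so once the other Jack polynomials of degree \<open>n R\<close> are known to be orthogonal
  to it on the torus, only the coefficient \<open>\<gamma>\<close> survives, multiplied by \<open>c / c'\<close> of the rectangle.

  Jack functions at a fixed parameter \<open>\<alpha>\<close> cannot be obtained from the Laplace-Beltrami operator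
  alone, because its eigenvalues may collide on incomparable partitions (already for \<open>(4,1,1)\<close> and
  \<open>(3,3)\<close>). Instead they are the eigenvectors of a Nazarov-Sklyanin Hamiltonian
  \<open>\<Sum>\<^sub>l t\<^sup>l E L\<^sup>l E\<^sup>*\<close>, whose Lax matrix \<open>L\<close>, written in the power sums and their derivatives, is
  symmetric for the Jack scalar product at sight. In \<open>n\<close> variables it becomes
  \<open>\<Sum>\<^sub>l t\<^sup>l \<Sum>\<^sub>i (D\<^sub>i + N - n)\<^sup>l D\<^sub>i\<close> with the Dunkl operators
  \<open>D\<^sub>i = \<alpha> x\<^sub>i \<partial>\<^sub>i + \<Sum>\<^sub>j x\<^sub>i (1 - s\<^sub>i\<^sub>j) / (x\<^sub>i - x\<^sub>j)\<close>, hence is triangular for the dominance order;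
  the generating function of its eigenvalues is a rational function that determines the partition,
  so a generic \<open>t\<close> separates all partitions of \<open>N\<close>. For \<open>\<alpha> = 1/m\<close> each \<open>D\<^sub>i\<close> acts under the constant
  term against \<open>(x\<^sub>1 \<cdots> x\<^sub>n)\<^sup>-\<^sup>R\<close> as the scalar \<open>R/m\<close>, which gives the orthogonality on the torus.
\<close>

section \<open>Linear operators on polynomials\<close>

text \<open>Both \<open>jackP\<close> and \<open>gamma\<close> are definite descriptions, so nothing
  is known about them before existence and uniqueness are proved; most of the development therefore
  rebuilds the Jack functions at one fixed positive parameter. The obstacle is that three demands
  meet in one operator. Self-adjointness concerns a product given on power sums, triangularity is
  read off monomials in at least N variables, and the torus argument lives in exactly n variables.
  The Lax matrix acts on \<Lambda> itself and is carried to every number of variables at once; that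
  number enters only as p_0, which explains the shift by N - n. A single Dunkl operator destroys
  symmetry, so dominance is expressed by subset sums of exponent vectors, not by sorted lists. The
  same calculus of leading monomials yields both the eigenvalues and the logarithmic derivative of
  the Vandermonde determinant. The normalising constant is never evaluated: it is nonzero as a sum
  of squares of integers, and it cancels from the final formula.\<close>

abbreviation lookup where "lookup \<equiv> Poly_Mapping.lookup"
abbreviation keys where "keys \<equiv> Poly_Mapping.keys"
abbreviation single where "single \<equiv> Poly_Mapping.single"

abbreviation mon :: "(nat \<Rightarrow>\<^sub>0 nat) \<Rightarrow> cpoly" where "mon a \<equiv> single a 1"
definition ue :: "nat \<Rightarrow> (nat \<Rightarrow>\<^sub>0 nat)" where "ue k = single k 1"

lemma lookup_ue [simp]: "lookup (ue k) j = (if j = k then 1 else 0)"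
  by (simp add: ue_def lookup_single when_def)

definition X :: "nat \<Rightarrow> cpoly" where "X i = mon (ue i)"

lemma cconst_add: "cconst (a + b) = cconst a + cconst b"
  by (simp add: cconst_def single_add)

lemma cconst_diff: "cconst (a - b) = cconst a - cconst b"
  by (simp add: cconst_def single_diff)

lemma cconst_uminus: "cconst (- a) = - cconst a"
  by (simp add: cconst_def single_uminus)

lemma cconst_mult: "cconst (a * b) = cconst a * cconst b"
  by (simp add: cconst_def mult_single)

lemma cconst_0 [simp]: "cconst 0 = 0"
  by (simp add: cconst_def)

lemma cconst_1 [simp]: "cconst 1 = 1"
  by (simp add: cconst_def)

lemma cconst_of_nat: "cconst (of_nat n) = of_nat n"
  by (simp add: cconst_def)

lemma mult_cancel_cconst: "c \<noteq> 0 \<Longrightarrow> cconst (inverse c) * (cconst c * f) = f"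
  by (simp add: cconst_mult [symmetric] mult.assoc [symmetric])

text \<open>Subtraction of exponents is truncated, so the guard that \<open>a\<close> lies below
  \<open>b\<close> has to accompany the quotient monomial \<open>b - a\<close>.\<close>

lemma lookup_single_mult:
  "lookup (single a c * f) b = (if \<forall>i. lookup a i \<le> lookup b i then c * lookup f (b - a) else 0)"
  for f :: cpoly
proof -
  have eq: "b = a + q \<longleftrightarrow> (\<forall>i. lookup a i \<le> lookup b i) \<and> q = b - a" for q
  proof
    assume "b = a + q" thus "(\<forall>i. lookup a i \<le> lookup b i) \<and> q = b - a"
      by (simp add: lookup_add)
  next
    assume *: "(\<forall>i. lookup a i \<le> lookup b i) \<and> q = b - a"
    show "b = a + q"
      by (rule poly_mapping_eqI) (use * in \<open>auto simp: lookup_add lookup_minus\<close>)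
  qed
  have "lookup (single a c * f) b = Sum_any (\<lambda>l. (c when a = l) * Sum_any (\<lambda>q. lookup f q when b = l + q))"
    by (simp add: lookup_mult lookup_single)
  also have "\<dots> = c * Sum_any (\<lambda>q. lookup f q when b = a + q)"
    by (simp add: when_mult)
  also have "\<dots> = (if \<forall>i. lookup a i \<le> lookup b i then c * lookup f (b - a) else 0)"
    unfolding eq by (cases "\<forall>i. lookup a i \<le> lookup b i") (auto simp: when_def [symmetric])
  finally show ?thesis .
qed

lemma lookup_cconst_mult [simp]: "lookup (cconst c * f) a = c * lookup f a"
  by (simp add: cconst_def lookup_single_mult)

lemma cpoly_expand: "f = (\<Sum>a\<in>keys f. cconst (lookup f a) * mon a)" for f :: cpoly
proof (rule poly_mapping_eqI)
  fix k
  have "lookup f k = (\<Sum>a\<in>keys f. if a = k then lookup f a else 0)"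
    by (auto simp: in_keys_iff)
  also have "\<dots> = (\<Sum>a\<in>keys f. lookup f a * (if a = k then 1 else 0))"
    by (rule sum.cong) auto
  finally show "lookup f k = lookup (\<Sum>a\<in>keys f. cconst (lookup f a) * mon a) k"
    by (simp add: lookup_sum lookup_single lookup_ue when_def)
qed

text \<open>On the power-sum side this is induction on the number of factors of a product of power
  sums.\<close>

lemma expv_induct [case_names zero add]:
  assumes "P 0" and "\<And>v k. P v \<Longrightarrow> P (v + ue k)"
  shows "P (v :: nat \<Rightarrow>\<^sub>0 nat)"
proof (induction "\<Sum>k\<in>keys v. lookup v k" arbitrary: v rule: less_induct)
  case less
  show ?case
  proof (cases "v = 0")
    case True thus ?thesis using assms(1) by simp
  next
    case False
    then obtain k where k: "k \<in> keys v" by (metis keys_eq_empty ex_in_conv)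
    define w where "w = v - ue k"
    have vw: "v = w + ue k"
      using k by (intro poly_mapping_eqI)
        (auto simp: w_def lookup_add lookup_minus lookup_single lookup_ue when_def in_keys_iff)
    have "keys w \<subseteq> keys v" by (auto simp: w_def in_keys_iff lookup_minus)
    hence "(\<Sum>k\<in>keys w. lookup w k) = (\<Sum>k\<in>keys v. lookup w k)"
      by (intro sum.mono_neutral_left) (auto simp: in_keys_iff)
    also have "\<dots> < (\<Sum>k\<in>keys v. lookup v k)"
      by (rule sum_strict_mono_ex1) (use k in \<open>auto simp: w_def lookup_minus lookup_single lookup_ue when_def in_keys_iff\<close>)
    finally have "P w" by (rule less)
    thus ?thesis unfolding vw by (rule assms(2))
  qed
qed

definition clin :: "(cpoly \<Rightarrow> cpoly) \<Rightarrow> bool" where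
  "clin T \<longleftrightarrow> (\<forall>f g. T (f + g) = T f + T g) \<and> (\<forall>c f. T (cconst c * f) = cconst c * T f)"

lemma clinI: "(\<And>f g. T (f + g) = T f + T g) \<Longrightarrow> (\<And>c f. T (cconst c * f) = cconst c * T f) \<Longrightarrow> clin T"
  by (auto simp: clin_def)

lemma clin_add: "clin T \<Longrightarrow> T (f + g) = T f + T g"
  by (auto simp: clin_def)

lemma clin_scale: "clin T \<Longrightarrow> T (cconst c * f) = cconst c * T f"
  by (auto simp: clin_def)

lemma clin_0: "clin T \<Longrightarrow> T 0 = 0"
  using clin_scale[of T 0 0] by simp

lemma clin_uminus: "clin T \<Longrightarrow> T (- f) = - T f"
  using clin_scale[of T "-1" f] by (simp add: cconst_uminus)

lemma clin_diff: "clin T \<Longrightarrow> T (f - g) = T f - T g"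
  using clin_add[of T f "- g"] by (simp add: clin_uminus)

lemma clin_sum: "clin T \<Longrightarrow> T (sum f A) = (\<Sum>x\<in>A. T (f x))"
  by (induction A rule: infinite_finite_induct) (auto simp: clin_add clin_0)

text \<open>Agreement is asked only on the monomials of the given \<open>f\<close>, because the
  chain rule \<open>theta_sf_eval\<close> sums over a fixed finite set of indices and so holds only
  for monomials supported there.\<close>

lemma clin_eqI:
  assumes "clin S" "clin T" "\<And>a. a \<in> keys f \<Longrightarrow> S (mon a) = T (mon a)"
  shows "S f = T f"
proof -
  have "S f = (\<Sum>a\<in>keys f. cconst (lookup f a) * S (mon a))"
    by (subst cpoly_expand[of f]) (simp only: clin_sum[OF assms(1)] clin_scale[OF assms(1)])
  also have "\<dots> = (\<Sum>a\<in>keys f. cconst (lookup f a) * T (mon a))"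
    using assms(3) by simp
  also have "\<dots> = T f"
    by (subst (3) cpoly_expand[of f]) (simp only: clin_sum[OF assms(2)] clin_scale[OF assms(2)])
  finally show ?thesis .
qed

lemma clin_plus: "clin S \<Longrightarrow> clin T \<Longrightarrow> clin (\<lambda>f. S f + T f)"
  by (auto simp: clin_def algebra_simps)

lemma clin_minus: "clin S \<Longrightarrow> clin T \<Longrightarrow> clin (\<lambda>f. S f - T f)"
  by (auto simp: clin_def algebra_simps)

lemma clin_mult: "clin T \<Longrightarrow> clin (\<lambda>f. h * T f)"
  by (auto simp: clin_def algebra_simps)

lemma clin_mult_right: "clin T \<Longrightarrow> clin (\<lambda>f. T f * h)"
  by (auto simp: clin_def algebra_simps)

lemma clin_id: "clin (\<lambda>f. f)"
  by (auto simp: clin_def)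

lemma clin_zero: "clin (\<lambda>f. 0)"
  by (auto simp: clin_def)

lemma clin_compose: "clin S \<Longrightarrow> clin T \<Longrightarrow> clin (\<lambda>f. S (T f))"
  by (auto simp: clin_def)

lemma clin_setsum: "(\<And>x. x \<in> A \<Longrightarrow> clin (T x)) \<Longrightarrow> clin (\<lambda>f. \<Sum>x\<in>A. T x f)"
  by (induction A rule: infinite_finite_induct) (auto simp: clin_zero intro: clin_plus)

lemma clin_funpow: "clin T \<Longrightarrow> clin (T ^^ l)"
  by (induction l) (auto simp: clin_def)

lemmas clin_intros = clin_plus clin_minus clin_mult clin_mult_right clin_id clin_zero clin_setsum clin_funpow

definition linext :: "((nat \<Rightarrow>\<^sub>0 nat) \<Rightarrow> cpoly) \<Rightarrow> cpoly \<Rightarrow> cpoly" where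
  "linext \<phi> f = (\<Sum>a\<in>keys f. cconst (lookup f a) * \<phi> a)"

lemma linext_superset:
  "finite S \<Longrightarrow> keys f \<subseteq> S \<Longrightarrow> linext \<phi> f = (\<Sum>a\<in>S. cconst (lookup f a) * \<phi> a)"
  unfolding linext_def by (rule sum.mono_neutral_left) (auto simp: in_keys_iff)

lemma linext_mon [simp]: "linext \<phi> (mon a) = \<phi> a"
  by (simp add: linext_def)

lemma clin_linext: "clin (linext \<phi>)"
proof (rule clinI)
  fix f g :: cpoly
  have "linext \<phi> (f + g) = (\<Sum>a\<in>keys f \<union> keys g. cconst (lookup (f + g) a) * \<phi> a)"
    by (rule linext_superset) (auto simp: in_keys_iff lookup_add)
  moreover have "linext \<phi> f = (\<Sum>a\<in>keys f \<union> keys g. cconst (lookup f a) * \<phi> a)"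
    by (rule linext_superset) auto
  moreover have "linext \<phi> g = (\<Sum>a\<in>keys f \<union> keys g. cconst (lookup g a) * \<phi> a)"
    by (rule linext_superset) auto
  ultimately show "linext \<phi> (f + g) = linext \<phi> f + linext \<phi> g"
    by (simp add: lookup_add cconst_add algebra_simps sum.distrib)
next
  fix c and f :: cpoly
  have "linext \<phi> (cconst c * f) = (\<Sum>a\<in>keys f. cconst (lookup (cconst c * f) a) * \<phi> a)"
    by (rule linext_superset) (auto simp: in_keys_iff)
  thus "linext \<phi> (cconst c * f) = cconst c * linext \<phi> f"
    by (simp add: linext_def sum_distrib_left cconst_mult mult.assoc)
qed

lemma lookup_linext: "lookup (linext \<phi> f) b = (\<Sum>a\<in>keys f. lookup f a * lookup (\<phi> a) b)"
  by (simp add: linext_def lookup_sum)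

lemma bilin_eqI:
  assumes "\<And>g. clin (\<lambda>f. S f g)" "\<And>f. clin (S f)" "\<And>g. clin (\<lambda>f. T f g)" "\<And>f. clin (T f)"
    and "\<And>a b. S (mon a) (mon b) = T (mon a) (mon b)"
  shows "S f g = T f g"
proof (rule clin_eqI[OF assms(1,3)])
  fix a show "S (mon a) g = T (mon a) g"
    by (rule clin_eqI[OF assms(2,4)]) (rule assms(5))
qed

lemma mon_mult: "mon a * mon b = mon (a + b)"
  by (simp add: mult_single)

lemma linext_derivation:
  assumes "\<And>a b. \<phi> (a + b) = \<phi> a * mon b + mon a * \<phi> b"
  shows "linext \<phi> (f * g) = linext \<phi> f * g + f * linext \<phi> g"
proof (rule bilin_eqI[of "\<lambda>f g. linext \<phi> (f * g)" "\<lambda>f g. linext \<phi> f * g + f * linext \<phi> g"])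
  show "clin (\<lambda>f. linext \<phi> (f * g))" for g
    by (rule clin_compose[OF clin_linext clin_mult_right[OF clin_id]])
  show "clin (\<lambda>g. linext \<phi> (f * g))" for f
    by (rule clin_compose[OF clin_linext clin_mult[OF clin_id]])
qed (auto intro!: clin_plus clin_mult clin_mult_right clin_linext clin_id simp: assms mon_mult)

lemma linext_hom:
  assumes "\<And>a b. \<phi> (a + b) = \<phi> a * \<phi> b"
  shows "linext \<phi> (f * g) = linext \<phi> f * linext \<phi> g"
proof (rule bilin_eqI[of "\<lambda>f g. linext \<phi> (f * g)" "\<lambda>f g. linext \<phi> f * linext \<phi> g"])
  show "clin (\<lambda>f. linext \<phi> (f * g))" for g
    by (rule clin_compose[OF clin_linext clin_mult_right[OF clin_id]])
  show "clin (\<lambda>g. linext \<phi> (f * g))" for f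
    by (rule clin_compose[OF clin_linext clin_mult[OF clin_id]])
qed (auto intro!: clin_plus clin_mult clin_mult_right clin_linext clin_id simp: assms mon_mult)

section \<open>Euler operators x_i d/dx_i and partial derivatives\<close>

definition theta :: "nat \<Rightarrow> cpoly \<Rightarrow> cpoly" where
  "theta i = linext (\<lambda>a. cconst (of_nat (lookup a i)) * mon a)"

definition pd :: "nat \<Rightarrow> cpoly \<Rightarrow> cpoly" where
  "pd k = linext (\<lambda>a. cconst (of_nat (lookup a k)) * mon (a - ue k))"

lemma clin_theta: "clin (theta i)"
  unfolding theta_def by (rule clin_linext)

lemma clin_pd: "clin (pd k)"
  unfolding pd_def by (rule clin_linext)

lemma lookup_theta: "lookup (theta i f) a = of_nat (lookup a i) * lookup f a"
proof -
  have "lookup (theta i f) a = (\<Sum>b\<in>keys f. if b = a then of_nat (lookup a i) * lookup f a else 0)"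
    unfolding theta_def lookup_linext
    by (rule sum.cong) (auto simp: lookup_single lookup_ue when_def)
  thus ?thesis by (auto simp: in_keys_iff)
qed

lemma theta_mult: "theta i (f * g) = theta i f * g + f * theta i g"
  unfolding theta_def by (rule linext_derivation)
    (simp add: lookup_add cconst_add algebra_simps mon_mult [symmetric])

lemma pd_mult: "pd k (f * g) = pd k f * g + f * pd k g"
  unfolding pd_def
proof (rule linext_derivation)
  fix a b :: "nat \<Rightarrow>\<^sub>0 nat"
  \<comment> \<open>If x_k does not divide the first factor, both sides vanish; otherwise the
    truncated subtraction is exact.\<close>
  have 1: "cconst (of_nat (lookup a k)) * mon (a + b - ue k) =
        cconst (of_nat (lookup a k)) * mon (a - ue k) * mon b" for a b :: "nat \<Rightarrow>\<^sub>0 nat"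
  proof (cases "lookup a k = 0")
    case False
    hence "a + b - ue k = (a - ue k) + b"
      by (intro poly_mapping_eqI) (auto simp: lookup_add lookup_minus lookup_single lookup_ue when_def)
    thus ?thesis by (simp add: mon_mult mult.assoc)
  qed auto
  show "cconst (of_nat (lookup (a + b) k)) * mon (a + b - ue k) =
      cconst (of_nat (lookup a k)) * mon (a - ue k) * mon b +
      mon a * (cconst (of_nat (lookup b k)) * mon (b - ue k))"
    unfolding lookup_add of_nat_add cconst_add distrib_right 1[of a b]
    using 1[of b a] by (simp only: add.commute[of b a] ac_simps)
qed

lemma pd_X: "pd k (X j) = (if j = k then 1 else 0)"
  by (auto simp: pd_def X_def lookup_single lookup_ue when_def)

lemma pd_1: "pd k 1 = 0"
  using linext_mon[of _ 0] by (simp add: pd_def)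

lemma theta_1: "theta i 1 = 0"
  by (rule poly_mapping_eqI) (simp add: lookup_theta lookup_one when_def)

lemma X_power: "X i ^ a = mon (single i a)"
  by (induction a) (simp_all add: X_def ue_def mon_mult single_add[symmetric])

lemma mon_add_single: "mon (v + ue k) = mon v * X k"
  by (simp add: X_def mon_mult)

section \<open>Evaluation of symmetric functions and divided differences\<close>

lemma sf_eval_eq_linext: "sf_eval n = linext (\<lambda>v. \<Prod>k\<in>keys v. psum n k ^ lookup v k)"
  by (rule ext) (simp add: sf_eval_def linext_def)

lemma clin_sf_eval: "clin (sf_eval n)"
  unfolding sf_eval_eq_linext by (rule clin_linext)

lemma prod_power_superset:
  assumes "finite K" "keys v \<subseteq> K"
  shows "(\<Prod>k\<in>keys v. g k ^ lookup v k) = (\<Prod>k\<in>K. (g k :: 'b :: comm_monoid_mult) ^ lookup v k)"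
  by (rule prod.mono_neutral_left) (use assms in \<open>auto simp: in_keys_iff\<close>)

lemma prod_power_keys_add:
  "(\<Prod>k\<in>keys (u + v). g k ^ lookup (u + v) k) =
   (\<Prod>k\<in>keys u. g k ^ lookup u k) * (\<Prod>k\<in>keys v. (g k :: 'b :: comm_monoid_mult) ^ lookup v k)"
proof -
  let ?K = "keys u \<union> keys v"
  have "(\<Prod>k\<in>keys (u + v). g k ^ lookup (u + v) k) = (\<Prod>k\<in>?K. g k ^ lookup (u + v) k)"
    by (rule prod_power_superset) (auto simp: in_keys_iff lookup_add)
  moreover have "(\<Prod>k\<in>keys u. g k ^ lookup u k) = (\<Prod>k\<in>?K. g k ^ lookup u k)"
    by (rule prod_power_superset) auto
  moreover have "(\<Prod>k\<in>keys v. g k ^ lookup v k) = (\<Prod>k\<in>?K. g k ^ lookup v k)"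
    by (rule prod_power_superset) auto
  ultimately show ?thesis
    by (simp only: lookup_add power_add prod.distrib)
qed

lemma sf_eval_mult: "sf_eval n (f * g) = sf_eval n f * sf_eval n g"
  unfolding sf_eval_eq_linext by (rule linext_hom) (rule prod_power_keys_add)

lemma sf_eval_mon: "sf_eval n (mon v) = (\<Prod>k\<in>keys v. psum n k ^ lookup v k)"
  by (simp add: sf_eval_eq_linext)

lemma sf_eval_X: "sf_eval n (X k) = psum n k"
  by (simp add: sf_eval_mon X_def ue_def)

lemma sf_eval_1: "sf_eval n 1 = 1"
  using sf_eval_mon[of n 0] by simp

lemma sf_eval_scale: "sf_eval n (cconst c * f) = cconst c * sf_eval n f"
  by (rule clin_scale[OF clin_sf_eval])

section \<open>Permutations of the variables\<close>

lemma lookup_map_key: "inj p \<Longrightarrow> lookup (Poly_Mapping.map_key p a) i = lookup a (p i)"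
  by (simp add: map_key.rep_eq)

text \<open>The substitution of x_(p i) for x_i. Exponents move along \<open>p\<close>, so exponent
  vectors are pulled back along the inverse, while coefficients are read off by pulling back along
  \<open>p\<close> itself (\<open>lookup_pact\<close>).\<close>

definition pact :: "(nat \<Rightarrow> nat) \<Rightarrow> cpoly \<Rightarrow> cpoly" where
  "pact p = linext (\<lambda>a. mon (Poly_Mapping.map_key (inv p) a))"

lemma clin_pact: "clin (pact p)"
  unfolding pact_def by (rule clin_linext)

lemma pact_mon: "pact p (mon a) = mon (Poly_Mapping.map_key (inv p) a)"
  by (simp add: pact_def)

lemma map_key_zero: "inj q \<Longrightarrow> Poly_Mapping.map_key q 0 = 0"
  by (rule poly_mapping_eqI) (simp add: lookup_map_key)

lemma pact_1: "bij p \<Longrightarrow> pact p 1 = 1"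
  using pact_mon[of p 0] by (simp add: map_key_zero bij_imp_bij_inv bij_is_inj)

lemma pact_mult:
  assumes "bij p"
  shows "pact p (f * g) = pact p f * pact p g"
  unfolding pact_def
proof (rule linext_hom)
  have inj: "inj (inv p)" using assms by (simp add: bij_imp_bij_inv bij_is_inj)
  show "mon (Poly_Mapping.map_key (inv p) (a + b)) =
      mon (Poly_Mapping.map_key (inv p) a) * mon (Poly_Mapping.map_key (inv p) b)" for a b
    by (simp add: mon_mult map_key_plus[OF inj])
qed

lemma pact_power: "bij p \<Longrightarrow> pact p (f ^ k) = pact p f ^ k"
  by (induction k) (simp_all add: pact_1 pact_mult)

lemma pact_prod: "bij p \<Longrightarrow> pact p (prod f A) = (\<Prod>x\<in>A. pact p (f x))"
  by (induction A rule: infinite_finite_induct) (simp_all add: pact_1 pact_mult)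

lemma lookup_pact:
  assumes "bij p"
  shows "lookup (pact p f) a = lookup f (Poly_Mapping.map_key p a)"
proof -
  have inj: "inj p" "inj (inv p)" using assms by (simp_all add: bij_imp_bij_inv bij_is_inj)
  have iff: "Poly_Mapping.map_key (inv p) b = a \<longleftrightarrow> b = Poly_Mapping.map_key p a" for b
  proof -
    have "Poly_Mapping.map_key p (Poly_Mapping.map_key (inv p) b) = b" for b :: "nat \<Rightarrow>\<^sub>0 nat"
      by (rule poly_mapping_eqI) (simp add: lookup_map_key inj bij_inv_eq_iff[OF assms])
    moreover have "Poly_Mapping.map_key (inv p) (Poly_Mapping.map_key p b) = b" for b :: "nat \<Rightarrow>\<^sub>0 nat"
      by (rule poly_mapping_eqI) (simp add: lookup_map_key inj surj_f_inv_f[OF bij_is_surj[OF assms]])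
    ultimately show ?thesis by metis
  qed
  have "lookup (pact p f) a = (\<Sum>b\<in>keys f. if b = Poly_Mapping.map_key p a then lookup f (Poly_Mapping.map_key p a) else 0)"
    unfolding pact_def lookup_linext
    by (rule sum.cong) (auto simp: lookup_single lookup_ue when_def iff)
  thus ?thesis by (auto simp: in_keys_iff)
qed

lemma map_key_single_inv:
  assumes "bij p"
  shows "Poly_Mapping.map_key (inv p) (single i c) = single (p i) c"
proof (rule poly_mapping_eqI)
  fix k
  have inj: "inj (inv p)" using assms by (simp add: bij_imp_bij_inv bij_is_inj)
  have "i = inv p k \<longleftrightarrow> p i = k" using assms by (metis bij_inv_eq_iff)
  thus "lookup (Poly_Mapping.map_key (inv p) (single i c)) k = lookup (single (p i) c) k"
    by (simp add: lookup_map_key[OF inj] lookup_single)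
qed

lemma pact_X: "bij p \<Longrightarrow> pact p (X i) = X (p i)"
  by (simp add: X_def ue_def pact_mon map_key_single_inv del: One_nat_def)

lemma pact_psum:
  assumes "p permutes {..<n}"
  shows "pact p (psum n k) = psum n k"
proof -
  have b: "bij p" using assms by (rule permutes_bij)
  have "pact p (psum n k) = (\<Sum>i<n. mon (single (p i) k))"
    by (simp add: psum_def clin_sum[OF clin_pact] pact_mon map_key_single_inv[OF b])
  also have "\<dots> = psum n k" unfolding psum_def
    by (rule sum.reindex_bij_betw[OF permutes_imp_bij[OF assms], of "\<lambda>i. mon (single i k)"])
  finally show ?thesis .
qed

lemma pact_sf_eval:
  assumes "p permutes {..<n}"
  shows "pact p (sf_eval n f) = sf_eval n f"
proof (rule clin_eqI[OF clin_compose[OF clin_pact clin_sf_eval] clin_sf_eval])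
  have b: "bij p" using assms by (rule permutes_bij)
  show "pact p (sf_eval n (mon a)) = sf_eval n (mon a)" for a
    by (simp add: sf_eval_mon pact_prod[OF b] pact_power[OF b] pact_psum[OF assms])
qed

section \<open>Divided differences and Dunkl operators\<close>

abbreviation sw :: "nat \<Rightarrow> nat \<Rightarrow> cpoly \<Rightarrow> cpoly" where "sw i j \<equiv> pact (transpose i j)"

definition upd2 :: "nat \<Rightarrow> nat \<Rightarrow> (nat \<Rightarrow>\<^sub>0 nat) \<Rightarrow> nat \<Rightarrow> nat \<Rightarrow> (nat \<Rightarrow>\<^sub>0 nat)" where
  "upd2 i j e c d = Poly_Mapping.update i c (Poly_Mapping.update j d e)"

lemma lookup_upd2: "lookup (upd2 i j e c d) l = (if l = i then c else if l = j then d else lookup e l)"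
  by (simp add: upd2_def lookup_update)

text \<open>The divided difference \<open>x\<^sub>i (f - s\<^sub>i\<^sub>j f) / (x\<^sub>i - x\<^sub>j)\<close>.\<close>
definition dd :: "nat \<Rightarrow> nat \<Rightarrow> cpoly \<Rightarrow> cpoly" where
  "dd i j = linext (\<lambda>e. if lookup e j \<le> lookup e i
     then \<Sum>c\<in>{lookup e j<..lookup e i}. mon (upd2 i j e c (lookup e i + lookup e j - c))
     else - (\<Sum>c\<in>{lookup e i<..lookup e j}. mon (upd2 i j e c (lookup e i + lookup e j - c))))"

lemma clin_dd: "clin (dd i j)"
  unfolding dd_def by (rule clin_linext)

lemma telescope_powers:
  fixes x y :: "'a :: comm_ring_1"
  assumes "b \<le> a"
  shows "(x - y) * (\<Sum>c\<in>{b<..a}. x ^ c * y ^ (a + b - c)) = x * (x ^ a * y ^ b - x ^ b * y ^ a)"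
proof -
  define k where "k = a - b"
  have a: "a = b + k" using assms by (simp add: k_def)
  have "(\<Sum>c\<in>{b<..a}. x ^ c * y ^ (a + b - c)) = (\<Sum>l<k. x ^ (b + Suc l) * y ^ (b + (k - Suc l)))"
    by (rule sum.reindex_bij_witness[of _ "\<lambda>l. b + Suc l" "\<lambda>c. c - Suc b"]) (auto simp: a algebra_simps)
  also have "\<dots> = x ^ Suc b * y ^ b * (\<Sum>l<k. y ^ (k - Suc l) * x ^ l)"
    unfolding sum_distrib_left by (rule sum.cong) (simp_all only: power_add power_Suc mult_ac)
  finally have "(x - y) * (\<Sum>c\<in>{b<..a}. x ^ c * y ^ (a + b - c)) =
      x ^ Suc b * y ^ b * ((x - y) * (\<Sum>l<k. y ^ (k - Suc l) * x ^ l))"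
    by (simp add: algebra_simps)
  also have "\<dots> = x ^ Suc b * y ^ b * (x ^ k - y ^ k)"
    by (simp only: power_diff_sumr2)
  finally show ?thesis by (simp add: a power_add algebra_simps)
qed

lemma mon_upd2:
  assumes "i \<noteq> j"
  shows "mon (upd2 i j e c d) = mon (upd2 i j e 0 0) * (X i ^ c * X j ^ d)"
proof -
  have "upd2 i j e c d = upd2 i j e 0 0 + (single i c + single j d)"
    using assms by (intro poly_mapping_eqI) (auto simp: lookup_upd2 lookup_add lookup_single lookup_ue when_def)
  thus ?thesis by (simp add: X_power mon_mult)
qed

lemma sw_mon: "sw i j (mon e) = mon (upd2 i j e (lookup e j) (lookup e i))"
proof -
  have "Poly_Mapping.map_key (transpose i j) e = upd2 i j e (lookup e j) (lookup e i)"
    by (rule poly_mapping_eqI) (auto simp: lookup_map_key lookup_upd2 transpose_def)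
  thus ?thesis by (simp add: pact_mon)
qed

lemma upd2_same: "upd2 i j e (lookup e i) (lookup e j) = e"
  by (rule poly_mapping_eqI) (simp add: lookup_upd2)

text \<open>The polynomials form a domain, so this equation determines \<open>dd i j f\<close>, and
  algebraic identities are derived from it alone. The explicit monomials in the definition serve the
  triangularity arguments.\<close>

lemma dd_eq:
  assumes "i \<noteq> j"
  shows "(X i - X j) * dd i j f = X i * (f - sw i j f)"
proof (rule clin_eqI[of "\<lambda>f. (X i - X j) * dd i j f" "\<lambda>f. X i * (f - sw i j f)"])
  fix e :: "nat \<Rightarrow>\<^sub>0 nat"
  define a b \<rho> where "a = lookup e i" and "b = lookup e j" and "\<rho> = mon (upd2 i j e 0 0)"
  have mu: "mon (upd2 i j e c d) = \<rho> * (X i ^ c * X j ^ d)" for c d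
    unfolding \<rho>_def by (rule mon_upd2[OF assms])
  have me: "mon e = \<rho> * (X i ^ a * X j ^ b)"
    using mu[of a b] upd2_same[of i j e] by (simp add: a_def b_def)
  have sw: "sw i j (mon e) = \<rho> * (X i ^ b * X j ^ a)"
    unfolding sw_mon using mu[of b a] by (simp add: a_def b_def)
  show "(X i - X j) * dd i j (mon e) = X i * (mon e - sw i j (mon e))"
  proof (cases "b \<le> a")
    case True
    hence "dd i j (mon e) = \<rho> * (\<Sum>c\<in>{b<..a}. X i ^ c * X j ^ (a + b - c))"
      by (simp add: dd_def mu a_def[symmetric] b_def[symmetric] sum_distrib_left)
    hence "(X i - X j) * dd i j (mon e) = \<rho> * ((X i - X j) * (\<Sum>c\<in>{b<..a}. X i ^ c * X j ^ (a + b - c)))"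
      by (simp only: ac_simps)
    also have "\<dots> = X i * (mon e - sw i j (mon e))"
      unfolding telescope_powers[OF True] sw unfolding me by (simp add: algebra_simps)
    finally show ?thesis .
  next
    case False
    hence ab: "a \<le> b" by simp
    have "dd i j (mon e) = - \<rho> * (\<Sum>c\<in>{a<..b}. X i ^ c * X j ^ (b + a - c))"
      using False by (simp add: dd_def mu a_def[symmetric] b_def[symmetric] sum_distrib_left sum_negf add.commute)
    hence "(X i - X j) * dd i j (mon e) = - \<rho> * ((X i - X j) * (\<Sum>c\<in>{a<..b}. X i ^ c * X j ^ (b + a - c)))"
      by (simp only: ac_simps)
    also have "\<dots> = X i * (mon e - sw i j (mon e))"
      unfolding telescope_powers[OF ab] sw unfolding me by (simp add: algebra_simps)
    finally show ?thesis .
  qed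
qed (intro clin_mult clin_minus clin_id clin_pact clin_dd)+

lemma X_diff_nonzero: "i \<noteq> j \<Longrightarrow> X i - X j \<noteq> 0"
proof
  assume "i \<noteq> j" "X i - X j = 0"
  hence "lookup (X i) (ue i) = lookup (X j) (ue i)" by (metis eq_iff_diff_eq_0)
  moreover have "ue j \<noteq> ue i" using \<open>i \<noteq> j\<close>
    by (metis lookup_ue zero_neq_one)
  ultimately show False by (simp add: X_def lookup_single lookup_ue when_def)
qed

lemma dd_unique: "i \<noteq> j \<Longrightarrow> (X i - X j) * g = X i * (f - sw i j f) \<Longrightarrow> dd i j f = g"
  using dd_eq[of i j f] X_diff_nonzero[of i j] by (metis mult_cancel_left)

lemma dd_mult_sym:
  assumes "i \<noteq> j" "sw i j h = h"
  shows "dd i j (f * h) = dd i j f * h"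
proof (rule dd_unique[OF assms(1)])
  show "(X i - X j) * (dd i j f * h) = X i * (f * h - sw i j (f * h))"
    using arg_cong[OF dd_eq[OF assms(1), of f], of "\<lambda>z. z * h"]
    by (simp add: pact_mult assms(2) algebra_simps)
qed

lemma dd_X_power:
  assumes "i \<noteq> j"
  shows "dd i j (X i ^ a) = (\<Sum>c=1..a. X i ^ c * X j ^ (a - c))"
proof (rule dd_unique[OF assms])
  have "sw i j (X i ^ a) = X j ^ a"
    by (simp add: pact_power pact_X)
  moreover have "{1..a} = {0<..a}" by auto
  ultimately show "(X i - X j) * (\<Sum>c=1..a. X i ^ c * X j ^ (a - c)) = X i * (X i ^ a - sw i j (X i ^ a))"
    using telescope_powers[of 0 a "X i" "X j"] by simp
qed

lemma dd_sym: "i \<noteq> j \<Longrightarrow> sw i j h = h \<Longrightarrow> dd i j h = 0"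
  by (rule dd_unique) auto

text \<open>A form of the Cherednik operators without a chosen ordering: all variables other than
  x_i enter alike, so permuting the variables permutes the operators.\<close>

definition dunkl :: "complex \<Rightarrow> nat \<Rightarrow> nat \<Rightarrow> cpoly \<Rightarrow> cpoly" where
  "dunkl \<alpha> n i f = cconst \<alpha> * theta i f + (\<Sum>j\<in>{..<n} - {i}. dd i j f)"

lemma clin_dunkl: "clin (dunkl \<alpha> n i)"
  unfolding dunkl_def [abs_def] by (intro clin_intros clin_theta clin_dd)

lemma theta_X: "theta i (X j ^ k) = (if i = j then cconst (of_nat k) * X j ^ k else 0)"
  by (auto simp: theta_def X_power lookup_single lookup_ue when_def)

lemma theta_psum: "i < n \<Longrightarrow> theta i (psum n k) = cconst (of_nat k) * X i ^ k"
proof -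
  assume "i < n"
  have "theta i (psum n k) = (\<Sum>j<n. theta i (X j ^ k))"
    by (simp add: psum_def clin_sum[OF clin_theta] X_power)
  also have "\<dots> = (\<Sum>j<n. if j = i then cconst (of_nat k) * X i ^ k else 0)"
    by (rule sum.cong) (auto simp: theta_X)
  also have "\<dots> = cconst (of_nat k) * X i ^ k" using \<open>i < n\<close> by simp
  finally show ?thesis .
qed

lemma psum_eq: "psum n k = (\<Sum>i<n. X i ^ k)"
  by (simp add: psum_def X_power)

text \<open>Chain rule for x_i d/dx_i through the power sums, proved one factor at a time by the
  product rule.\<close>

lemma theta_sf_eval:
  assumes "i < n" "finite K" "\<And>v. v \<in> keys f \<Longrightarrow> keys v \<subseteq> K"
  shows "theta i (sf_eval n f) = (\<Sum>k\<in>K. cconst (of_nat k) * X i ^ k * sf_eval n (pd k f))"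
proof (rule clin_eqI[of "\<lambda>f. theta i (sf_eval n f)" "\<lambda>f. \<Sum>k\<in>K. cconst (of_nat k) * X i ^ k * sf_eval n (pd k f)"])
  fix v assume "v \<in> keys f"
  hence "keys v \<subseteq> K" by (rule assms(3))
  thus "theta i (sf_eval n (mon v)) = (\<Sum>k\<in>K. cconst (of_nat k) * X i ^ k * sf_eval n (pd k (mon v)))"
  proof (induction v rule: expv_induct)
    case zero
    thus ?case by (simp add: sf_eval_1 theta_1 pd_1 clin_0[OF clin_sf_eval])
  next
    case (add v k)
    have "keys v \<subseteq> keys (v + ue k)" "k \<in> keys (v + ue k)"
      by (auto simp: in_keys_iff lookup_add)
    hence v: "keys v \<subseteq> K" "k \<in> K" using add.prems by auto
    note e = mon_add_single[of v k]
    have "(\<Sum>l\<in>K. cconst (of_nat l) * X i ^ l * sf_eval n (pd l (mon v * X k)))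
        = (\<Sum>l\<in>K. cconst (of_nat l) * X i ^ l * sf_eval n (pd l (mon v))) * psum n k
          + (\<Sum>l\<in>K. if l = k then sf_eval n (mon v) * (cconst (of_nat k) * X i ^ k) else 0)"
      unfolding sum_distrib_right sum.distrib[symmetric]
      by (rule sum.cong)
         (auto simp: pd_mult pd_X sf_eval_1 sf_eval_mult sf_eval_X clin_add[OF clin_sf_eval] clin_0[OF clin_sf_eval] algebra_simps)
    also have "\<dots> = theta i (sf_eval n (mon v)) * psum n k + sf_eval n (mon v) * theta i (psum n k)"
      using v assms(2) by (simp add: add.IH theta_psum[OF assms(1)])
    also have "\<dots> = theta i (sf_eval n (mon v * X k))"
      by (simp add: sf_eval_mult sf_eval_X theta_mult)
    finally show ?case unfolding e by simp
  qed
qed (intro clin_intros clin_compose[OF clin_theta clin_sf_eval] clin_compose[OF clin_sf_eval clin_pd])+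

section \<open>A self-adjoint Lax operator\<close>

abbreviation jweight :: "complex \<Rightarrow> (nat \<Rightarrow>\<^sub>0 nat) \<Rightarrow> complex" where
  "jweight \<alpha> v \<equiv> zee v * \<alpha> ^ plen v"

lemma jack_scal_superset:
  assumes "finite S" "keys f \<inter> keys g \<subseteq> S"
  shows "jack_scal \<alpha> f g = (\<Sum>v\<in>S. lookup f v * lookup g v * jweight \<alpha> v)"
  unfolding jack_scal_def mult.assoc[of _ "zee _"]
  by (rule sum.mono_neutral_left) (use assms in \<open>auto simp: in_keys_iff\<close>)

lemma jack_scal_left: "jack_scal \<alpha> f g = (\<Sum>v\<in>keys f. lookup f v * lookup g v * jweight \<alpha> v)"
  by (rule jack_scal_superset) auto

lemma jack_scal_sym: "jack_scal \<alpha> f g = jack_scal \<alpha> g f"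
  unfolding jack_scal_def by (rule sum.cong) auto

lemma jack_scal_add_right: "jack_scal \<alpha> f (g + h) = jack_scal \<alpha> f g + jack_scal \<alpha> f h"
  by (simp add: jack_scal_left lookup_add algebra_simps sum.distrib)

lemma jack_scal_scale_right: "jack_scal \<alpha> f (cconst c * g) = c * jack_scal \<alpha> f g"
  unfolding jack_scal_left lookup_cconst_mult by (simp add: sum_distrib_left mult_ac)

lemma jack_scal_diff_right: "jack_scal \<alpha> f (g - h) = jack_scal \<alpha> f g - jack_scal \<alpha> f h"
  by (simp add: jack_scal_left lookup_minus algebra_simps sum_subtractf)

lemma jack_scal_sum_right: "jack_scal \<alpha> f (\<Sum>x\<in>A. g x) = (\<Sum>x\<in>A. jack_scal \<alpha> f (g x))"
proof -
  have "jack_scal \<alpha> f 0 = 0" by (simp add: jack_scal_def)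
  thus ?thesis by (induction A rule: infinite_finite_induct) (auto simp: jack_scal_add_right)
qed

lemma jack_scal_sum_left: "jack_scal \<alpha> (\<Sum>x\<in>A. g x) f = (\<Sum>x\<in>A. jack_scal \<alpha> (g x) f)"
  using jack_scal_sum_right[of \<alpha> f g A] by (simp add: jack_scal_sym[of \<alpha> _ f])

lemma jack_scal_scale_left: "jack_scal \<alpha> (cconst c * g) f = c * jack_scal \<alpha> g f"
  by (simp add: jack_scal_sym[of \<alpha> _ f] jack_scal_scale_right)

lemma zee_superset:
  assumes "finite S" "keys v \<subseteq> S"
  shows "zee v = (\<Prod>k\<in>S. of_nat k ^ lookup v k * of_nat (fact (lookup v k)))"
  unfolding zee_def by (rule prod.mono_neutral_left) (use assms in \<open>auto simp: in_keys_iff\<close>)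

lemma plen_superset: "finite S \<Longrightarrow> keys v \<subseteq> S \<Longrightarrow> plen v = (\<Sum>k\<in>S. lookup v k)"
  unfolding plen_def by (rule sum.mono_neutral_left) (auto simp: in_keys_iff)

lemma wdeg_superset: "finite S \<Longrightarrow> keys v \<subseteq> S \<Longrightarrow> wdeg v = (\<Sum>k\<in>S. k * lookup v k)"
  unfolding wdeg_def by (rule sum.mono_neutral_left) (auto simp: in_keys_iff)

lemma keys_add_single: "keys (v + ue k) = insert k (keys v)"
  for v :: "nat \<Rightarrow>\<^sub>0 nat"
  by (auto simp: in_keys_iff lookup_add lookup_single lookup_ue when_def split: if_splits)

lemma plen_add_single: "plen (v + ue k) = plen v + 1"
proof -
  let ?S = "insert k (keys v)"
  have "plen (v + ue k) = (\<Sum>j\<in>?S. lookup v j + (if j = k then 1 else 0))"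
    by (subst plen_superset[of ?S]) (auto simp: keys_add_single lookup_add lookup_single lookup_ue when_def intro!: sum.cong)
  also have "\<dots> = plen v + 1"
    using plen_superset[of ?S v] by (simp add: sum.distrib subset_insertI)
  finally show ?thesis .
qed

lemma wdeg_add_single: "wdeg (v + ue k) = wdeg v + k"
proof -
  let ?S = "insert k (keys v)"
  have "wdeg (v + ue k) = (\<Sum>j\<in>?S. j * lookup v j + (if j = k then k else 0))"
    by (subst wdeg_superset[of ?S]) (auto simp: keys_add_single lookup_add lookup_single lookup_ue when_def intro!: sum.cong)
  also have "\<dots> = wdeg v + k"
    using wdeg_superset[of ?S v] by (simp add: sum.distrib subset_insertI)
  finally show ?thesis .
qed

lemma zee_add_single: "zee (v + ue k) = zee v * of_nat k * of_nat (lookup v k + 1)"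
proof -
  let ?S = "insert k (keys v)"
  have "zee (v + ue k) = (\<Prod>j\<in>?S. (of_nat j ^ lookup v j * of_nat (fact (lookup v j))) *
      (if j = k then of_nat k * of_nat (lookup v k + 1) else 1))"
    by (subst zee_superset[of ?S])
      (auto simp: keys_add_single lookup_add lookup_single lookup_ue when_def algebra_simps intro!: prod.cong)
  also have "\<dots> = zee v * (of_nat k * of_nat (lookup v k + 1))"
    using zee_superset[of ?S v] by (simp add: prod.distrib subset_insertI)
  finally show ?thesis by (simp add: mult.assoc)
qed

lemma add_single_eq_iff:
  "lookup a k \<noteq> 0 \<and> a - ue k = v \<longleftrightarrow> a = v + ue k" for a :: "nat \<Rightarrow>\<^sub>0 nat"
proof
  assume *: "lookup a k \<noteq> 0 \<and> a - ue k = v"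
  have "lookup a i = lookup v i + lookup (ue k) i" for i
    using * by (cases "i = k") (auto simp: lookup_minus lookup_single lookup_ue when_def)
  thus "a = v + ue k" by (intro poly_mapping_eqI) (simp add: lookup_add)
qed (auto simp: lookup_add)

lemma lookup_pd: "lookup (pd k g) v = of_nat (lookup v k + 1) * lookup g (v + ue k)"
proof -
  have "lookup (pd k g) v = (\<Sum>a\<in>keys g. if a = v + ue k then
      of_nat (lookup v k + 1) * lookup g (v + ue k) else 0)"
    unfolding pd_def lookup_linext
  proof (rule sum.cong)
    fix a assume "a \<in> keys g"
    show "lookup g a * lookup (cconst (of_nat (lookup a k)) * mon (a - ue k)) v =
      (if a = v + ue k then of_nat (lookup v k + 1) * lookup g (v + ue k) else 0)"
      using add_single_eq_iff[of a k v]
      by (cases "lookup a k = 0") (auto simp: lookup_single lookup_ue when_def lookup_add)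
  qed simp
  thus ?thesis by (auto simp: in_keys_iff)
qed

lemma lookup_X_mult_add: "lookup (X k * f) (v + ue k) = lookup f v"
  unfolding X_def lookup_single_mult by (simp add: lookup_add)

lemma keys_X_mult: "keys (X k * f) = (\<lambda>v. v + ue k) ` keys f"
proof (intro equalityI subsetI)
  fix u assume "u \<in> keys (X k * f)"
  hence *: "lookup (X k * f) u \<noteq> 0" by (simp add: in_keys_iff)
  hence "\<forall>i. lookup (ue k) i \<le> lookup u i" "lookup f (u - ue k) \<noteq> 0"
    unfolding X_def lookup_single_mult by (auto split: if_splits)
  moreover from this(1) have "lookup u k \<noteq> 0" by (auto dest: spec[of _ k])
  hence "u = (u - ue k) + ue k" using add_single_eq_iff[of u k "u - ue k"] by simp
  ultimately show "u \<in> (\<lambda>v. v + ue k) ` keys f" by (auto simp: in_keys_iff)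
next
  fix u assume "u \<in> (\<lambda>v. v + ue k) ` keys f"
  thus "u \<in> keys (X k * f)" by (auto simp: in_keys_iff lookup_X_mult_add)
qed

text \<open>One more part k multiplies z by k times the new multiplicity of k and the power of
  \<alpha> by \<alpha>. The multiplicity is exactly the factor that the derivative by p_k
  produces.\<close>

lemma jack_scal_adjoint:
  "jack_scal \<alpha> (X k * f) g = jack_scal \<alpha> f (cconst (\<alpha> * of_nat k) * pd k g)"
proof -
  have "jack_scal \<alpha> (X k * f) g =
      (\<Sum>v\<in>keys f. lookup f v * lookup g (v + ue k) * jweight \<alpha> (v + ue k))" (is "?L = _")
    unfolding jack_scal_left keys_X_mult
    by (subst sum.reindex) (auto simp: inj_on_def lookup_X_mult_add)
  thus ?thesis
    unfolding jack_scal_left[of \<alpha> f] lookup_cconst_mult lookup_pd zee_add_single plen_add_single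
    by (simp only: power_add power_one_right mult_ac)
qed

section \<open>Homogeneous symmetric functions\<close>

lemma homog_0 [simp]: "homog_symfun M 0"
  by (simp add: homog_symfun_def)

lemma homog_add: "homog_symfun M f \<Longrightarrow> homog_symfun M g \<Longrightarrow> homog_symfun M (f + g)"
  unfolding homog_symfun_def using keys_add[of f g] by blast

lemma homog_scale: "homog_symfun M f \<Longrightarrow> homog_symfun M (cconst c * f)"
  unfolding homog_symfun_def by (auto simp: in_keys_iff)

lemma homog_diff: "homog_symfun M f \<Longrightarrow> homog_symfun M g \<Longrightarrow> homog_symfun M (f - g)"
  using homog_add[of M f "cconst (-1) * g"] homog_scale[of M g "-1"] by (simp add: cconst_uminus)

lemma homog_sum: "(\<And>x. x \<in> A \<Longrightarrow> homog_symfun M (f x)) \<Longrightarrow> homog_symfun M (\<Sum>x\<in>A. f x)"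
  by (induction A rule: infinite_finite_induct) (auto simp: homog_add)

lemma homog_X_mult: "homog_symfun M f \<Longrightarrow> k > 0 \<Longrightarrow> homog_symfun (M + k) (X k * f)"
  unfolding homog_symfun_def keys_X_mult
  by (auto simp: wdeg_add_single keys_add_single)

lemma homog_pd: "homog_symfun (M + k) f \<Longrightarrow> homog_symfun M (pd k f)"
  unfolding homog_symfun_def
proof
  fix v assume *: "\<forall>v\<in>keys f. 0 \<notin> keys v \<and> wdeg v = M + k" and "v \<in> keys (pd k f)"
  hence "v + ue k \<in> keys f" by (auto simp: in_keys_iff lookup_pd)
  with * show "0 \<notin> keys v \<and> wdeg v = M"
    by (auto simp: wdeg_add_single keys_add_single)
qed

text \<open>An index that occurs is at most the weighted degree, and index 0 is excluded by
  homogeneity; hence sums over 1..N miss no derivative.\<close>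

lemma homog_keys_le:
  assumes "homog_symfun M f" "v \<in> keys f"
  shows "keys v \<subseteq> {1..M}"
proof
  fix k assume k: "k \<in> keys v"
  have "k \<le> k * lookup v k" using k by (auto simp: in_keys_iff)
  also have "\<dots> \<le> wdeg v" unfolding wdeg_def by (rule member_le_sum) (use k in auto)
  finally show "k \<in> {1..M}" using assms k
    by (auto simp: homog_symfun_def Suc_le_eq intro!: gr0I)
qed

text \<open>A vector \<open>F\<close> in \<open>\<Lambda>[w]\<close> is represented by its coefficients \<open>F a\<close> of \<open>w\<^sup>a\<close> for \<open>1 \<le> a \<le> N\<close>;
  \<open>lax_op\<close> is the matrix of the Dunkl operator of one variable \<open>w\<close> among infinitely many.\<close>
definition lax_entry :: "complex \<Rightarrow> nat \<Rightarrow> nat \<Rightarrow> nat \<Rightarrow> cpoly \<Rightarrow> cpoly" where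
  "lax_entry \<alpha> N a b f = (if a < b then X (b - a) * f
     else if b < a then cconst (\<alpha> * of_nat (a - b)) * pd (a - b) f
     else cconst ((\<alpha> - 1) * of_nat a + of_nat N) * f)"

definition lax_op :: "complex \<Rightarrow> nat \<Rightarrow> (nat \<Rightarrow> cpoly) \<Rightarrow> nat \<Rightarrow> cpoly" where
  "lax_op \<alpha> N F a = (\<Sum>b=1..N. lax_entry \<alpha> N a b (F b))"

text \<open>Divided differences annihilate a symmetric \<open>f\<close>, so its first Dunkl operator
  reduces to \<alpha> times the Euler operator in w; these are the coefficients of the result by the
  chain rule.\<close>

definition lax_in :: "complex \<Rightarrow> cpoly \<Rightarrow> nat \<Rightarrow> cpoly" where
  "lax_in \<alpha> f a = cconst (\<alpha> * of_nat a) * pd a f"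

text \<open>Summation over all variables that w may stand for, which turns w^a into p_a.\<close>

definition lax_out :: "nat \<Rightarrow> (nat \<Rightarrow> cpoly) \<Rightarrow> cpoly" where
  "lax_out N F = (\<Sum>a=1..N. X a * F a)"

text \<open>The series in \<open>t\<close> is cut off at \<open>K\<close>: finitely many
  coefficients suffice to separate the finitely many partitions of \<open>N\<close>.\<close>

definition hamiltonian :: "complex \<Rightarrow> nat \<Rightarrow> nat \<Rightarrow> complex \<Rightarrow> cpoly \<Rightarrow> cpoly" where
  "hamiltonian \<alpha> N K t f = (\<Sum>l<K. cconst (t ^ l) * lax_out N ((lax_op \<alpha> N ^^ l) (lax_in \<alpha> f)))"

definition vec_scal :: "complex \<Rightarrow> nat \<Rightarrow> (nat \<Rightarrow> cpoly) \<Rightarrow> (nat \<Rightarrow> cpoly) \<Rightarrow> complex" where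
  "vec_scal \<alpha> N F G = (\<Sum>a=1..N. jack_scal \<alpha> (F a) (G a))"

text \<open>Entries above the diagonal multiply by a power sum, those below are the adjoint
  derivatives, and the diagonal is scalar.\<close>

lemma lax_entry_adjoint: "jack_scal \<alpha> (lax_entry \<alpha> N a b f) g = jack_scal \<alpha> f (lax_entry \<alpha> N b a g)"
proof (cases a b rule: linorder_cases)
  case less thus ?thesis by (simp add: lax_entry_def jack_scal_adjoint)
next
  case equal thus ?thesis by (simp add: lax_entry_def jack_scal_scale_left jack_scal_scale_right)
next
  case greater
  thus ?thesis using jack_scal_adjoint[of \<alpha> "a - b" g f]
    by (simp add: lax_entry_def jack_scal_sym[of \<alpha> f] jack_scal_sym[of \<alpha> _ g])
qed

lemma lax_op_adjoint: "vec_scal \<alpha> N (lax_op \<alpha> N F) G = vec_scal \<alpha> N F (lax_op \<alpha> N G)"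
proof -
  have "vec_scal \<alpha> N (lax_op \<alpha> N F) G =
      (\<Sum>a=1..N. \<Sum>b=1..N. jack_scal \<alpha> (F b) (lax_entry \<alpha> N b a (G a)))"
    by (simp add: vec_scal_def lax_op_def jack_scal_sum_left lax_entry_adjoint)
  also have "\<dots> = (\<Sum>b=1..N. \<Sum>a=1..N. jack_scal \<alpha> (F b) (lax_entry \<alpha> N b a (G a)))"
    by (rule sum.swap)
  also have "\<dots> = vec_scal \<alpha> N F (lax_op \<alpha> N G)"
    by (simp add: vec_scal_def lax_op_def jack_scal_sum_right)
  finally show ?thesis .
qed

lemma lax_op_pow_adjoint:
  "vec_scal \<alpha> N ((lax_op \<alpha> N ^^ l) F) G = vec_scal \<alpha> N F ((lax_op \<alpha> N ^^ l) G)"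
  by (induction l arbitrary: F) (simp_all add: lax_op_adjoint funpow_swap1)

lemma lax_out_adjoint: "jack_scal \<alpha> (lax_out N F) g = vec_scal \<alpha> N F (lax_in \<alpha> g)"
  by (simp add: lax_out_def vec_scal_def lax_in_def jack_scal_sum_left jack_scal_adjoint)

lemma vec_scal_sym: "vec_scal \<alpha> N F G = vec_scal \<alpha> N G F"
  unfolding vec_scal_def by (rule sum.cong) (auto simp: jack_scal_sym)

lemma hamiltonian_adjoint:
  "jack_scal \<alpha> (hamiltonian \<alpha> N K t f) g = jack_scal \<alpha> f (hamiltonian \<alpha> N K t g)"
proof -
  have "jack_scal \<alpha> (lax_out N ((lax_op \<alpha> N ^^ l) (lax_in \<alpha> f))) g =
        jack_scal \<alpha> f (lax_out N ((lax_op \<alpha> N ^^ l) (lax_in \<alpha> g)))" for l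
    unfolding jack_scal_sym[of \<alpha> f] lax_out_adjoint lax_op_pow_adjoint
    by (subst vec_scal_sym) (simp only: lax_op_pow_adjoint)
  thus ?thesis
    by (simp add: hamiltonian_def jack_scal_sum_left jack_scal_sum_right jack_scal_scale_left jack_scal_scale_right)
qed

lemma clin_lax_entry: "clin (lax_entry \<alpha> N a b)"
  unfolding lax_entry_def [abs_def]
  by (cases a b rule: linorder_cases) (simp_all add: clin_mult clin_id clin_pd)

lemma lax_add:
  "lax_op \<alpha> N (\<lambda>a. F a + G a) = (\<lambda>a. lax_op \<alpha> N F a + lax_op \<alpha> N G a)"
  by (rule ext) (simp add: lax_op_def clin_add[OF clin_lax_entry] sum.distrib)

lemma lax_scale:
  "lax_op \<alpha> N (\<lambda>a. cconst c * F a) = (\<lambda>a. cconst c * lax_op \<alpha> N F a)"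
  by (rule ext) (simp add: lax_op_def clin_scale[OF clin_lax_entry] sum_distrib_left)

lemma clin_hamiltonian: "clin (hamiltonian \<alpha> N K t)"
proof -
  have 1: "(lax_op \<alpha> N ^^ l) (\<lambda>a. F a + G a) = (\<lambda>a. (lax_op \<alpha> N ^^ l) F a + (lax_op \<alpha> N ^^ l) G a)" for F G l
    by (induction l) (simp_all add: lax_add)
  have 2: "(lax_op \<alpha> N ^^ l) (\<lambda>a. cconst c * F a) = (\<lambda>a. cconst c * (lax_op \<alpha> N ^^ l) F a)" for F c l
    by (induction l) (simp_all add: lax_scale)
  have 3: "lax_in \<alpha> (f + g) = (\<lambda>a. lax_in \<alpha> f a + lax_in \<alpha> g a)"
    "lax_in \<alpha> (cconst c * f) = (\<lambda>a. cconst c * lax_in \<alpha> f a)" for f g c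
    by (auto simp: lax_in_def clin_add[OF clin_pd] clin_scale[OF clin_pd] distrib_left mult.left_commute)
  show ?thesis
  proof (rule clinI)
    show "hamiltonian \<alpha> N K t (f + g) = hamiltonian \<alpha> N K t f + hamiltonian \<alpha> N K t g" for f g
      by (simp add: hamiltonian_def 1 3 lax_out_def distrib_left sum.distrib)
    show "hamiltonian \<alpha> N K t (cconst c * f) = cconst c * hamiltonian \<alpha> N K t f" for c f
      unfolding hamiltonian_def 3(2) 2 lax_out_def sum_distrib_left by (simp only: mult.left_commute)
  qed
qed

text \<open>When w^a counts with degree a, the vector has total degree N. A component beyond index N
  would have negative degree, so cutting the matrix at N is exact.\<close>

abbreviation homog_vec :: "nat \<Rightarrow> (nat \<Rightarrow> cpoly) \<Rightarrow> bool" where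
  "homog_vec N F \<equiv> (\<forall>a\<in>{1..N}. homog_symfun (N - a) (F a))"

lemma homog_lax_op:
  assumes "homog_vec N F"
  shows "homog_vec N (lax_op \<alpha> N F)"
proof
  fix a assume a: "a \<in> {1..N}"
  show "homog_symfun (N - a) (lax_op \<alpha> N F a)"
    unfolding lax_op_def
  proof (rule homog_sum)
    fix b assume b: "b \<in> {1..N}"
    have h: "homog_symfun (N - b) (F b)" using assms b by blast
    show "homog_symfun (N - a) (lax_entry \<alpha> N a b (F b))"
    proof (cases a b rule: linorder_cases)
      case less
      hence "N - a = (N - b) + (b - a)" using b by auto
      moreover have "homog_symfun ((N - b) + (b - a)) (X (b - a) * F b)"
        using less by (intro homog_X_mult h) auto
      ultimately show ?thesis using less by (simp only: lax_entry_def if_True)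
    next
      case equal thus ?thesis using h by (simp add: lax_entry_def homog_scale)
    next
      case greater
      hence "N - b = (N - a) + (a - b)" using a by auto
      hence "homog_symfun (N - a) (pd (a - b) (F b))" using h by (intro homog_pd) (simp only:)
      thus ?thesis using greater by (simp add: lax_entry_def homog_scale)
    qed
  qed
qed

lemma homog_lax_pow: "homog_vec N F \<Longrightarrow> homog_vec N ((lax_op \<alpha> N ^^ l) F)"
proof (induction l)
  case (Suc l)
  show ?case using homog_lax_op[OF Suc.IH[OF Suc.prems]] by (simp only: funpow.simps o_apply)
qed (simp only: funpow.simps id_apply)

lemma homog_lax_in: "homog_symfun N f \<Longrightarrow> homog_vec N (lax_in \<alpha> f)"
  by (auto simp: lax_in_def intro!: homog_scale homog_pd)

lemma homog_lax_out: "homog_vec N F \<Longrightarrow> homog_symfun N (lax_out N F)"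
  unfolding lax_out_def
proof (rule homog_sum)
  fix a assume "homog_vec N F" "a \<in> {1..N}"
  thus "homog_symfun N (X a * F a)" using homog_X_mult[of "N - a" "F a" a] by auto
qed

lemma homog_hamiltonian: "homog_symfun N f \<Longrightarrow> homog_symfun N (hamiltonian \<alpha> N K t f)"
  unfolding hamiltonian_def
  by (intro homog_sum homog_scale homog_lax_out homog_lax_pow homog_lax_in)

section \<open>Passage to n variables by setting w = x_i\<close>

definition eval_at :: "nat \<Rightarrow> nat \<Rightarrow> nat \<Rightarrow> (nat \<Rightarrow> cpoly) \<Rightarrow> cpoly" where
  "eval_at N n i F = (\<Sum>a=1..N. X i ^ a * sf_eval n (F a))"

text \<open>The divided differences produce p_0, the number of variables, on the diagonal. To obtain
  an operator on \<Lambda> that is independent of n, the Lax matrix carries N in its place; the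
  difference is corrected here and vanishes for n = N.\<close>

definition dunkl_shift :: "complex \<Rightarrow> nat \<Rightarrow> nat \<Rightarrow> nat \<Rightarrow> cpoly \<Rightarrow> cpoly" where
  "dunkl_shift \<alpha> N n i f = dunkl \<alpha> n i f + cconst (of_nat N - of_nat n) * f"

lemma clin_dunkl_shift: "clin (dunkl_shift \<alpha> N n i)"
  unfolding dunkl_shift_def [abs_def] by (intro clin_intros clin_dunkl)

lemma permutes_swap_less: "i < n \<Longrightarrow> j < n \<Longrightarrow> transpose i j permutes {..<n}"
  by (rule permutes_swap_id) auto

lemma sum_split_at:
  fixes f :: "nat \<Rightarrow> 'a :: comm_monoid_add"
  assumes "1 \<le> b" "b \<le> N"
  shows "(\<Sum>a=1..N. f a) = (\<Sum>a=1..<b. f a) + f b + (\<Sum>k=1..N-b. f (b + k))"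
proof -
  have "{1..N} = insert b ({1..<b} \<union> {b+1..b+(N-b)})" using assms by auto
  also have "{b+1..b+(N-b)} = (\<lambda>k. b + k) ` {1..N-b}" by simp
  finally have "{1..N} = insert b ({1..<b} \<union> (\<lambda>k. b + k) ` {1..N-b})" .
  moreover have "b \<notin> {1..<b} \<union> (\<lambda>k. b + k) ` {1..N-b}" by auto
  ultimately have "(\<Sum>a=1..N. f a) = f b + sum f ({1..<b} \<union> (\<lambda>k. b + k) ` {1..N-b})"
    by (simp only:) (rule sum.insert, auto)
  moreover have "sum f ({1..<b} \<union> (\<lambda>k. b + k) ` {1..N-b}) = sum f {1..<b} + sum f ((\<lambda>k. b + k) ` {1..N-b})"
    by (rule sum.union_disjoint) auto
  moreover have "sum f ((\<lambda>k. b + k) ` {1..N-b}) = (\<Sum>k=1..N-b. f (b + k))"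
    by (subst sum.reindex) (auto simp: inj_on_def)
  ultimately show ?thesis by (simp only: ac_simps)
qed

lemma sf_eval_X_mult: "sf_eval n (X k * f) = psum n k * sf_eval n f"
  by (simp add: sf_eval_mult sf_eval_X)

lemma dunkl_ring_identity:
  fixes A B x h z y c M :: "'a :: comm_ring_1"
  shows "A * (B * x * h + z) + (y + (c - B) * x) * h + (M - c) * (x * h) =
      y * h + x * ((A * B - B + M) * h) + A * z"
  by (simp add: algebra_simps)

text \<open>One column of the Lax matrix. As \<open>sf_eval n f\<close> is symmetric, a divided
  difference acts on x_i^b only and gives the sum of x_i^c x_j^(b-c). Summing over j completes this
  to p_(b-c), at the cost of one x_i^b for each c. The Euler operator supplies the derivatives below
  the diagonal.\<close>

lemma dunkl_shift_monomial:
  assumes i: "i < n" and b: "b \<in> {1..N}" and h: "homog_symfun (N - b) f"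
  shows "dunkl_shift \<alpha> N n i (X i ^ b * sf_eval n f) = (\<Sum>a=1..N. X i ^ a * sf_eval n (lax_entry \<alpha> N a b f))"
proof -
  let ?h = "sf_eval n f"
  have dd1: "dd i j (X i ^ b * ?h) = (\<Sum>c=1..b. X i ^ c * X j ^ (b - c)) * ?h" if "j \<in> {..<n} - {i}" for j
    using that i by (simp add: dd_mult_sym dd_X_power pact_sf_eval permutes_swap_less)
  have "(\<Sum>j\<in>{..<n} - {i}. dd i j (X i ^ b * ?h)) = (\<Sum>c=1..b. X i ^ c * (\<Sum>j\<in>{..<n} - {i}. X j ^ (b - c))) * ?h"
    unfolding sum_distrib_left sum.swap[of _ "{..<n} - {i}" "{1..b}"] sum_distrib_right
    by (simp add: dd1 sum_distrib_right)
  also have "(\<Sum>c=1..b. X i ^ c * (\<Sum>j\<in>{..<n} - {i}. X j ^ (b - c))) = (\<Sum>c=1..b. X i ^ c * psum n (b - c) - X i ^ b)"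
  proof (rule sum.cong)
    fix c assume c: "c \<in> {1..b}"
    have "psum n (b - c) = X i ^ (b - c) + (\<Sum>j\<in>{..<n} - {i}. X j ^ (b - c))"
      unfolding psum_eq using i by (subst sum.remove[of _ i]) auto
    moreover have "X i ^ b = X i ^ c * X i ^ (b - c)" using c by (simp flip: power_add)
    ultimately show "X i ^ c * (\<Sum>j\<in>{..<n} - {i}. X j ^ (b - c)) = X i ^ c * psum n (b - c) - X i ^ b"
      by (simp add: algebra_simps)
  qed simp
  \<comment> \<open>The term c = b carries p_0 = n; with the b corrections by x_i^b this makes the
    diagonal contribution n - b.\<close>
  also have "\<dots> = (\<Sum>c=1..<b. X i ^ c * psum n (b - c)) + cconst (of_nat n - of_nat b) * X i ^ b"
  proof -
    have "(\<Sum>c=1..b. X i ^ c * psum n (b - c)) = X i ^ b * psum n (b - b) + (\<Sum>c=1..<b. X i ^ c * psum n (b - c))"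
      by (rule sum.last_plus) (use b in auto)
    moreover have "psum n (b - b) = of_nat n" by (simp add: psum_eq)
    ultimately show ?thesis
      by (simp only: sum_subtractf cconst_diff cconst_of_nat) (simp add: algebra_simps)
  qed
  finally have D: "(\<Sum>j\<in>{..<n} - {i}. dd i j (X i ^ b * ?h)) =
      ((\<Sum>c=1..<b. X i ^ c * psum n (b - c)) + cconst (of_nat n - of_nat b) * X i ^ b) * ?h" .
  have "theta i ?h = (\<Sum>k=1..N-b. cconst (of_nat k) * X i ^ k * sf_eval n (pd k f))"
    by (rule theta_sf_eval[OF i]) (use homog_keys_le[OF h] in auto)
  hence T: "theta i (X i ^ b * ?h) = cconst (of_nat b) * X i ^ b * ?h +
      (\<Sum>k=1..N-b. X i ^ (b + k) * (cconst (of_nat k) * sf_eval n (pd k f)))"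
    by (simp add: theta_mult theta_X sum_distrib_left power_add mult_ac)
  define Y where "Y = (\<Sum>c=1..<b. X i ^ c * psum n (b - c))"
  define Z where "Z = (\<Sum>k=1..N-b. X i ^ (b + k) * (cconst (of_nat k) * sf_eval n (pd k f)))"
  have "(\<Sum>a=1..<b. X i ^ a * sf_eval n (lax_entry \<alpha> N a b f)) = Y * ?h"
    unfolding Y_def sum_distrib_right by (rule sum.cong) (auto simp: lax_entry_def sf_eval_X_mult)
  moreover have "(\<Sum>k=1..N-b. X i ^ (b + k) * sf_eval n (lax_entry \<alpha> N (b + k) b f)) = cconst \<alpha> * Z"
    unfolding Z_def sum_distrib_left
    by (rule sum.cong) (simp_all add: lax_entry_def sf_eval_scale, simp add: cconst_mult mult_ac)
  moreover have "sf_eval n (lax_entry \<alpha> N b b f) =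
      (cconst \<alpha> * cconst (of_nat b) - cconst (of_nat b) + cconst (of_nat N)) * ?h"
    by (simp add: lax_entry_def sf_eval_scale) (simp add: cconst_mult cconst_add cconst_diff left_diff_distrib)
  ultimately have R: "(\<Sum>a=1..N. X i ^ a * sf_eval n (lax_entry \<alpha> N a b f)) =
     Y * ?h + X i ^ b * ((cconst \<alpha> * cconst (of_nat b) - cconst (of_nat b) + cconst (of_nat N)) * ?h) + cconst \<alpha> * Z"
    using b by (subst sum_split_at[of b N]) (simp_all only: atLeastAtMost_iff)
  show ?thesis
    unfolding dunkl_shift_def dunkl_def D T R Y_def[symmetric] Z_def[symmetric] cconst_diff by (rule dunkl_ring_identity)
qed

lemma dunkl_shift_eval_at:
  assumes "i < n" "homog_vec N F"
  shows "dunkl_shift \<alpha> N n i (eval_at N n i F) = eval_at N n i (lax_op \<alpha> N F)"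
proof -
  have "dunkl_shift \<alpha> N n i (eval_at N n i F) =
      (\<Sum>b=1..N. \<Sum>a=1..N. X i ^ a * sf_eval n (lax_entry \<alpha> N a b (F b)))"
    unfolding eval_at_def clin_sum[OF clin_dunkl_shift]
    by (rule sum.cong[OF refl], rule dunkl_shift_monomial) (use assms in auto)
  also have "\<dots> = (\<Sum>a=1..N. \<Sum>b=1..N. X i ^ a * sf_eval n (lax_entry \<alpha> N a b (F b)))"
    by (rule sum.swap)
  also have "\<dots> = eval_at N n i (lax_op \<alpha> N F)"
    by (simp add: eval_at_def lax_op_def clin_sum[OF clin_sf_eval] sum_distrib_left)
  finally show ?thesis .
qed

lemma dunkl_shift_pow_eval_at:
  assumes "i < n" "homog_vec N F"
  shows "(dunkl_shift \<alpha> N n i ^^ l) (eval_at N n i F) = eval_at N n i ((lax_op \<alpha> N ^^ l) F)"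
  by (induction l) (simp_all add: dunkl_shift_eval_at[OF assms(1) homog_lax_pow[OF assms(2)]])

lemma dunkl_sf_eval:
  assumes "i < n" "homog_symfun N f"
  shows "dunkl \<alpha> n i (sf_eval n f) = eval_at N n i (lax_in \<alpha> f)"
proof -
  have "theta i (sf_eval n f) = (\<Sum>k=1..N. cconst (of_nat k) * X i ^ k * sf_eval n (pd k f))"
    by (rule theta_sf_eval[OF assms(1)]) (use homog_keys_le[OF assms(2)] in auto)
  moreover have "(\<Sum>j\<in>{..<n} - {i}. dd i j (sf_eval n f)) = 0"
    using assms(1) by (intro sum.neutral ballI dd_sym pact_sf_eval permutes_swap_less) auto
  ultimately show ?thesis
    unfolding dunkl_def eval_at_def lax_in_def sf_eval_scale
    by (simp only: sum_distrib_left cconst_mult mult_ac add_0_right)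
qed

lemma sf_eval_lax_out: "sf_eval n (lax_out N F) = (\<Sum>i<n. eval_at N n i F)"
  unfolding lax_out_def eval_at_def clin_sum[OF clin_sf_eval] sf_eval_X_mult psum_eq sum_distrib_right
  by (rule sum.swap)

text \<open>Valid for every n. The case n = N, where the shift disappears, gives triangularity; the
  case of the n torus variables gives orthogonality to the rectangle.\<close>

theorem sf_eval_hamiltonian:
  assumes "homog_symfun N f"
  shows "sf_eval n (hamiltonian \<alpha> N K t f) =
    (\<Sum>l<K. cconst (t ^ l) * (\<Sum>i<n. (dunkl_shift \<alpha> N n i ^^ l) (dunkl \<alpha> n i (sf_eval n f))))"
  using assms
  by (simp add: hamiltonian_def clin_sum[OF clin_sf_eval] sf_eval_scale sf_eval_lax_out dunkl_sf_eval
      dunkl_shift_pow_eval_at homog_lax_in del: atLeastAtMost_iff)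

section \<open>Separation of eigenvalues\<close>

text \<open>Take a symmetric polynomial with leading exponents of which \<mu> u are equal to u, and
  apply the Dunkl operator of x_i to it l + 1 times. \<open>psi \<alpha> \<mu> l s\<close> is the
  factor gained by the coefficient of a leading monomial with exponent s in x_i; the recursion is
  the induction step of \<open>lookup_dunkl_pow_leading\<close>.\<close>

primrec psi :: "real \<Rightarrow> (nat \<Rightarrow> nat) \<Rightarrow> nat \<Rightarrow> nat \<Rightarrow> real" where
  "psi \<alpha> \<mu> 0 s = \<alpha> * real s"
| "psi \<alpha> \<mu> (Suc l) s = (\<alpha> * real s + (\<Sum>u<s. real (\<mu> u))) * psi \<alpha> \<mu> l s - (\<Sum>u<s. real (\<mu> u) * psi \<alpha> \<mu> l u)"

text \<open>The same factors summed over all variables, grouped by their exponent u: the coefficient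
  of \<open>t ^ l\<close> in an eigenvalue.\<close>

definition eps :: "real \<Rightarrow> (nat \<Rightarrow> nat) \<Rightarrow> nat \<Rightarrow> nat \<Rightarrow> real" where
  "eps \<alpha> \<mu> N l = (\<Sum>u\<le>N. real (\<mu> u) * psi \<alpha> \<mu> l u)"

text \<open>With \<mu> as multiplicities, the second summand counts the variables with exponent
  below \<open>s\<close>. These numbers parametrise the linear factors of
  \<open>eps_product_formula\<close>.\<close>

definition shifted :: "real \<Rightarrow> (nat \<Rightarrow> nat) \<Rightarrow> nat \<Rightarrow> real" where
  "shifted \<alpha> \<mu> s = \<alpha> * real s + (\<Sum>u<s. real (\<mu> u))"

lemma shifted_Suc: "shifted \<alpha> \<mu> (Suc s) - \<alpha> = shifted \<alpha> \<mu> s + real (\<mu> s)"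
  by (simp add: shifted_def algebra_simps)

lemma shifted_strict_mono: "\<alpha> > 0 \<Longrightarrow> s < t \<Longrightarrow> shifted \<alpha> \<mu> s + \<alpha> \<le> shifted \<alpha> \<mu> t"
proof (induction t)
  case (Suc t)
  have "shifted \<alpha> \<mu> t + \<alpha> \<le> shifted \<alpha> \<mu> (Suc t)" using shifted_Suc[of \<alpha> \<mu> t] by simp
  with Suc show ?case by (cases "s = t") auto
qed simp

abbreviation linfac :: "real \<Rightarrow> real fps" where "linfac c \<equiv> fps_of_poly [:1, - c:]"

lemma linfac_eq: "linfac c = 1 - fps_const c * fps_X"
  by (rule fps_ext) (auto simp: coeff_pCons fps_mult_fps_X_commute split: nat.split)

lemma fps_const_sum: "fps_const (\<Sum>x\<in>A. f x) = (\<Sum>x\<in>A. fps_const (f x))"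
  by (rule fps_ext) (simp add: fps_sum_nth fps_nth_fps_const sum.neutral)

text \<open>Write z for \<open>fps_X\<close>. In terms of \<omega>_s = 1 + z \<Psi>_s the recursion
  of \<open>psi\<close> says that \<omega>_s times the linear factor of \<open>shifted\<close> at s
  is R_s. Since R_(s+1) = R_s - z \<mu>_s \<omega>_s, the quotient of consecutive R_s is a ratio of
  two linear factors and the product telescopes, starting at R_0 = 1; R_(N+1) is the left factor of
  the claim.\<close>

lemma eps_product_formula:
  fixes \<alpha> :: real and \<mu> :: "nat \<Rightarrow> nat"
  assumes "(\<Sum>u\<le>N. \<mu> u) = N"
  shows "(1 - fps_const (real N) * fps_X - fps_X ^ 2 * Abs_fps (eps \<alpha> \<mu> N)) * (\<Prod>u\<le>N. linfac (shifted \<alpha> \<mu> u))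
       = (\<Prod>u\<le>N. linfac (shifted \<alpha> \<mu> (Suc u) - \<alpha>))"
proof -
  define \<Psi> where "\<Psi> s = Abs_fps (\<lambda>l. psi \<alpha> \<mu> l s)" for s
  define \<omega> where "\<omega> s = 1 + fps_X * \<Psi> s" for s
  define R where "R s = 1 - fps_X * (\<Sum>u<s. fps_const (real (\<mu> u)) * \<omega> u)" for s
  have \<Psi>: "\<Psi> s * linfac (shifted \<alpha> \<mu> s) = fps_const (\<alpha> * real s) - fps_X * (\<Sum>u<s. fps_const (real (\<mu> u)) * \<Psi> u)" for s
  proof (rule fps_ext)
    fix l
    have "\<Psi> s * linfac (shifted \<alpha> \<mu> s) = \<Psi> s - fps_const (shifted \<alpha> \<mu> s) * (fps_X * \<Psi> s)"
      unfolding linfac_eq by (simp add: algebra_simps)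
    thus "fps_nth (\<Psi> s * linfac (shifted \<alpha> \<mu> s)) l = fps_nth (fps_const (\<alpha> * real s) - fps_X * (\<Sum>u<s. fps_const (real (\<mu> u)) * \<Psi> u)) l"
      by (cases l) (simp_all add: \<Psi>_def shifted_def fps_sum_nth)
  qed
  have \<omega>: "\<omega> s * linfac (shifted \<alpha> \<mu> s) = R s" for s
  proof -
    have "\<omega> s * linfac (shifted \<alpha> \<mu> s) = linfac (shifted \<alpha> \<mu> s) + fps_X * (\<Psi> s * linfac (shifted \<alpha> \<mu> s))"
      by (simp add: \<omega>_def algebra_simps)
    also have "\<dots> = 1 - fps_X * (\<Sum>u<s. fps_const (real (\<mu> u))) - fps_X * (fps_X * (\<Sum>u<s. fps_const (real (\<mu> u)) * \<Psi> u))"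
      unfolding \<Psi> unfolding linfac_eq shifted_def fps_const_add[symmetric] fps_const_sum
      by (simp add: algebra_simps)
    also have "\<dots> = R s"
      by (simp add: R_def \<omega>_def algebra_simps sum.distrib sum_distrib_left)
    finally show ?thesis .
  qed
  have step: "R (Suc s) * linfac (shifted \<alpha> \<mu> s) = R s * linfac (shifted \<alpha> \<mu> (Suc s) - \<alpha>)" for s
  proof -
    have "R (Suc s) = R s - fps_X * (fps_const (real (\<mu> s)) * \<omega> s)"
      by (simp add: R_def algebra_simps)
    hence "R (Suc s) * linfac (shifted \<alpha> \<mu> s) =
        R s * linfac (shifted \<alpha> \<mu> s) - fps_X * (fps_const (real (\<mu> s)) * (\<omega> s * linfac (shifted \<alpha> \<mu> s)))"
      by (simp only: left_diff_distrib mult.assoc)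
    hence "R (Suc s) * linfac (shifted \<alpha> \<mu> s) =
        R s * linfac (shifted \<alpha> \<mu> s) - fps_X * (fps_const (real (\<mu> s)) * R s)"
      by (simp only: \<omega>)
    also have "\<dots> = R s * linfac (shifted \<alpha> \<mu> (Suc s) - \<alpha>)"
      unfolding shifted_Suc linfac_eq fps_const_add[symmetric] by (simp add: algebra_simps del: fps_const_add)
    finally show ?thesis .
  qed
  have prod: "R s * (\<Prod>u<s. linfac (shifted \<alpha> \<mu> u)) = (\<Prod>u<s. linfac (shifted \<alpha> \<mu> (Suc u) - \<alpha>))" for s
  proof (induction s)
    case (Suc s)
    have "R (Suc s) * (\<Prod>u<Suc s. linfac (shifted \<alpha> \<mu> u)) =
        (R (Suc s) * linfac (shifted \<alpha> \<mu> s)) * (\<Prod>u<s. linfac (shifted \<alpha> \<mu> u))"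
      by (simp only: prod.lessThan_Suc mult_ac)
    also have "\<dots> = (R s * (\<Prod>u<s. linfac (shifted \<alpha> \<mu> u))) * linfac (shifted \<alpha> \<mu> (Suc s) - \<alpha>)"
      by (simp only: step mult_ac)
    finally show ?case by (simp only: Suc.IH prod.lessThan_Suc)
  qed (simp add: R_def)
  have "(\<Sum>u\<le>N. fps_const (real (\<mu> u)) * \<Psi> u) = Abs_fps (eps \<alpha> \<mu> N)"
    by (rule fps_ext) (simp add: fps_sum_nth \<Psi>_def eps_def)
  moreover have "(\<Sum>u\<le>N. fps_const (real (\<mu> u))) = fps_const (real N)"
    unfolding fps_const_sum[symmetric] using assms by (metis of_nat_sum)
  moreover have "R (Suc N) = 1 - fps_X * (\<Sum>u\<le>N. fps_const (real (\<mu> u))) - fps_X ^ 2 * (\<Sum>u\<le>N. fps_const (real (\<mu> u)) * \<Psi> u)"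
    unfolding R_def lessThan_Suc_atMost \<omega>_def
    by (simp add: algebra_simps sum.distrib sum_distrib_left power2_eq_square)
  ultimately show ?thesis using prod[of "Suc N"]
    by (simp add: lessThan_Suc_atMost mult.commute[of fps_X])
qed

text \<open>\<open>t\<close> is the last index at which the two sequences differ, so in the
  cross-multiplied product formulas all factors from beyond it cancel. At the reciprocal of the
  larger value \<open>shifted \<alpha> \<nu> t\<close> the polynomial \<open>P \<nu>\<close>
  vanishes, whereas \<open>Q \<nu>\<close> and \<open>P \<mu>\<close> have only smaller parameters
  and do not.\<close>

lemma eps_separates_aux:
  assumes \<alpha>: "\<alpha> > 0" and sum: "(\<Sum>u\<le>N. \<mu> u) = N" "(\<Sum>u\<le>N. \<nu> u) = N"
    and eps: "\<And>l. eps \<alpha> \<mu> N l = eps \<alpha> \<nu> N l"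
    and t: "t \<le> N" "shifted \<alpha> \<mu> t < shifted \<alpha> \<nu> t"
    and after: "\<And>u. t < u \<Longrightarrow> u \<le> Suc N \<Longrightarrow> shifted \<alpha> \<mu> u = shifted \<alpha> \<nu> u"
  shows False
proof -
  \<comment> \<open>\<open>Q\<close> stops before \<open>t\<close>: its factor for u = t contains
    the value at t + 1, where the sequences already agree.\<close>
  define P Q where "P \<mu> = (\<Prod>u\<le>t. [:1, - shifted \<alpha> \<mu> u:])" and "Q \<mu> = (\<Prod>u<t. [:1, - (shifted \<alpha> \<mu> (Suc u) - \<alpha>):])"
    for \<mu> :: "nat \<Rightarrow> nat"
  define P2 Q2 where "P2 = (\<Prod>u\<in>{t<..N}. [:1, - shifted \<alpha> \<mu> u:])" and "Q2 = (\<Prod>u\<in>{t..N}. [:1, - (shifted \<alpha> \<mu> (Suc u) - \<alpha>):])"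
  define E where "E = 1 - fps_const (real N) * fps_X - fps_X ^ 2 * Abs_fps (eps \<alpha> \<mu> N)"
  have E: "E = 1 - fps_const (real N) * fps_X - fps_X ^ 2 * Abs_fps (eps \<alpha> \<nu> N)"
    using ext[of "eps \<alpha> \<mu> N" "eps \<alpha> \<nu> N", OF eps] by (simp add: E_def)
  have split: "(\<Prod>u\<le>N. f u) = (\<Prod>u\<le>t. f u) * (\<Prod>u\<in>{t<..N}. f u)"
    "(\<Prod>u\<le>N. f u) = (\<Prod>u<t. f u) * (\<Prod>u\<in>{t..N}. f u)" for f :: "nat \<Rightarrow> real poly"
  proof -
    have 1: "{..N} = {..t} \<union> {t<..N}" and 2: "{..N} = {..<t} \<union> {t..N}" using t by auto
    show "(\<Prod>u\<le>N. f u) = (\<Prod>u\<le>t. f u) * (\<Prod>u\<in>{t<..N}. f u)"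
      unfolding 1 by (rule prod.union_disjoint) auto
    show "(\<Prod>u\<le>N. f u) = (\<Prod>u<t. f u) * (\<Prod>u\<in>{t..N}. f u)"
      unfolding 2 by (rule prod.union_disjoint) auto
  qed
  have "P2 = (\<Prod>u\<in>{t<..N}. [:1, - shifted \<alpha> \<nu> u:])" "Q2 = (\<Prod>u\<in>{t..N}. [:1, - (shifted \<alpha> \<nu> (Suc u) - \<alpha>):])"
    unfolding P2_def Q2_def using after by (auto intro!: prod.cong)
  hence "(\<Prod>u\<le>N. [:1, - shifted \<alpha> \<mu> u:]) = P \<mu> * P2" "(\<Prod>u\<le>N. [:1, - shifted \<alpha> \<nu> u:]) = P \<nu> * P2"
    "(\<Prod>u\<le>N. [:1, - (shifted \<alpha> \<mu> (Suc u) - \<alpha>):]) = Q \<mu> * Q2"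
    "(\<Prod>u\<le>N. [:1, - (shifted \<alpha> \<nu> (Suc u) - \<alpha>):]) = Q \<nu> * Q2"
    unfolding P_def Q_def by (simp_all only: split(1)[of "\<lambda>u. [:1, - shifted \<alpha> _ u:]"] split(2)[of "\<lambda>u. [:1, - (shifted \<alpha> _ (Suc u) - \<alpha>):]"] P2_def Q2_def)
  hence eq: "E * fps_of_poly (P \<mu> * P2) = fps_of_poly (Q \<mu> * Q2)" "E * fps_of_poly (P \<nu> * P2) = fps_of_poly (Q \<nu> * Q2)"
    using eps_product_formula[OF sum(1), of \<alpha>] eps_product_formula[OF sum(2), of \<alpha>]
    unfolding E_def[symmetric] E[symmetric] fps_of_poly_prod[symmetric] by simp_all
  have "fps_of_poly (Q \<mu> * Q2) * fps_of_poly (P \<nu> * P2) = fps_of_poly (Q \<nu> * Q2) * fps_of_poly (P \<mu> * P2)"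
    unfolding eq[symmetric] by (simp add: mult_ac)
  hence "(Q \<mu> * Q2) * (P \<nu> * P2) = (Q \<nu> * Q2) * (P \<mu> * P2)"
    by (simp only: fps_of_poly_mult[symmetric] fps_of_poly_eq_iff)
  hence "(Q2 * P2) * (Q \<mu> * P \<nu>) = (Q2 * P2) * (Q \<nu> * P \<mu>)"
    by (simp only: mult_ac)
  moreover have "Q2 * P2 \<noteq> 0" by (simp add: Q2_def P2_def)
  ultimately have cancel: "Q \<mu> * P \<nu> = Q \<nu> * P \<mu>" by (simp only: mult_cancel_left) simp
  define x where "x = inverse (shifted \<alpha> \<nu> t)"
  have nonneg: "shifted \<alpha> \<mu> s \<ge> 0" for \<mu> s using \<alpha> by (auto simp: shifted_def intro!: add_nonneg_nonneg sum_nonneg)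
  have pos: "shifted \<alpha> \<nu> t > 0" using t(2) nonneg[of \<mu> t] by linarith
  have lt: "c < shifted \<alpha> \<nu> t \<Longrightarrow> 1 - x * c \<noteq> 0" for c
    using pos by (auto simp: x_def field_simps)
  have "poly (P \<nu>) x = 0"
    using pos by (auto simp: P_def poly_prod x_def intro!: bexI[of _ t])
  hence "poly (Q \<nu>) x * poly (P \<mu>) x = 0" by (metis cancel poly_mult mult_zero_right)
  moreover have "poly (Q \<nu>) x \<noteq> 0"
  proof -
    have "shifted \<alpha> \<nu> (Suc u) - \<alpha> < shifted \<alpha> \<nu> t" if "u < t" for u
      using shifted_strict_mono[OF \<alpha>, of "Suc u" t \<nu>] \<alpha> that by (cases "Suc u = t") auto
    hence "1 - x * (shifted \<alpha> \<nu> (Suc u) - \<alpha>) \<noteq> 0" if "u < t" for u using lt that by blast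
    thus ?thesis by (auto simp: Q_def poly_prod algebra_simps)
  qed
  moreover have "poly (P \<mu>) x \<noteq> 0"
  proof -
    have "shifted \<alpha> \<mu> u < shifted \<alpha> \<nu> t" if "u \<le> t" for u
      using shifted_strict_mono[OF \<alpha>, of u t \<mu>] \<alpha> that t(2) by (cases "u = t") auto
    hence "1 - x * shifted \<alpha> \<mu> u \<noteq> 0" if "u \<le> t" for u using lt that by blast
    thus ?thesis by (auto simp: P_def poly_prod algebra_simps)
  qed
  ultimately show False by simp
qed

lemma eps_separates:
  assumes \<alpha>: "\<alpha> > 0" and sum: "(\<Sum>u\<le>N. \<mu> u) = N" "(\<Sum>u\<le>N. \<nu> u) = N"
    and eps: "\<And>l. eps \<alpha> \<mu> N l = eps \<alpha> \<nu> N l" and "u \<le> N"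
  shows "\<mu> u = \<nu> u"
proof -
  have all: "shifted \<alpha> \<mu> s = shifted \<alpha> \<nu> s" if "s \<le> Suc N" for s
  proof (rule ccontr)
    assume s: "shifted \<alpha> \<mu> s \<noteq> shifted \<alpha> \<nu> s"
    define T where "T = {s. s \<le> Suc N \<and> shifted \<alpha> \<mu> s \<noteq> shifted \<alpha> \<nu> s}"
    have fin: "finite T" and ne: "T \<noteq> {}" using s that by (auto simp: T_def)
    define t where "t = Max T"
    have tT: "t \<in> T" unfolding t_def by (rule Max_in[OF fin ne])
    have after: "shifted \<alpha> \<mu> u = shifted \<alpha> \<nu> u" if "t < u" "u \<le> Suc N" for u
      using Max_ge[OF fin, of u] that unfolding t_def[symmetric] by (auto simp: T_def)
    \<comment> \<open>Both values are \<alpha> (N + 1) + N, so the last disagreement occurs at some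
      t \<le> N.\<close>
    have "shifted \<alpha> \<mu> (Suc N) = shifted \<alpha> \<nu> (Suc N)"
      using sum unfolding shifted_def lessThan_Suc_atMost by (metis of_nat_sum)
    with tT have tN: "t \<le> N" by (cases "t = Suc N") (auto simp: T_def)
    from tT consider "shifted \<alpha> \<mu> t < shifted \<alpha> \<nu> t" | "shifted \<alpha> \<nu> t < shifted \<alpha> \<mu> t"
      unfolding T_def by fastforce
    thus False
    proof cases
      case 1 show ?thesis by (rule eps_separates_aux[OF \<alpha> sum eps tN 1 after])
    next
      case 2 show ?thesis by (rule eps_separates_aux[OF \<alpha> sum(2,1) eps[symmetric] tN 2 after[symmetric]])
    qed
  qed
  have "real (\<mu> u) = real (\<nu> u)"
    using all[of u] all[of "Suc u"] shifted_Suc[of \<alpha> \<mu> u] shifted_Suc[of \<alpha> \<nu> u] \<open>u \<le> N\<close> by simp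
  thus ?thesis by simp
qed

section \<open>Dominance order on exponent vectors\<close>

lemma part_filter_nonzero:
  "sorted_wrt (\<ge>) ys \<Longrightarrow> part (filter (\<lambda>x. x \<noteq> 0) ys) (Suc k) = (if k < length ys then ys ! k else 0)"
proof (induction ys arbitrary: k)
  case (Cons y ys)
  show ?case
  proof (cases "y = 0")
    case True
    hence "\<forall>x\<in>set ys. x = 0" using Cons.prems by auto
    hence "filter (\<lambda>x. x \<noteq> 0) ys = []" by (simp add: filter_empty_conv)
    moreover have "(y # ys) ! k = 0" if "k < Suc (length ys)"
      using True \<open>\<forall>x\<in>set ys. x = 0\<close> that by (cases k) auto
    ultimately show ?thesis using True by (simp add: part_def)
  next
    case False
    show ?thesis
    proof (cases k)
      case 0 thus ?thesis using False by (simp add: part_def)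
    next
      case (Suc l)
      have "part (filter (\<lambda>x. x \<noteq> 0) ys) (Suc l) = (if l < length ys then ys ! l else 0)"
        by (rule Cons.IH) (use Cons.prems in auto)
      thus ?thesis using False Suc by (auto simp: part_def)
    qed
  qed
qed (simp add: part_def)

lemma exps_partition_eq_filter:
  "exps_partition N a = filter (\<lambda>x. x \<noteq> 0) (rev (sort (map (lookup a) [0..<N])))"
  unfolding exps_partition_def rev_filter[symmetric] filter_sort ..

lemma is_partition_exps: "is_partition (exps_partition N a)"
  unfolding is_partition_def exps_partition_def
  by (auto simp: sorted_wrt_rev)

lemma exps_partition_permutation:
  "\<exists>p. p permutes {..<N} \<and> (\<forall>k<N. part (exps_partition N a) (Suc k) = lookup a (p k))"
proof -
  define xs where "xs = map (lookup a) [0..<N]"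
  define ys where "ys = rev (sort xs)"
  have len: "length ys = N" "length xs = N" by (simp_all add: xs_def ys_def)
  have "mset ys = mset xs" by (simp add: ys_def)
  then obtain p where p: "p permutes {..<length xs}" "permute_list p xs = ys"
    by (rule mset_eq_permutation)
  have s: "sorted_wrt (\<ge>) ys" by (simp add: ys_def sorted_wrt_rev)
  have e: "exps_partition N a = filter (\<lambda>x. x \<noteq> 0) ys" by (simp add: exps_partition_eq_filter xs_def ys_def)
  have "part (exps_partition N a) (Suc k) = lookup a (p k)" if "k < N" for k
  proof -
    have "p k < N" using p(1) that len permutes_in_image[OF p(1), of k] by auto
    moreover have "ys ! k = xs ! p k" using p that len by (metis permute_list_nth)
    ultimately show ?thesis unfolding e part_filter_nonzero[OF s] using that len by (simp add: xs_def)
  qed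
  thus ?thesis using p(1) len by auto
qed

lemma part_antimono:
  assumes "is_partition lam" "i \<le> j"
  shows "part lam (Suc j) \<le> part lam (Suc i)"
proof (cases "i = j")
  case False
  thus ?thesis using assms by (auto simp: part_def is_partition_def sorted_wrt_iff_nth_less)
qed simp

lemma part_sum: "(\<Sum>i=1..l. part lam i) = (\<Sum>k<l. part lam (Suc k))"
  using sum.atLeast1_atMost_eq[of "part lam" l] by simp

lemma part_sum_all:
  assumes "length lam \<le> l"
  shows "(\<Sum>i=1..l. part lam i) = sum_list lam"
proof -
  have "(\<Sum>k<l. part lam (Suc k)) = (\<Sum>k<length lam. part lam (Suc k))"
    by (rule sum.mono_neutral_right) (use assms in \<open>auto simp: part_def\<close>)
  also have "\<dots> = (\<Sum>k<length lam. lam ! k)" by (rule sum.cong) (auto simp: part_def)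
  finally show ?thesis unfolding part_sum by (simp add: sum_list_sum_nth atLeast0LessThan)
qed

lemma part_sum_mono: "k \<le> l \<Longrightarrow> (\<Sum>i=1..k. part lam i) \<le> (\<Sum>i=1..l. part lam i)"
  by (rule sum_mono2) auto

lemma part_sum_le: "(\<Sum>i=1..l. part lam i) \<le> sum_list lam"
  using part_sum_mono[of l "max l (length lam)" lam] part_sum_all[of lam "max l (length lam)"] by simp

text \<open>Remove the largest index m of \<open>J\<close>: if \<open>J\<close> has c + 1 elements,
  m is at least c, so g m is at most g c.\<close>

lemma sum_antimono_le_prefix:
  fixes g :: "nat \<Rightarrow> nat"
  assumes "finite J" "\<And>i j. i \<le> j \<Longrightarrow> g j \<le> g i"
  shows "sum g J \<le> sum g {..<card J}"
  using assms(1)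
proof (induction "card J" arbitrary: J)
  case (Suc c)
  define m where "m = Max J"
  have ne: "J \<noteq> {}" using Suc.hyps(2) by auto
  have m: "m \<in> J" unfolding m_def using Suc.prems ne by simp
  have "J \<subseteq> {..m}" unfolding m_def using Suc.prems by auto
  hence "card J \<le> Suc m" using card_mono[of "{..m}" J] by simp
  hence "c \<le> m" using Suc.hyps(2) by simp
  have c: "card (J - {m}) = c" using m Suc by simp
  have "sum g J = g m + sum g (J - {m})" using m Suc.prems by (simp add: sum.remove)
  also have "\<dots> \<le> g c + sum g {..<c}"
    using Suc.hyps(1)[of "J - {m}"] c Suc.prems assms(2)[OF \<open>c \<le> m\<close>] by (intro add_mono) auto
  finally show ?case using Suc.hyps(2) by (simp flip: Suc.hyps(2))
qed simp

text \<open>Together with \<open>part_sum_attained\<close> this makes the l-th partial sum of the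
  sorted entries the maximum of the sums over l-element sets of positions, a description that needs
  no sorting.\<close>

lemma sum_le_part_sum:
  assumes "I \<subseteq> {..<N}"
  shows "(\<Sum>i\<in>I. lookup a i) \<le> (\<Sum>i=1..card I. part (exps_partition N a) i)"
proof -
  obtain p where p: "p permutes {..<N}" "\<And>k. k < N \<Longrightarrow> part (exps_partition N a) (Suc k) = lookup a (p k)"
    using exps_partition_permutation[of N a] by auto
  define J where "J = inv p ` I"
  have "J \<subseteq> inv p ` {..<N}" using assms unfolding J_def by (rule image_mono)
  also have "\<dots> = {..<N}" by (rule permutes_image[OF permutes_inv[OF p(1)]])
  finally have J: "J \<subseteq> {..<N}" .
  have I: "I = p ` J" using permutes_inverses(1)[OF p(1)] by (auto simp: J_def image_image)
  have inj: "inj_on p J" using permutes_inj[OF p(1)] by (rule inj_on_subset) simp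
  have "(\<Sum>i\<in>I. lookup a i) = (\<Sum>k\<in>J. lookup a (p k))" unfolding I by (rule sum.reindex[OF inj, unfolded o_def])
  also have "\<dots> = (\<Sum>k\<in>J. part (exps_partition N a) (Suc k))" by (rule sum.cong) (use J p(2) in auto)
  also have "\<dots> \<le> (\<Sum>k<card J. part (exps_partition N a) (Suc k))"
    by (rule sum_antimono_le_prefix) (use J finite_subset part_antimono[OF is_partition_exps] in auto)
  also have "card J = card I" unfolding I by (simp add: card_image[OF inj])
  finally show ?thesis unfolding part_sum .
qed

lemma part_sum_attained:
  assumes "l \<le> N"
  obtains I where "I \<subseteq> {..<N}" "card I = l" "(\<Sum>i\<in>I. lookup a i) = (\<Sum>i=1..l. part (exps_partition N a) i)"
proof -
  obtain p where p: "p permutes {..<N}" "\<And>k. k < N \<Longrightarrow> part (exps_partition N a) (Suc k) = lookup a (p k)"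
    using exps_partition_permutation[of N a] by auto
  have inj: "inj_on p {..<l}" using permutes_inj[OF p(1)] by (rule inj_on_subset) simp
  have "(\<Sum>i\<in>p ` {..<l}. lookup a i) = (\<Sum>k<l. lookup a (p k))" by (rule sum.reindex[OF inj, unfolded o_def])
  also have "\<dots> = (\<Sum>i=1..l. part (exps_partition N a) i)"
    unfolding part_sum by (rule sum.cong) (use p(2) assms in auto)
  finally have sum: "(\<Sum>i\<in>p ` {..<l}. lookup a i) = (\<Sum>i=1..l. part (exps_partition N a) i)" .
  have "p ` {..<l} \<subseteq> p ` {..<N}" using assms by (intro image_mono) auto
  also have "\<dots> = {..<N}" by (rule permutes_image[OF p(1)])
  finally show ?thesis using card_image[OF inj] sum by (intro that[of "p ` {..<l}"]) simp_all
qed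

lemma length_exps_partition: "length (exps_partition N a) \<le> N"
  unfolding exps_partition_eq_filter using length_filter_le[of _ "rev (sort (map (lookup a) [0..<N]))"] by simp

lemma sum_list_exps_partition: "sum_list (exps_partition N a) = (\<Sum>i<N. lookup a i)"
proof -
  obtain p where p: "p permutes {..<N}" "\<And>k. k < N \<Longrightarrow> part (exps_partition N a) (Suc k) = lookup a (p k)"
    using exps_partition_permutation[of N a] by auto
  have "sum_list (exps_partition N a) = (\<Sum>k<N. part (exps_partition N a) (Suc k))"
    using part_sum_all[OF length_exps_partition, of N a] unfolding part_sum by simp
  also have "\<dots> = (\<Sum>k<N. lookup a (p k))" using p(2) by simp
  also have "\<dots> = (\<Sum>i<N. lookup a i)" by (rule sum.reindex_bij_betw[OF permutes_imp_bij[OF p(1)]])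
  finally show ?thesis .
qed

text \<open>Dominance without sorting. Monomials produced by one Dunkl operator are not symmetric in
  the variables, and subset sums are easy to follow when only two entries change.\<close>

definition vec_bounded :: "nat \<Rightarrow> (nat \<Rightarrow> nat) \<Rightarrow> (nat \<Rightarrow>\<^sub>0 nat) \<Rightarrow> bool" where
  "vec_bounded N B e \<longleftrightarrow> keys e \<subseteq> {..<N} \<and> (\<forall>I\<subseteq>{..<N}. (\<Sum>i\<in>I. lookup e i) \<le> B (card I))"

definition dom_bounded :: "nat \<Rightarrow> (nat \<Rightarrow> nat) \<Rightarrow> cpoly \<Rightarrow> bool" where
  "dom_bounded N B f \<longleftrightarrow> (\<forall>e\<in>keys f. vec_bounded N B e)"

abbreviation part_sums :: "nat list \<Rightarrow> nat \<Rightarrow> nat" where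
  "part_sums lam \<equiv> \<lambda>l. \<Sum>i=1..l. part lam i"

lemma dominated_exps_iff:
  assumes "keys a \<subseteq> {..<N}" "(\<Sum>i<N. lookup a i) = sum_list lam"
  shows "dominated (exps_partition N a) lam \<longleftrightarrow> vec_bounded N (part_sums lam) a"
proof
  assume *: "dominated (exps_partition N a) lam"
  show "vec_bounded N (part_sums lam) a"
    unfolding vec_bounded_def
  proof (intro conjI allI impI)
    fix I assume "I \<subseteq> {..<N}"
    thus "(\<Sum>i\<in>I. lookup a i) \<le> part_sums lam (card I)"
      using sum_le_part_sum[of I N a] * unfolding dominated_def by (meson le_trans)
  qed (use assms in auto)
next
  assume *: "vec_bounded N (part_sums lam) a"
  have le: "part_sums (exps_partition N a) l \<le> part_sums lam l" if "l \<le> N" for l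
    by (rule part_sum_attained[OF that, of a]) (use * in \<open>metis vec_bounded_def\<close>)
  have "part_sums (exps_partition N a) l \<le> part_sums lam l" for l
  proof (cases "l \<le> N")
    case False
    have "part_sums (exps_partition N a) l \<le> sum_list (exps_partition N a)" by (rule part_sum_le)
    also have "\<dots> = part_sums (exps_partition N a) N" by (rule part_sum_all[OF length_exps_partition, symmetric])
    also have "\<dots> \<le> part_sums lam N" by (rule le) simp
    also have "\<dots> \<le> part_sums lam l" using False by (intro part_sum_mono) simp
    finally show ?thesis .
  qed (rule le)
  thus "dominated (exps_partition N a) lam"
    using assms(2) by (simp add: dominated_def sum_list_exps_partition)
qed

section \<open>Rearrangements of exponents and symmetric polynomials\<close>

lemma exps_cong_mset:
  assumes "mset (map (lookup a) [0..<N]) = mset (map (lookup b) [0..<N])"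
  shows "exps_partition N a = exps_partition N b"
proof -
  have "sort (map (lookup a) [0..<N]) = sort (map (lookup b) [0..<N])"
    by (rule properties_for_sort) (use assms in auto)
  thus ?thesis by (simp only: exps_partition_eq_filter)
qed

lemma exps_partition_map_key:
  assumes "p permutes {..<N}"
  shows "exps_partition N (Poly_Mapping.map_key p a) = exps_partition N a"
proof (rule exps_cong_mset)
  have "mset (map (lookup (Poly_Mapping.map_key p a)) [0..<N]) = mset (permute_list p (map (lookup a) [0..<N]))"
  proof (rule arg_cong[of _ _ mset], rule nth_equalityI)
    fix i assume i: "i < length (map (lookup (Poly_Mapping.map_key p a)) [0..<N])"
    hence "p i < N" using permutes_in_image[OF assms, of i] by auto
    thus "map (lookup (Poly_Mapping.map_key p a)) [0..<N] ! i = permute_list p (map (lookup a) [0..<N]) ! i"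
      using i assms by (simp add: permute_list_nth lookup_map_key permutes_inj)
  qed simp
  also have "\<dots> = mset (map (lookup a) [0..<N])" by (rule mset_permute_list) (use assms in simp)
  finally show "mset (map (lookup (Poly_Mapping.map_key p a)) [0..<N]) = mset (map (lookup a) [0..<N])" .
qed

lemma exps_eq_imp_map_key:
  assumes "keys a \<subseteq> {..<N}" "keys b \<subseteq> {..<N}" "exps_partition N a = exps_partition N b"
  obtains p where "p permutes {..<N}" "b = Poly_Mapping.map_key p a"
proof -
  obtain p where p: "p permutes {..<N}" "\<And>k. k < N \<Longrightarrow> part (exps_partition N a) (Suc k) = lookup a (p k)"
    using exps_partition_permutation[of N a] by auto
  obtain q where q: "q permutes {..<N}" "\<And>k. k < N \<Longrightarrow> part (exps_partition N b) (Suc k) = lookup b (q k)"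
    using exps_partition_permutation[of N b] by auto
  define r where "r = p \<circ> inv q"
  have r: "r permutes {..<N}" unfolding r_def by (rule permutes_compose[OF permutes_inv[OF q(1)] p(1)])
  have "b = Poly_Mapping.map_key r a"
  proof (rule poly_mapping_eqI)
    fix i
    show "lookup b i = lookup (Poly_Mapping.map_key r a) i"
    proof (cases "i < N")
      case True
      have k: "inv q i < N" using permutes_in_image[OF permutes_inv[OF q(1)], of i] True by auto
      have "lookup b i = lookup b (q (inv q i))" by (simp add: permutes_inverses(1)[OF q(1)])
      also have "\<dots> = lookup a (p (inv q i))" using p(2)[OF k] q(2)[OF k] assms(3) by simp
      finally show ?thesis unfolding lookup_map_key[OF permutes_inj[OF r]] by (simp add: r_def)
    next
      case False
      hence "r i = i" using r by (meson permutes_not_in lessThan_iff)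
      moreover have "i \<notin> keys a" "i \<notin> keys b" using assms(1,2) False by auto
      ultimately show ?thesis by (simp add: lookup_map_key permutes_inj[OF r] in_keys_iff)
    qed
  qed
  with r show ?thesis by (rule that)
qed

definition symm :: "nat \<Rightarrow> cpoly \<Rightarrow> bool" where
  "symm n f \<longleftrightarrow> (\<forall>p. p permutes {..<n} \<longrightarrow> pact p f = f)"

lemma symm_sf_eval: "symm n (sf_eval n f)"
  by (simp add: symm_def pact_sf_eval)

lemma symm_lookup_eq:
  assumes "symm N f" "keys a \<subseteq> {..<N}" "keys b \<subseteq> {..<N}" "exps_partition N a = exps_partition N b"
  shows "lookup f a = lookup f b"
proof -
  obtain p where p: "p permutes {..<N}" "b = Poly_Mapping.map_key p a"
    using exps_eq_imp_map_key assms(2-4) by blast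
  have "lookup (pact p f) a = lookup f b" using p by (simp add: lookup_pact permutes_bij)
  thus ?thesis using assms(1) p(1) by (simp add: symm_def)
qed

text \<open>A partition read as an exponent vector is the representative monomial at which
  coefficients of symmetric polynomials are looked up.\<close>

lemma exps_partition_nth:
  assumes "is_partition lam" "length lam \<le> N"
  shows "exps_partition N (Poly_Mapping.nth lam) = lam" "keys (Poly_Mapping.nth lam) \<subseteq> {..<N}"
proof -
  have "map (lookup (Poly_Mapping.nth lam)) [0..<N] = lam @ replicate (N - length lam) 0"
    by (rule nth_equalityI) (use assms(2) in \<open>simp_all add: nth_default_def nth_append\<close>)
  moreover have "filter (\<lambda>x. x \<noteq> 0) lam = lam"
    using assms(1) unfolding is_partition_def by (intro filter_True) metis
  ultimately have "filter (\<lambda>x. x \<noteq> 0) (map (lookup (Poly_Mapping.nth lam)) [0..<N]) = lam"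
    by (simp only: filter_append) simp
  moreover have "rev (sort lam) = lam"
  proof -
    have "sort lam = rev lam"
      by (rule properties_for_sort) (use assms(1) in \<open>auto simp: is_partition_def sorted_wrt_rev\<close>)
    thus ?thesis by simp
  qed
  ultimately show "exps_partition N (Poly_Mapping.nth lam) = lam" by (simp add: exps_partition_def)
  show "keys (Poly_Mapping.nth lam) \<subseteq> {..<N}"
  proof
    fix i assume "i \<in> keys (Poly_Mapping.nth lam)"
    hence "nth_default 0 lam i \<noteq> 0" by (metis in_keys_iff lookup_nth)
    hence "i < length lam" by (cases "i < length lam") (auto simp: nth_default_def)
    thus "i \<in> {..<N}" using assms(2) by simp
  qed
qed

lemma partition_eqI:
  assumes "is_partition lam" "is_partition mu" "\<And>i. part lam (Suc i) = part mu (Suc i)"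
  shows "lam = mu"
proof -
  have len: "i < length lam \<longleftrightarrow> part lam (Suc i) \<noteq> 0" if "is_partition lam" for lam i
  proof (cases "i < length lam")
    case True
    hence "lam ! i \<noteq> 0" using that nth_mem[OF True] unfolding is_partition_def by metis
    thus ?thesis using True by (simp add: part_def)
  qed (simp add: part_def)
  have "i < length lam \<longleftrightarrow> i < length mu" for i using len[OF assms(1)] len[OF assms(2)] assms(3) by simp
  hence l: "length lam = length mu" by (metis less_irrefl linorder_neqE_nat)
  show ?thesis
  proof (rule nth_equalityI[OF l])
    fix i assume "i < length lam"
    thus "lam ! i = mu ! i" using assms(3)[of i] l by (simp add: part_def)
  qed
qed

lemma dominated_refl: "dominated lam lam" by (simp add: dominated_def)

lemma dominated_trans: "dominated lam mu \<Longrightarrow> dominated mu nu \<Longrightarrow> dominated lam nu"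
  unfolding dominated_def by (metis le_trans)

lemma dominated_antisym:
  assumes "is_partition lam" "is_partition mu" "dominated lam mu" "dominated mu lam"
  shows "lam = mu"
proof (rule partition_eqI[OF assms(1,2)])
  fix i
  have eq: "(\<Sum>k<l. part lam (Suc k)) = (\<Sum>k<l. part mu (Suc k))" for l
    using assms(3,4) unfolding dominated_def part_sum by (meson le_antisym)
  show "part lam (Suc i) = part mu (Suc i)" using eq[of "Suc i"] eq[of i] by simp
qed

section \<open>Leading coefficients of Dunkl operators\<close>

lemma sum_split_two:
  fixes g :: "nat \<Rightarrow> 'a :: comm_monoid_add"
  assumes "finite I" "i \<noteq> j"
  shows "sum g I = sum g (I - {i, j}) + ((if i \<in> I then g i else 0) + (if j \<in> I then g j else 0))"
proof -
  have "sum g I = sum g (I - {i, j}) + sum g (I \<inter> {i, j})"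
    using assms(1) by (subst sum.union_disjoint[symmetric]) (auto intro!: arg_cong[of _ _ "sum g"])
  also have "sum g (I \<inter> {i, j}) = (if i \<in> I then g i else 0) + (if j \<in> I then g j else 0)"
    using assms(2) by (cases "i \<in> I"; cases "j \<in> I") (auto simp: Int_insert_right)
  finally show ?thesis .
qed

text \<open>If I contains both or neither of i and j, its sum is unchanged. If it contains exactly
  one, the new entry there is at most the larger of the two old ones, and the old bound is applied
  to the set of equal size that contains the position of that larger entry.\<close>

lemma vec_bounded_upd2:
  assumes e: "vec_bounded N B e" and ij: "i < N" "j < N" "i \<noteq> j"
    and cd: "c + d = lookup e i + lookup e j" "c \<le> max (lookup e i) (lookup e j)" "d \<le> max (lookup e i) (lookup e j)"
  shows "vec_bounded N B (upd2 i j e c d)"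
  unfolding vec_bounded_def
proof (intro conjI allI impI)
  have ke: "keys e \<subseteq> {..<N}" and be: "\<And>I. I \<subseteq> {..<N} \<Longrightarrow> (\<Sum>i\<in>I. lookup e i) \<le> B (card I)"
    using e by (auto simp: vec_bounded_def)
  show "keys (upd2 i j e c d) \<subseteq> {..<N}"
  proof
    fix l assume l: "l \<in> keys (upd2 i j e c d)"
    show "l \<in> {..<N}"
    proof (cases "l = i \<or> l = j")
      case False
      hence "l \<in> keys e" using l by (simp add: in_keys_iff lookup_upd2)
      thus ?thesis using ke by blast
    qed (use ij in auto)
  qed
  fix I assume I: "I \<subseteq> {..<N}"
  have fin: "finite I" using I finite_subset by blast
  define S where "S = sum (lookup e) (I - {i, j})"
  have S: "sum (lookup (upd2 i j e c d)) (I - {i, j}) = S"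
    unfolding S_def by (rule sum.cong) (auto simp: lookup_upd2)
  have L: "sum (lookup (upd2 i j e c d)) I = S + ((if i \<in> I then c else 0) + (if j \<in> I then d else 0))"
    unfolding sum_split_two[OF fin ij(3), of "lookup (upd2 i j e c d)"] S using ij(3) by (simp add: lookup_upd2)
  have *: "S + ((if i \<in> I' then lookup e i else 0) + (if j \<in> I' then lookup e j else 0)) \<le> B (card I')"
    if "I' \<subseteq> {..<N}" "I' - {i, j} = I - {i, j}" for I'
  proof -
    have "finite I'" using that finite_subset by blast
    from sum_split_two[OF this ij(3), of "lookup e"] be[OF that(1)] that(2) show ?thesis
      by (simp add: S_def)
  qed
  show "(\<Sum>l\<in>I. lookup (upd2 i j e c d) l) \<le> B (card I)"
  proof (cases "i \<in> I \<longleftrightarrow> j \<in> I")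
    case True
    thus ?thesis using *[OF I] cd(1) unfolding L by (cases "i \<in> I") auto
  next
    case False
    define I1 where "I1 = insert i (I - {i, j})"
    define I2 where "I2 = insert j (I - {i, j})"
    have "card I = Suc (card (I - {i, j}))"
    proof (cases "i \<in> I")
      case True
      hence "I - {i, j} = I - {i}" using False by auto
      thus ?thesis using True fin card_Suc_Diff1[of I i] by simp
    next
      case False2: False
      hence "j \<in> I" "I - {i, j} = I - {j}" using False by auto
      thus ?thesis using fin card_Suc_Diff1[of I j] by simp
    qed
    hence card: "card I1 = card I" "card I2 = card I" using fin by (simp_all add: I1_def I2_def)
    have "I1 \<subseteq> {..<N}" "I1 - {i, j} = I - {i, j}" "i \<in> I1" "j \<notin> I1"
      using I ij by (auto simp: I1_def)
    from *[OF this(1,2)] this(3,4) card have "S + lookup e i \<le> B (card I)" by simp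
    moreover have "I2 \<subseteq> {..<N}" "I2 - {i, j} = I - {i, j}" "i \<notin> I2" "j \<in> I2"
      using I ij by (auto simp: I2_def)
    from *[OF this(1,2)] this(3,4) card have "S + lookup e j \<le> B (card I)" by simp
    ultimately have "S + max (lookup e i) (lookup e j) \<le> B (card I)" by (simp add: max_def)
    thus ?thesis using False cd(2,3) unfolding L by (cases "i \<in> I") simp_all
  qed
qed

lemma keys_linext: "keys (linext \<phi> f) \<subseteq> (\<Union>e\<in>keys f. keys (\<phi> e))"
proof
  fix a assume "a \<in> keys (linext \<phi> f)"
  hence "(\<Sum>e\<in>keys f. lookup f e * lookup (\<phi> e) a) \<noteq> 0" by (simp add: in_keys_iff lookup_linext)
  then obtain e where "e \<in> keys f" "lookup f e * lookup (\<phi> e) a \<noteq> 0" by (meson sum.not_neutral_contains_not_neutral)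
  thus "a \<in> (\<Union>e\<in>keys f. keys (\<phi> e))" by (auto simp: in_keys_iff)
qed

lemma keys_sum_mon: "keys (\<Sum>c\<in>C. mon (h c)) \<subseteq> h ` C"
proof
  fix a assume "a \<in> keys (\<Sum>c\<in>C. mon (h c))"
  hence "(\<Sum>c\<in>C. lookup (mon (h c)) a) \<noteq> 0" by (simp add: in_keys_iff lookup_sum)
  then obtain c where "c \<in> C" "lookup (mon (h c)) a \<noteq> 0" by (meson sum.not_neutral_contains_not_neutral)
  thus "a \<in> h ` C" by (auto simp: lookup_single when_def split: if_splits)
qed

lemma keys_ddE:
  assumes "a \<in> keys (dd i j f)"
  obtains e c d where "e \<in> keys f" "a = upd2 i j e c d" "c + d = lookup e i + lookup e j"
    "c \<le> max (lookup e i) (lookup e j)" "d \<le> max (lookup e i) (lookup e j)"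
proof -
  from subsetD[OF keys_linext assms[unfolded dd_def]]
  obtain e where e: "e \<in> keys f" and a: "a \<in> keys (if lookup e j \<le> lookup e i
     then \<Sum>c\<in>{lookup e j<..lookup e i}. mon (upd2 i j e c (lookup e i + lookup e j - c))
     else - (\<Sum>c\<in>{lookup e i<..lookup e j}. mon (upd2 i j e c (lookup e i + lookup e j - c))))"
    by (rule UN_E)
  have "\<exists>c. min (lookup e i) (lookup e j) < c \<and> c \<le> max (lookup e i) (lookup e j) \<and>
       a = upd2 i j e c (lookup e i + lookup e j - c)"
  proof (cases "lookup e j \<le> lookup e i")
    case True
    hence "a \<in> keys (\<Sum>c\<in>{lookup e j<..lookup e i}. mon (upd2 i j e c (lookup e i + lookup e j - c)))"
      using a by simp
    hence "a \<in> (\<lambda>c. upd2 i j e c (lookup e i + lookup e j - c)) ` {lookup e j<..lookup e i}"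
      by (rule subsetD[OF keys_sum_mon])
    thus ?thesis using True by auto
  next
    case False
    hence "a \<in> keys (\<Sum>c\<in>{lookup e i<..lookup e j}. mon (upd2 i j e c (lookup e i + lookup e j - c)))"
      using a by simp
    hence "a \<in> (\<lambda>c. upd2 i j e c (lookup e i + lookup e j - c)) ` {lookup e i<..lookup e j}"
      by (rule subsetD[OF keys_sum_mon])
    thus ?thesis using False by auto
  qed
  then obtain c where c: "min (lookup e i) (lookup e j) < c" "c \<le> max (lookup e i) (lookup e j)"
    "a = upd2 i j e c (lookup e i + lookup e j - c)" by blast
  show ?thesis by (rule that[OF e c(3)]) (use c(1,2) in auto)
qed

lemma dom_bounded_dd:
  assumes "dom_bounded N B f" "i < N" "j < N" "i \<noteq> j"
  shows "dom_bounded N B (dd i j f)"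
  unfolding dom_bounded_def
proof
  fix a assume "a \<in> keys (dd i j f)"
  then obtain e c d where e: "e \<in> keys f" "a = upd2 i j e c d" "c + d = lookup e i + lookup e j"
    "c \<le> max (lookup e i) (lookup e j)" "d \<le> max (lookup e i) (lookup e j)" by (rule keys_ddE)
  have "vec_bounded N B e" using assms(1) e(1) by (simp add: dom_bounded_def)
  thus "vec_bounded N B a" unfolding e(2) by (rule vec_bounded_upd2[OF _ assms(2-4) e(3-5)])
qed

lemma dom_bounded_add: "dom_bounded N B f \<Longrightarrow> dom_bounded N B g \<Longrightarrow> dom_bounded N B (f + g)"
  unfolding dom_bounded_def using keys_add[of f g] by blast

lemma dom_bounded_0 [simp]: "dom_bounded N B 0" by (simp add: dom_bounded_def)

lemma dom_bounded_sum: "(\<And>x. x \<in> A \<Longrightarrow> dom_bounded N B (f x)) \<Longrightarrow> dom_bounded N B (\<Sum>x\<in>A. f x)"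
  by (induction A rule: infinite_finite_induct) (auto simp: dom_bounded_add)

lemma dom_bounded_scale: "dom_bounded N B f \<Longrightarrow> dom_bounded N B (cconst c * f)"
  by (auto simp: dom_bounded_def in_keys_iff)

lemma dom_bounded_theta: "dom_bounded N B f \<Longrightarrow> dom_bounded N B (theta i f)"
  by (auto simp: dom_bounded_def in_keys_iff lookup_theta)

lemma dom_bounded_dunkl: "dom_bounded N B f \<Longrightarrow> i < N \<Longrightarrow> dom_bounded N B (dunkl \<alpha> N i f)"
  unfolding dunkl_def by (intro dom_bounded_add dom_bounded_scale dom_bounded_theta dom_bounded_sum dom_bounded_dd) auto

lemma dunkl_shift_same: "dunkl_shift \<alpha> N N i = dunkl \<alpha> N i"
  by (rule ext) (simp add: dunkl_shift_def)

lemma dom_bounded_dunkl_pow: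
  "dom_bounded N B f \<Longrightarrow> i < N \<Longrightarrow> dom_bounded N B ((dunkl \<alpha> N i ^^ l) f)"
  by (induction l) (auto intro: dom_bounded_dunkl)

lemma dom_bounded_hamiltonian:
  assumes "homog_symfun N f" "dom_bounded N B (sf_eval N f)"
  shows "dom_bounded N B (sf_eval N (hamiltonian \<alpha> N K t f))"
  unfolding sf_eval_hamiltonian[OF assms(1)] dunkl_shift_same
  by (intro dom_bounded_sum dom_bounded_scale dom_bounded_dunkl_pow dom_bounded_dunkl assms(2)) auto

text \<open>The bound is reached on the entries exceeding a given one together with that one.
  Rearrangements of a partition have this property for its partial sums, and it is what makes the
  leading coefficients of a divided difference computable.\<close>

definition extremal :: "nat \<Rightarrow> (nat \<Rightarrow> nat) \<Rightarrow> (nat \<Rightarrow>\<^sub>0 nat) \<Rightarrow> bool" where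
  "extremal N B a \<longleftrightarrow> keys a \<subseteq> {..<N} \<and>
    (\<forall>i<N. B (card {l\<in>{..<N}. lookup a l > lookup a i} + 1) \<le> (\<Sum>l\<in>{l\<in>{..<N}. lookup a l > lookup a i}. lookup a l) + lookup a i)"

text \<open>Exchange argument. T consists of the positions with entries above
  \<open>lookup a i\<close>, and I is an optimal set with one element more. Positions of I outside T
  carry at most \<open>lookup a i\<close>, those of T outside I carry more, and the former outnumber
  the latter by one.\<close>

lemma extremal_exps_partition:
  assumes "keys a \<subseteq> {..<N}"
  shows "extremal N (part_sums (exps_partition N a)) a"
  unfolding extremal_def
proof (intro conjI allI impI)
  fix i assume i: "i < N"
  define T where "T = {l\<in>{..<N}. lookup a l > lookup a i}"
  have T: "T \<subseteq> {..<N} - {i}" by (auto simp: T_def)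
  hence finT: "finite T" using finite_subset by blast
  have "card T < N" using card_mono[of "{..<N} - {i}" T] T i by simp
  hence "card T + 1 \<le> N" by simp
  then obtain I where I: "I \<subseteq> {..<N}" "card I = card T + 1"
      "(\<Sum>i\<in>I. lookup a i) = part_sums (exps_partition N a) (card T + 1)"
    by (rule part_sum_attained)
  have finI: "finite I" using I finite_subset by blast
  have cI: "card I = card (I \<inter> T) + card (I - T)" using finI by (metis card_Int_Diff)
  have cT: "card T = card (I \<inter> T) + card (T - I)" using finT by (metis card_Int_Diff inf_commute)
  have "(\<Sum>l\<in>I. lookup a l) = (\<Sum>l\<in>I \<inter> T. lookup a l) + (\<Sum>l\<in>I - T. lookup a l)"
    using finI by (metis sum.Int_Diff)
  also have "(\<Sum>l\<in>I - T. lookup a l) \<le> (\<Sum>l\<in>I - T. lookup a i)"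
    by (rule sum_mono) (use I in \<open>auto simp: T_def not_less\<close>)
  also have "\<dots> = (card (T - I) + 1) * lookup a i" using cI cT I(2) by simp
  also have "\<dots> \<le> (\<Sum>l\<in>T - I. lookup a l) + lookup a i"
  proof -
    have "(\<Sum>l\<in>T - I. lookup a i) \<le> (\<Sum>l\<in>T - I. lookup a l)"
      by (rule sum_mono) (auto simp: T_def)
    thus ?thesis by simp
  qed
  finally have "(\<Sum>l\<in>I. lookup a l) \<le> (\<Sum>l\<in>I \<inter> T. lookup a l) + (\<Sum>l\<in>T - I. lookup a l) + lookup a i" by simp
  also have "(\<Sum>l\<in>I \<inter> T. lookup a l) + (\<Sum>l\<in>T - I. lookup a l) = (\<Sum>l\<in>T. lookup a l)"
    using finT by (metis sum.Int_Diff inf_commute)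
  finally show "part_sums (exps_partition N a) (card {l\<in>{..<N}. lookup a l > lookup a i} + 1)
      \<le> (\<Sum>l\<in>{l\<in>{..<N}. lookup a l > lookup a i}. lookup a l) + lookup a i"
    unfolding T_def[symmetric] I(3) .
qed (use assms in auto)

text \<open>The positions T with entries above the larger of a_i and a_j avoid i and j, so e and a
  agree there. Testing the bound for e on T enlarged by i or j, against the value given by
  extremality of a, bounds e_i and e_j.\<close>

lemma extremal_max:
  assumes e: "vec_bounded N B e" and a: "extremal N B a" and ij: "i < N" "j < N" "i \<noteq> j"
    and off: "\<And>l. l \<noteq> i \<Longrightarrow> l \<noteq> j \<Longrightarrow> lookup e l = lookup a l"
  shows "max (lookup e i) (lookup e j) \<le> max (lookup a i) (lookup a j)"
proof -
  define k where "k = (if lookup a i \<le> lookup a j then j else i)"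
  have k: "lookup a k = max (lookup a i) (lookup a j)" "k < N" using ij by (auto simp: k_def)
  define T where "T = {l\<in>{..<N}. lookup a l > lookup a k}"
  have T: "i \<notin> T" "j \<notin> T" "T \<subseteq> {..<N}" "finite T" using k by (auto simp: T_def)
  have "lookup e i' \<le> lookup a k" if "i' \<in> {i, j}" for i'
  proof -
    have "(\<Sum>l\<in>insert i' T. lookup e l) \<le> B (card (insert i' T))"
      using e that T(3) ij unfolding vec_bounded_def by blast
    also have "card (insert i' T) = card T + 1" using T that by auto
    also have "B (card T + 1) \<le> (\<Sum>l\<in>T. lookup a l) + lookup a k"
      using a k(2) unfolding extremal_def T_def by blast
    also have "(\<Sum>l\<in>T. lookup a l) = (\<Sum>l\<in>T. lookup e l)"
      by (rule sum.cong) (use off T in \<open>metis\<close>)+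
    also have "(\<Sum>l\<in>insert i' T. lookup e l) = lookup e i' + (\<Sum>l\<in>T. lookup e l)"
      using T that by (subst sum.insert) auto
    finally show ?thesis by simp
  qed
  thus ?thesis unfolding k(1) by simp
qed

lemma lookup_sum_upd2:
  assumes "finite C"
  shows "lookup (\<Sum>c\<in>C. mon (upd2 i j e c (s - c))) a =
     (if lookup a i \<in> C \<and> a = upd2 i j e (lookup a i) (s - lookup a i) then 1 else 0)"
proof -
  have "lookup (\<Sum>c\<in>C. mon (upd2 i j e c (s - c))) a =
      (\<Sum>c\<in>C. if c = lookup a i then (if a = upd2 i j e (lookup a i) (s - lookup a i) then 1 else 0) else 0)"
    unfolding lookup_sum
    by (rule sum.cong) (auto simp: lookup_single when_def lookup_upd2)
  thus ?thesis using assms by simp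
qed

text \<open>Points strictly inside the segment from (p, q) to (q, p) have a maximum below that of p
  and q, hence cannot be (x, y); the half-open interval keeps only the end with the larger first
  entry.\<close>

lemma segment_indicator:
  fixes x y p q :: nat
  assumes "q \<le> p" "max p q \<le> max x y"
  shows "(if x \<in> {q<..p} \<and> y = p + q - x then 1 else (0 :: complex)) =
    (if y < x then (if p = x \<and> q = y then 1 else 0) - (if p = y \<and> q = x then 1 else 0) else 0)"
  using assms by (auto simp: max_def split: if_splits)

lemma segment_indicator':
  fixes x y p q :: nat
  assumes "p < q" "max p q \<le> max x y"
  shows "- (if x \<in> {p<..q} \<and> y = p + q - x then 1 else (0 :: complex)) =
    (if y < x then (if p = x \<and> q = y then 1 else 0) - (if p = y \<and> q = x then 1 else 0) else 0)"
  using assms by (auto simp: max_def split: if_splits)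

text \<open>A divided difference moves the exponents (e_i, e_j) inwards, while
  \<open>extremal_max\<close> bounds the larger of them by that of \<open>a\<close>. So only
  \<open>a\<close> and its transposition can contribute, with opposite signs, and only when x_i has
  the larger exponent in \<open>a\<close>.\<close>

lemma lookup_dd_extremal:
  assumes f: "dom_bounded N B f" and a: "extremal N B a" and ij: "i < N" "j < N" "i \<noteq> j"
  shows "lookup (dd i j f) a =
     (if lookup a j < lookup a i then lookup f a - lookup f (Poly_Mapping.map_key (transpose i j) a) else 0)"
proof -
  define b where "b = Poly_Mapping.map_key (transpose i j) a"
  have b: "b = upd2 i j a (lookup a j) (lookup a i)"
    unfolding b_def by (rule poly_mapping_eqI) (auto simp: lookup_map_key lookup_upd2 transpose_def)
  let ?\<phi> = "\<lambda>e. if lookup e j \<le> lookup e i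
     then \<Sum>c\<in>{lookup e j<..lookup e i}. mon (upd2 i j e c (lookup e i + lookup e j - c))
     else - (\<Sum>c\<in>{lookup e i<..lookup e j}. mon (upd2 i j e c (lookup e i + lookup e j - c)))"
  have \<phi>: "lookup (?\<phi> e) a = (if lookup a j < lookup a i then (if e = a then 1 else 0) - (if e = b then 1 else 0) else 0)"
    if e: "e \<in> keys f" for e
  proof -
    define s where "s = lookup e i + lookup e j"
    have vb: "vec_bounded N B e" using f e by (simp add: dom_bounded_def)
    have eqa: "a = upd2 i j e (lookup a i) (s - lookup a i) \<longleftrightarrow>
       (\<forall>l. l \<noteq> i \<longrightarrow> l \<noteq> j \<longrightarrow> lookup e l = lookup a l) \<and> lookup a j = s - lookup a i"
      unfolding poly_mapping_eq_iff fun_eq_iff lookup_upd2 using ij(3) by metis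
    have ea: "e = a \<longleftrightarrow> (\<forall>l. l \<noteq> i \<longrightarrow> l \<noteq> j \<longrightarrow> lookup e l = lookup a l) \<and> lookup e i = lookup a i \<and> lookup e j = lookup a j"
      unfolding poly_mapping_eq_iff fun_eq_iff by metis
    have eb: "e = b \<longleftrightarrow> (\<forall>l. l \<noteq> i \<longrightarrow> l \<noteq> j \<longrightarrow> lookup e l = lookup a l) \<and> lookup e i = lookup a j \<and> lookup e j = lookup a i"
      unfolding b poly_mapping_eq_iff fun_eq_iff lookup_upd2 using ij(3) by metis
    show ?thesis
    proof (cases "\<forall>l. l \<noteq> i \<longrightarrow> l \<noteq> j \<longrightarrow> lookup e l = lookup a l")
      case off: True
      have mx: "max (lookup e i) (lookup e j) \<le> max (lookup a i) (lookup a j)"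
        by (rule extremal_max[OF vb a ij]) (use off in blast)
      have ea': "e = a \<longleftrightarrow> lookup e i = lookup a i \<and> lookup e j = lookup a j"
        and eb': "e = b \<longleftrightarrow> lookup e i = lookup a j \<and> lookup e j = lookup a i"
        using ea eb off by blast+
      show ?thesis
      proof (cases "lookup e j \<le> lookup e i")
        case True
        hence "lookup (?\<phi> e) a = (if lookup a i \<in> {lookup e j<..lookup e i} \<and> lookup a j = s - lookup a i then 1 else 0)"
          using lookup_sum_upd2[of "{lookup e j<..lookup e i}" i j e s a] off unfolding eqa s_def[symmetric] by simp
        also have "\<dots> = (if lookup a j < lookup a i then (if lookup e i = lookup a i \<and> lookup e j = lookup a j then 1 else 0)
            - (if lookup e i = lookup a j \<and> lookup e j = lookup a i then 1 else 0) else 0)"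
          unfolding s_def by (rule segment_indicator[OF True mx])
        finally show ?thesis unfolding ea' eb' .
      next
        case False
        hence "lookup (?\<phi> e) a = - (if lookup a i \<in> {lookup e i<..lookup e j} \<and> lookup a j = s - lookup a i then 1 else 0)"
          using lookup_sum_upd2[of "{lookup e i<..lookup e j}" i j e s a] off unfolding eqa s_def[symmetric] by simp
        also have "\<dots> = (if lookup a j < lookup a i then (if lookup e i = lookup a i \<and> lookup e j = lookup a j then 1 else 0)
            - (if lookup e i = lookup a j \<and> lookup e j = lookup a i then 1 else 0) else 0)"
          unfolding s_def by (rule segment_indicator'[OF _ mx]) (use False in simp)
        finally show ?thesis unfolding ea' eb' .
      qed
    next
      case off: False
      hence "lookup (?\<phi> e) a = 0"
        using lookup_sum_upd2[of "{lookup e j<..lookup e i}" i j e s a] lookup_sum_upd2[of "{lookup e i<..lookup e j}" i j e s a]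
        unfolding eqa s_def[symmetric] by simp
      moreover have "e \<noteq> a" "e \<noteq> b" using off unfolding ea eb by auto
      ultimately show ?thesis by simp
    qed
  qed
  have sum1: "(\<Sum>e\<in>keys f. if e = c then lookup f c else 0) = lookup f c" for c
    by (auto simp: in_keys_iff)
  have "lookup (dd i j f) a = (\<Sum>e\<in>keys f. lookup f e * (if lookup a j < lookup a i then (if e = a then 1 else 0) - (if e = b then 1 else 0) else 0))"
    unfolding dd_def lookup_linext by (rule sum.cong) (simp_all only: \<phi>)
  also have "\<dots> = (if lookup a j < lookup a i then (\<Sum>e\<in>keys f. (if e = a then lookup f a else 0) - (if e = b then lookup f b else 0)) else 0)"
    by (auto intro!: sum.cong)
  also have "\<dots> = (if lookup a j < lookup a i then lookup f a - lookup f b else 0)"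
    by (simp only: sum_subtractf sum1)
  finally show ?thesis by (simp only: b_def)
qed

text \<open>The value multiplicities \<open>mults\<close> include the multiplicity of the value 0 among the \<open>N\<close> variables.\<close>
definition mults :: "nat \<Rightarrow> nat list \<Rightarrow> nat \<Rightarrow> nat" where
  "mults N lam u = card {k\<in>{..<N}. part lam (Suc k) = u}"

lemma mults_exps_partition: "mults N (exps_partition N a) u = card {i\<in>{..<N}. lookup a i = u}"
proof -
  obtain p where p: "p permutes {..<N}" "\<And>k. k < N \<Longrightarrow> part (exps_partition N a) (Suc k) = lookup a (p k)"
    using exps_partition_permutation[of N a] by auto
  have "bij_betw p {k\<in>{..<N}. part (exps_partition N a) (Suc k) = u} {i\<in>{..<N}. lookup a i = u}"
  proof (rule bij_betw_imageI)
    show "inj_on p {k\<in>{..<N}. part (exps_partition N a) (Suc k) = u}"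
      using permutes_inj[OF p(1)] by (rule inj_on_subset) simp
    show "p ` {k\<in>{..<N}. part (exps_partition N a) (Suc k) = u} = {i\<in>{..<N}. lookup a i = u}"
    proof (intro equalityI subsetI)
      fix i assume i: "i \<in> {i\<in>{..<N}. lookup a i = u}"
      define k where "k = inv p i"
      have pk: "p k = i" unfolding k_def by (rule permutes_inverses(1)[OF p(1)])
      hence "k < N" using permutes_in_image[OF p(1), of k] i by auto
      thus "i \<in> p ` {k\<in>{..<N}. part (exps_partition N a) (Suc k) = u}"
        using pk i p(2)[of k] by (intro image_eqI[of _ _ k]) auto
    next
      fix i assume "i \<in> p ` {k\<in>{..<N}. part (exps_partition N a) (Suc k) = u}"
      then obtain k where k: "i = p k" "k < N" "part (exps_partition N a) (Suc k) = u" by auto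
      have "p k < N" using permutes_in_image[OF p(1), of k] k(2) by simp
      thus "i \<in> {i\<in>{..<N}. lookup a i = u}" using k p(2)[OF k(2)] by simp
    qed
  qed
  thus ?thesis by (simp add: mults_def bij_betw_same_card)
qed

lemma sum_by_value:
  fixes h :: "nat \<Rightarrow> 'a :: comm_semiring_1" and N :: nat
  shows "(\<Sum>i\<in>{i\<in>{..<N}. a i < s}. h (a i)) = (\<Sum>u<s. of_nat (card {i\<in>{..<N}. a i = u}) * h u)"
proof -
  have "(\<Sum>i\<in>{i\<in>{..<N}. a i < s}. h (a i)) = (\<Sum>u<s. \<Sum>i\<in>{i\<in>{i\<in>{..<N}. a i < s}. a i = u}. h (a i))"
  proof (rule sum.group[symmetric])
    show "finite {i\<in>{..<N}. a i < s}" by (rule finite_subset[of _ "{..<N}"]) auto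
  qed auto
  also have "\<dots> = (\<Sum>u<s. of_nat (card {i\<in>{..<N}. a i = u}) * h u)"
  proof (rule sum.cong)
    fix u assume "u \<in> {..<s}"
    hence "{i\<in>{i\<in>{..<N}. a i < s}. a i = u} = {i\<in>{..<N}. a i = u}" by auto
    thus "(\<Sum>i\<in>{i\<in>{i\<in>{..<N}. a i < s}. a i = u}. h (a i)) = of_nat (card {i\<in>{..<N}. a i = u}) * h u" by simp
  qed simp
  finally show ?thesis .
qed

text \<open>The induction treats all rearrangements \<open>a\<close> of \<open>lam\<close> at once,
  because a divided difference compares \<open>a\<close> with its transposition. Symmetry is lost
  after the first operator, but the coefficient still depends on the exponent of x_i alone, which is
  what the recursion of \<open>psi\<close> needs.\<close>

lemma lookup_dunkl_pow_leading:
  fixes \<alpha> :: real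
  assumes i: "i < N" and f: "dom_bounded N (part_sums lam) f" "symm N f"
    and c: "\<And>a. keys a \<subseteq> {..<N} \<Longrightarrow> exps_partition N a = lam \<Longrightarrow> lookup f a = c"
    and a: "keys a \<subseteq> {..<N}" "exps_partition N a = lam"
  shows "lookup ((dunkl (of_real \<alpha>) N i ^^ l) (dunkl (of_real \<alpha>) N i f)) a = c * of_real (psi \<alpha> (mults N lam) l (lookup a i))"
  using a
proof (induction l arbitrary: a)
  case 0
  have "dd i j f = 0" if "j \<in> {..<N} - {i}" for j
    using that i f(2) permutes_swap_less[of i N j] by (intro dd_sym) (auto simp: symm_def)
  hence "dunkl (of_real \<alpha>) N i f = cconst (of_real \<alpha>) * theta i f" by (simp add: dunkl_def)
  thus ?case using c[OF 0] by (simp add: lookup_theta)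
next
  case (Suc l)
  define G where "G = (dunkl (of_real \<alpha>) N i ^^ l) (dunkl (of_real \<alpha>) N i f)"
  define s where "s = lookup a i"
  let ?\<psi> = "psi \<alpha> (mults N lam) l"
  have G: "dom_bounded N (part_sums lam) G"
    unfolding G_def by (intro dom_bounded_dunkl_pow dom_bounded_dunkl f(1) i)
  have ext: "extremal N (part_sums lam) a" using extremal_exps_partition[OF Suc.prems(1)] Suc.prems(2) by simp
  have dd: "lookup (dd i j G) a = (if lookup a j < s then c * of_real (?\<psi> s) - c * of_real (?\<psi> (lookup a j)) else 0)"
    if j: "j \<in> {..<N} - {i}" for j
  proof -
    let ?b = "Poly_Mapping.map_key (transpose i j) a"
    have t: "transpose i j permutes {..<N}" using i j by (intro permutes_swap_less) auto
    have "keys ?b \<subseteq> {..<N}"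
    proof
      fix l assume "l \<in> keys ?b"
      hence "transpose i j l \<in> keys a" by (simp add: in_keys_iff lookup_map_key)
      thus "l \<in> {..<N}" using Suc.prems(1) permutes_in_image[OF t, of l] by blast
    qed
    moreover have "exps_partition N ?b = lam" using exps_partition_map_key[OF t, of a] Suc.prems(2) by simp
    ultimately have "lookup G ?b = c * of_real (?\<psi> (lookup ?b i))" unfolding G_def by (rule Suc.IH)
    moreover have "lookup ?b i = lookup a j" by (simp add: lookup_map_key)
    moreover have "lookup G a = c * of_real (?\<psi> s)" unfolding G_def s_def by (rule Suc.IH[OF Suc.prems])
    ultimately show ?thesis using lookup_dd_extremal[OF G ext i, of j] j by (auto simp: s_def)
  qed
  have "(\<Sum>j\<in>{..<N} - {i}. lookup (dd i j G) a) = (\<Sum>j\<in>{j\<in>{..<N}. lookup a j < s}. c * of_real (?\<psi> s) - c * of_real (?\<psi> (lookup a j)))"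
  proof -
    have "(\<Sum>j\<in>{..<N} - {i}. lookup (dd i j G) a) = (\<Sum>j\<in>{..<N} - {i}. if lookup a j < s then c * of_real (?\<psi> s) - c * of_real (?\<psi> (lookup a j)) else 0)"
      by (rule sum.cong) (simp_all only: dd)
    also have "\<dots> = (\<Sum>j\<in>{j\<in>{..<N} - {i}. lookup a j < s}. c * of_real (?\<psi> s) - c * of_real (?\<psi> (lookup a j)))"
      by (rule sum.inter_filter[symmetric]) simp
    also have "{j\<in>{..<N} - {i}. lookup a j < s} = {j\<in>{..<N}. lookup a j < s}" by (auto simp: s_def)
    finally show ?thesis .
  qed
  also have "\<dots> = (\<Sum>u<s. of_nat (mults N lam u) * (c * of_real (?\<psi> s) - c * of_real (?\<psi> u)))"
    unfolding sum_by_value[where a = "lookup a" and h = "\<lambda>v. c * of_real (?\<psi> s) - c * of_real (?\<psi> v)"]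
    using mults_exps_partition[of N a] Suc.prems(2) by simp
  also have "\<dots> = c * of_real ((\<Sum>u<s. real (mults N lam u)) * ?\<psi> s - (\<Sum>u<s. real (mults N lam u) * ?\<psi> u))"
    by (simp add: sum_distrib_left sum_distrib_right sum_subtractf algebra_simps)
  finally have D: "(\<Sum>j\<in>{..<N} - {i}. lookup (dd i j G) a) =
      c * of_real ((\<Sum>u<s. real (mults N lam u)) * ?\<psi> s - (\<Sum>u<s. real (mults N lam u) * ?\<psi> u))" .
  have "lookup G a = c * of_real (?\<psi> s)" unfolding G_def s_def by (rule Suc.IH[OF Suc.prems])
  hence "lookup (dunkl (of_real \<alpha>) N i G) a = of_real \<alpha> * (of_nat s * (c * of_real (?\<psi> s))) +
      c * of_real ((\<Sum>u<s. real (mults N lam u)) * ?\<psi> s - (\<Sum>u<s. real (mults N lam u) * ?\<psi> u))"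
    by (simp add: dunkl_def lookup_add lookup_theta lookup_sum D s_def)
  also have "\<dots> = c * of_real (psi \<alpha> (mults N lam) (Suc l) s)"
    by (simp add: algebra_simps)
  finally show ?case by (simp add: G_def s_def)
qed

definition ham_eigenvalue :: "real \<Rightarrow> nat \<Rightarrow> nat \<Rightarrow> real \<Rightarrow> nat list \<Rightarrow> real" where
  "ham_eigenvalue \<alpha> N K t lam = (\<Sum>l<K. t ^ l * eps \<alpha> (mults N lam) N l)"

lemma lookup_hamiltonian_leading:
  fixes \<alpha> t :: real
  assumes f: "homog_symfun N f" "dom_bounded N (part_sums lam) (sf_eval N f)"
    and c: "\<And>a. keys a \<subseteq> {..<N} \<Longrightarrow> exps_partition N a = lam \<Longrightarrow> lookup (sf_eval N f) a = c"
    and a: "keys a \<subseteq> {..<N}" "exps_partition N a = lam" and lam: "sum_list lam = N"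
  shows "lookup (sf_eval N (hamiltonian (of_real \<alpha>) N K (of_real t) f)) a = of_real (ham_eigenvalue \<alpha> N K t lam) * c"
proof -
  have L: "lookup ((dunkl (of_real \<alpha>) N i ^^ l) (dunkl (of_real \<alpha>) N i (sf_eval N f))) a =
      c * of_real (psi \<alpha> (mults N lam) l (lookup a i))" if "i < N" for i l
    using that by (intro lookup_dunkl_pow_leading f symm_sf_eval c a)
  have le: "lookup a i \<le> N" if "i < N" for i
    using member_le_sum[of i "{..<N}" "lookup a"] that sum_list_exps_partition[of N a] a lam by simp
  have "(\<Sum>i<N. psi \<alpha> (mults N lam) l (lookup a i)) = eps \<alpha> (mults N lam) N l" for l
  proof -
    have "{..<N} = {i\<in>{..<N}. lookup a i < Suc N}" using le by (auto simp: less_Suc_eq_le)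
    hence "(\<Sum>i<N. psi \<alpha> (mults N lam) l (lookup a i)) = (\<Sum>i\<in>{i\<in>{..<N}. lookup a i < Suc N}. psi \<alpha> (mults N lam) l (lookup a i))"
      by simp
    also have "\<dots> = eps \<alpha> (mults N lam) N l"
      unfolding sum_by_value eps_def lessThan_Suc_atMost using mults_exps_partition[of N a] a(2) by simp
    finally show ?thesis .
  qed
  hence "(\<Sum>i<N. c * of_real (psi \<alpha> (mults N lam) l (lookup a i))) = c * of_real (eps \<alpha> (mults N lam) N l)" for l
    by (simp flip: sum_distrib_left of_real_sum)
  hence E: "of_real t ^ l * (\<Sum>i<N. c * of_real (psi \<alpha> (mults N lam) l (lookup a i))) =
      of_real (t ^ l * eps \<alpha> (mults N lam) N l) * c" for l by simp
  have "lookup (sf_eval N (hamiltonian (of_real \<alpha>) N K (of_real t) f)) a =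
      (\<Sum>l<K. of_real t ^ l * (\<Sum>i<N. c * of_real (psi \<alpha> (mults N lam) l (lookup a i))))"
    unfolding sf_eval_hamiltonian[OF f(1)] dunkl_shift_same lookup_sum lookup_cconst_mult
    by (intro sum.cong refl arg_cong2[of _ _ _ _ times] L) auto
  also have "\<dots> = of_real (ham_eigenvalue \<alpha> N K t lam) * c"
    unfolding E ham_eigenvalue_def of_real_sum sum_distrib_right ..
  finally show ?thesis .
qed

section \<open>Power sums and symmetric polynomials\<close>

lemma lookup_psum_mult:
  "lookup (psum n k * g) a = (\<Sum>i<n. if k \<le> lookup a i then lookup g (a - single i k) else 0)"
proof -
  have "(\<forall>l. lookup (single i k) l \<le> lookup a l) \<longleftrightarrow> k \<le> lookup a i" for i
  proof
    assume "\<forall>l. lookup (single i k) l \<le> lookup a l"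
    from spec[OF this, of i] show "k \<le> lookup a i" by simp
  qed (simp add: lookup_single when_def)
  thus ?thesis unfolding psum_def sum_distrib_right lookup_sum lookup_single_mult by (simp only: mult_1)
qed

lemma sf_eval_add_ue: "sf_eval n (mon (v + ue k)) = psum n k * sf_eval n (mon v)"
  unfolding mon_add_single by (simp add: sf_eval_mult sf_eval_X)

lemma keys_ue_add_D: "0 \<notin> keys (v + ue k) \<Longrightarrow> 0 \<notin> keys v \<and> k > 0"
  unfolding keys_add_single by auto

lemma psum_mult_keyE:
  assumes "lookup (psum n k * g) a \<noteq> 0"
  obtains i b where "i < n" "a = b + single i k" "lookup g b \<noteq> 0"
proof -
  from assms obtain i where i: "i < n" "(if k \<le> lookup a i then lookup g (a - single i k) else 0) \<noteq> 0"
    unfolding lookup_psum_mult using sum.not_neutral_contains_not_neutral by blast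
  have "a = (a - single i k) + single i k"
    by (rule poly_mapping_eqI) (use i(2) in \<open>auto simp: lookup_add lookup_minus lookup_single when_def split: if_splits\<close>)
  thus ?thesis using i that[of i "a - single i k"] by (auto split: if_splits)
qed

lemma sf_eval_mon_degree:
  "lookup (sf_eval n (mon v)) a \<noteq> 0 \<Longrightarrow> keys a \<subseteq> {..<n} \<and> (\<Sum>i<n. lookup a i) = wdeg v"
proof (induction v arbitrary: a rule: expv_induct)
  case zero
  hence "a = 0" by (simp add: sf_eval_1 lookup_one when_def split: if_splits)
  thus ?case by (simp add: wdeg_def)
next
  case (add v k)
  obtain i b where ib: "i < n" "a = b + single i k" "lookup (sf_eval n (mon v)) b \<noteq> 0"
    using add.prems unfolding sf_eval_add_ue by (rule psum_mult_keyE)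
  have b: "keys b \<subseteq> {..<n}" "(\<Sum>i<n. lookup b i) = wdeg v" using add.IH[OF ib(3)] by auto
  have "keys a \<subseteq> {..<n}" using b(1) ib(1) unfolding ib(2) using keys_add[of b "single i k"] by (auto split: if_splits)
  moreover have "(\<Sum>l<n. lookup a l) = (\<Sum>l<n. lookup b l) + (\<Sum>l<n. if l = i then k else 0)"
    unfolding ib(2) lookup_add sum.distrib by (simp add: lookup_single when_def eq_commute)
  ultimately show ?case using b(2) ib(1) by (simp add: wdeg_add_single)
qed

lemma lookup_sf_eval: "lookup (sf_eval n f) a = (\<Sum>v\<in>keys f. lookup f v * lookup (sf_eval n (mon v)) a)"
  by (simp only: sf_eval_def[of n f] sf_eval_mon lookup_sum lookup_cconst_mult)

lemma sf_eval_degree: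
  assumes "homog_symfun N f" "a \<in> keys (sf_eval n f)"
  shows "keys a \<subseteq> {..<n}" "(\<Sum>i<n. lookup a i) = N"
proof -
  from assms(2) obtain v where v: "v \<in> keys f" "lookup (sf_eval n (mon v)) a \<noteq> 0"
  proof -
    from assms(2) obtain v where "v \<in> keys f" "lookup f v * lookup (sf_eval n (mon v)) a \<noteq> 0"
      unfolding in_keys_iff[of a] lookup_sf_eval[of n f] by (rule sum.not_neutral_contains_not_neutral)
    thus ?thesis by (intro that[of v]) simp_all
  qed
  from sf_eval_mon_degree[OF v(2)] v(1) assms(1)
  show "keys a \<subseteq> {..<n}" "(\<Sum>i<n. lookup a i) = N" by (auto simp: homog_symfun_def)
qed

lemma keys_minus_subset: "keys (a - b :: nat \<Rightarrow>\<^sub>0 nat) \<subseteq> keys a"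
  by (auto simp: in_keys_iff lookup_minus)

text \<open>Setting the extra variables to zero preserves every p_k except p_0, which counts
  variables; hence the condition on index 0.\<close>

lemma sf_eval_mon_restrict:
  assumes "n' \<le> n"
  shows "0 \<notin> keys v \<Longrightarrow> keys a \<subseteq> {..<n'} \<Longrightarrow> lookup (sf_eval n (mon v)) a = lookup (sf_eval n' (mon v)) a"
proof (induction v arbitrary: a rule: expv_induct)
  case zero
  thus ?case by (simp add: sf_eval_1)
next
  case (add v k)
  have v: "0 \<notin> keys v" "k > 0" using keys_ue_add_D[OF add.prems(1)] by simp_all
  have z: "lookup a i = 0" if "i \<notin> {..<n'}" for i using add.prems(2) that by (auto simp: in_keys_iff)
  have IH: "lookup (sf_eval n (mon v)) (a - single i k) = lookup (sf_eval n' (mon v)) (a - single i k)" for i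
    by (rule add.IH[OF v(1)]) (use keys_minus_subset add.prems(2) in blast)
  have "(\<Sum>i<n. if k \<le> lookup a i then lookup (sf_eval n (mon v)) (a - single i k) else 0)
      = (\<Sum>i<n'. if k \<le> lookup a i then lookup (sf_eval n (mon v)) (a - single i k) else 0)"
    by (rule sum.mono_neutral_right) (use assms v(2) z in auto)
  thus ?case unfolding sf_eval_add_ue lookup_psum_mult by (simp only: IH)
qed

lemma sf_eval_restrict:
  assumes "homog_symfun N f" "n' \<le> n" "keys a \<subseteq> {..<n'}"
  shows "lookup (sf_eval n f) a = lookup (sf_eval n' f) a"
  unfolding lookup_sf_eval[of _ f]
proof (rule sum.cong)
  fix v assume "v \<in> keys f"
  hence "0 \<notin> keys v" using assms(1) by (auto simp: homog_symfun_def)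
  thus "lookup f v * lookup (sf_eval n (mon v)) a = lookup f v * lookup (sf_eval n' (mon v)) a"
    using sf_eval_mon_restrict[OF assms(2) _ assms(3)] by simp
qed simp

text \<open>Each factor p_k either opens a new variable or raises one already present. As many
  variables as factors occur only if every factor has a variable of its own, and then the exponents
  are the parts. This is the triangularity between power sums and monomials.\<close>

lemma sf_eval_mon_support:
  "0 \<notin> keys v \<Longrightarrow> lookup (sf_eval n (mon v)) a \<noteq> 0 \<Longrightarrow>
   card (keys a) < plen v \<or> (card (keys a) = plen v \<and> (\<forall>u>0. card {i\<in>keys a. lookup a i = u} = lookup v u))"
proof (induction v arbitrary: a rule: expv_induct)
  case zero
  hence "a = 0" by (simp add: sf_eval_1 lookup_one when_def split: if_splits)
  thus ?case by (simp add: plen_def)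
next
  case (add v k)
  have v: "0 \<notin> keys v" "k > 0" using keys_ue_add_D[OF add.prems(1)] by simp_all
  obtain i b where ib: "i < n" "a = b + single i k" "lookup (sf_eval n (mon v)) b \<noteq> 0"
    using add.prems(2) unfolding sf_eval_add_ue by (rule psum_mult_keyE)
  have la: "lookup a l = lookup b l + (if l = i then k else 0)" for l
    unfolding ib(2) by (simp add: lookup_add lookup_single when_def)
  have ka: "keys a = insert i (keys b)" using v(2) by (auto simp: in_keys_iff la split: if_splits)
  have pl: "plen (v + ue k) = plen v + 1" by (rule plen_add_single)
  note IH = add.IH[OF v(1) ib(3)]
  show ?case
  proof (cases "i \<in> keys b")
    case True
    hence "keys a = keys b" using ka by (simp add: insert_absorb)
    thus ?thesis using IH pl by auto
  next
    case False
    hence bi: "lookup b i = 0" by (simp add: in_keys_iff)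
    have ca: "card (keys a) = Suc (card (keys b))" using ka False by simp
    show ?thesis
    proof (cases "card (keys b) < plen v")
      case True thus ?thesis using ca pl by simp
    next
      case nless: False
      hence eq: "card (keys b) = plen v" "\<forall>u>0. card {i\<in>keys b. lookup b i = u} = lookup v u" using IH by auto
      have "card {l\<in>keys a. lookup a l = u} = lookup (v + ue k) u" if u: "u > 0" for u
      proof (cases "u = k")
        case True
        have "{l\<in>keys a. lookup a l = u} = insert i {l\<in>keys b. lookup b l = u}"
          using ka la bi False True by auto
        thus ?thesis using eq(2) u False True by (simp add: lookup_add)
      next
        case False2: False
        have "{l\<in>keys a. lookup a l = u} = {l\<in>keys b. lookup b l = u}"
          using ka la bi False False2 u by (auto split: if_splits)
        thus ?thesis using eq(2) u False2 by (simp add: lookup_add lookup_single when_def)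
      qed
      thus ?thesis using ca eq(1) pl by simp
    qed
  qed
qed

text \<open>Rules out cancellation, so that a single contributing term suffices in
  \<open>sf_eval_mon_support_exists\<close>.\<close>

lemma sf_eval_mon_nonneg: "Im (lookup (sf_eval n (mon v)) a) = 0 \<and> Re (lookup (sf_eval n (mon v)) a) \<ge> 0"
proof (induction v arbitrary: a rule: expv_induct)
  case zero
  show ?case by (simp add: sf_eval_1 lookup_one when_def)
next
  case (add v k)
  show ?case unfolding sf_eval_add_ue lookup_psum_mult Im_sum Re_sum
    by (intro conjI sum.neutral sum_nonneg) (use add in auto)
qed

lemma sf_eval_mon_support_exists:
  "0 \<notin> keys v \<Longrightarrow> plen v \<le> n \<Longrightarrow> \<exists>a. lookup (sf_eval n (mon v)) a \<noteq> 0 \<and> card (keys a) = plen v"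
proof (induction v rule: expv_induct)
  case zero
  thus ?case by (intro exI[of _ 0]) (simp add: sf_eval_1 plen_def)
next
  case (add v k)
  have v: "0 \<notin> keys v" "k > 0" using keys_ue_add_D[OF add.prems(1)] by simp_all
  have pl: "plen (v + ue k) = plen v + 1" by (rule plen_add_single)
  then obtain b where b: "lookup (sf_eval n (mon v)) b \<noteq> 0" "card (keys b) = plen v"
    using add.IH[OF v(1)] add.prems(2) by auto
  have "card (keys b) < card {..<n}" using b(2) pl add.prems(2) by simp
  then obtain i where i: "i < n" "i \<notin> keys b"
    by (metis card_mono finite_keys lessThan_iff linorder_not_le subsetI)
  define a where "a = b + single i k"
  have ka: "keys a = insert i (keys b)" using v(2) by (auto simp: a_def in_keys_iff lookup_add lookup_single when_def split: if_splits)
  have ab: "a - single i k = b" by (simp add: a_def)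
  have lai: "k \<le> lookup a i" by (simp add: a_def lookup_add)
  have "0 < Re (lookup (sf_eval n (mon v)) b)"
    using sf_eval_mon_nonneg[of n v b] b(1) by (metis complex_eq_iff less_eq_real_def zero_complex.simps)
  also have "\<dots> = Re (if k \<le> lookup a i then lookup (sf_eval n (mon v)) (a - single i k) else 0)"
    using ab lai by simp
  also have "\<dots> \<le> (\<Sum>i<n. Re (if k \<le> lookup a i then lookup (sf_eval n (mon v)) (a - single i k) else 0))"
    by (rule member_le_sum) (use i sf_eval_mon_nonneg in auto)
  also have "\<dots> = Re (lookup (sf_eval n (mon (v + ue k))) a)"
    unfolding sf_eval_add_ue lookup_psum_mult by simp
  finally have "lookup (sf_eval n (mon (v + ue k))) a \<noteq> 0" by auto
  moreover have "card (keys a) = plen (v + ue k)" using ka i(2) b(2) pl by simp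
  ultimately show ?case by blast
qed

lemma plen_le_wdeg: "0 \<notin> keys v \<Longrightarrow> plen v \<le> wdeg v"
  unfolding plen_def wdeg_def by (rule sum_mono) (auto intro: Suc_leI gr0I)

text \<open>Let v be a product in \<open>f\<close> with the most factors. A monomial with as many
  variables as v has factors, taken from v, comes from no other product in \<open>f\<close>, so its
  coefficient cannot cancel. There is room for it because v has at most N factors.\<close>

lemma sf_eval_injective:
  assumes "homog_symfun N f" "sf_eval N f = 0"
  shows "f = 0"
proof (rule ccontr)
  assume "f \<noteq> 0"
  hence ne: "keys f \<noteq> {}" by simp
  define M where "M = Max (plen ` keys f)"
  have "M \<in> plen ` keys f" unfolding M_def by (rule Max_in) (use ne in auto)
  then obtain v where v: "v \<in> keys f" "plen v = M" by auto
  have vh: "0 \<notin> keys v" "wdeg v = N" using v assms(1) by (auto simp: homog_symfun_def)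
  obtain a where a: "lookup (sf_eval N (mon v)) a \<noteq> 0" "card (keys a) = plen v"
    using sf_eval_mon_support_exists[OF vh(1)] plen_le_wdeg[OF vh(1)] vh(2) by blast
  have va: "\<forall>u>0. card {i\<in>keys a. lookup a i = u} = lookup v u"
    using sf_eval_mon_support[OF vh(1) a(1)] a(2) by simp
  have other: "lookup (sf_eval N (mon w)) a = 0" if w: "w \<in> keys f" "w \<noteq> v" for w
  proof (rule ccontr)
    assume nz: "lookup (sf_eval N (mon w)) a \<noteq> 0"
    have wh: "0 \<notin> keys w" using w assms(1) by (auto simp: homog_symfun_def)
    have "plen w \<le> M" unfolding M_def by (rule Max_ge) (use w in auto)
    hence wa: "\<forall>u>0. card {i\<in>keys a. lookup a i = u} = lookup w u"
      using sf_eval_mon_support[OF wh nz] a(2) v(2) by auto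
    have "w = v"
    proof (rule poly_mapping_eqI)
      fix u show "lookup w u = lookup v u"
        using va wa vh(1) wh by (cases "u = 0") (auto simp: in_keys_iff)
    qed
    thus False using w(2) by simp
  qed
  have "lookup (sf_eval N f) a = (\<Sum>w\<in>keys f. if w = v then lookup f v * lookup (sf_eval N (mon v)) a else 0)"
    unfolding lookup_sf_eval[of _ f] by (rule sum.cong) (auto simp: other)
  hence "lookup (sf_eval N f) a = lookup f v * lookup (sf_eval N (mon v)) a" using v(1) by simp
  thus False using assms(2) a(1) v(1) by (simp add: in_keys_iff)
qed

section \<open>Partitions as multisets, and surjectivity of evaluation in N variables\<close>

lemma count_exps_partition:
  assumes "u > 0"
  shows "count (mset (exps_partition N a)) u = card {i\<in>{..<N}. lookup a i = u}"
proof -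
  have "mset (exps_partition N a) = filter_mset (\<lambda>x. x \<noteq> 0) (image_mset (lookup a) (mset_set {0..<N}))"
    unfolding exps_partition_eq_filter by (simp flip: mset_upt)
  hence "count (mset (exps_partition N a)) u = count (image_mset (lookup a) (mset_set {0..<N})) u"
    using assms by simp
  also have "\<dots> = card {i\<in>{..<N}. lookup a i = u}"
    by (simp add: count_image_mset) (auto intro!: arg_cong[of _ _ card])
  finally show ?thesis .
qed

lemma partition_eqI_count:
  assumes "is_partition lam" "is_partition mu" "\<And>u. u > 0 \<Longrightarrow> count (mset lam) u = count (mset mu) u"
  shows "lam = mu"
proof -
  have z: "count (mset lam) 0 = 0" "count (mset mu) 0 = 0"
    using assms(1,2) by (simp_all add: is_partition_def count_mset count_list_0_iff)
  have "count (mset lam) u = count (mset mu) u" for u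
    using z assms(3)[of u] by (cases "u = 0") (simp_all only: neq0_conv)
  hence "mset lam = mset mu" by (intro multiset_eqI) blast
  hence "sort lam = sort mu" by (metis properties_for_sort sort_key_simps sorted_sort mset_sort)
  moreover have "rev (sort xs) = xs" if "is_partition xs" for xs
  proof -
    have "sort xs = rev xs"
      by (rule properties_for_sort) (use that in \<open>auto simp: is_partition_def sorted_wrt_rev\<close>)
    thus ?thesis by simp
  qed
  ultimately show ?thesis using assms(1,2) by metis
qed

abbreviation partitions_of :: "nat \<Rightarrow> nat list set" where
  "partitions_of N \<equiv> {lam. is_partition lam \<and> sum_list lam = N}"

lemma length_le_sum_list: "0 \<notin> set lam \<Longrightarrow> length lam \<le> sum_list lam" for lam :: "nat list"
  by (induction lam) (auto simp: Suc_le_eq add_strict_increasing2)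

lemma partition_length_le: "lam \<in> partitions_of N \<Longrightarrow> length lam \<le> N"
  using length_le_sum_list[of lam] by (auto simp: is_partition_def)

lemma finite_partitions: "finite (partitions_of N)"
proof (rule finite_subset)
  show "partitions_of N \<subseteq> {xs. set xs \<subseteq> {..N} \<and> length xs \<le> N}"
    using partition_length_le by (auto dest: member_le_sum_list)
  show "finite {xs. set xs \<subseteq> {..N} \<and> length xs \<le> N}" by (rule finite_lists_length_le) simp
qed

lemma exps_partition_in_partitions: "(\<Sum>i<N. lookup a i) = M \<Longrightarrow> exps_partition N a \<in> partitions_of M"
  by (simp add: is_partition_exps sum_list_exps_partition)

lemma length_exps_partition_eq_card:
  assumes "keys a \<subseteq> {..<N}"
  shows "length (exps_partition N a) = card (keys a)"
proof -
  have "length (exps_partition N a) = length (filter (\<lambda>x. x \<noteq> 0) (map (lookup a) [0..<N]))"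
    by (simp add: exps_partition_def)
  also have "\<dots> = card {i. i < N \<and> lookup a i \<noteq> 0}"
    unfolding length_filter_conv_card by (rule arg_cong[of _ _ card]) auto
  also have "{i. i < N \<and> lookup a i \<noteq> 0} = keys a" using assms by (auto simp: in_keys_iff)
  finally show ?thesis .
qed

text \<open>An exponent vector over the power sums, recording multiplicities of parts; in contrast,
  \<open>Poly_Mapping.nth lam\<close> is an exponent vector over the variables.\<close>

definition exps_of_partition :: "nat list \<Rightarrow> (nat \<Rightarrow>\<^sub>0 nat)" where
  "exps_of_partition lam = Abs_poly_mapping (\<lambda>u. if u = 0 then 0 else count (mset lam) u)"

lemma lookup_exps_of_partition: "lookup (exps_of_partition lam) u = (if u = 0 then 0 else count (mset lam) u)"
proof -
  have "finite {u. (if u = 0 then 0 else count (mset lam) u) \<noteq> 0}"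
    by (rule finite_subset[of _ "set lam"]) (auto simp: count_eq_zero_iff split: if_splits)
  thus ?thesis by (simp add: exps_of_partition_def)
qed

lemma exps_of_partition_props:
  assumes "is_partition lam"
  shows "keys (exps_of_partition lam) = set lam" "plen (exps_of_partition lam) = length lam"
    "wdeg (exps_of_partition lam) = sum_list lam"
proof -
  have z: "0 \<notin> set lam" using assms by (simp add: is_partition_def)
  show k: "keys (exps_of_partition lam) = set lam"
  proof (intro set_eqI)
    fix u show "u \<in> keys (exps_of_partition lam) \<longleftrightarrow> u \<in> set lam"
      using z by (cases "u = 0") (auto simp: in_keys_iff lookup_exps_of_partition count_mset_0_iff)
  qed
  have l: "lookup (exps_of_partition lam) u = count (mset lam) u" if "u \<in> set lam" for u
    using that z by (auto simp: lookup_exps_of_partition)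
  show "plen (exps_of_partition lam) = length lam"
    unfolding plen_def k using size_multiset_overloaded_eq[of "mset lam"] by (simp add: l)
  show "wdeg (exps_of_partition lam) = sum_list lam"
    unfolding wdeg_def k using sum_list_map_eq_sum_count[of id lam]
    by (simp add: l count_mset mult.commute)
qed

lemma symm_diff: "symm n f \<Longrightarrow> symm n g \<Longrightarrow> symm n (f - g)"
  by (simp add: symm_def clin_diff[OF clin_pact])

text \<open>Elimination by the number s of variables in a monomial. Among monomials with s
  variables, a product of s power sums contains only the rearrangements of its own parts, so a
  suitable combination of such products cancels this top layer of \<open>f\<close>.\<close>

lemma sf_eval_surjective_aux:
  assumes "symm N f" "\<And>a. a \<in> keys f \<Longrightarrow> keys a \<subseteq> {..<N} \<and> (\<Sum>i<N. lookup a i) = N \<and> card (keys a) < s"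
  shows "\<exists>g. homog_symfun N g \<and> sf_eval N g = f"
  using assms
proof (induction s arbitrary: f)
  case 0
  hence "keys f = {}" by blast
  hence "f = 0" by simp
  thus ?case by (intro exI[of _ 0]) (simp add: clin_0[OF clin_sf_eval])
next
  case (Suc s)
  define L where "L = {lam\<in>partitions_of N. length lam = s}"
  have finL: "finite L" unfolding L_def by (rule finite_subset[OF _ finite_partitions[of N]]) auto
  define p where "p lam = mon (exps_of_partition lam)" for lam
  have hp: "homog_symfun N (p lam)" if "lam \<in> L" for lam
    using that exps_of_partition_props[of lam] by (auto simp: homog_symfun_def p_def L_def is_partition_def)
  have p0: "lookup (sf_eval N (p lam)) a = 0"
    if "lam \<in> L" "keys a \<subseteq> {..<N}" "card (keys a) > s \<or> card (keys a) = s \<and> exps_partition N a \<noteq> lam" for lam a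
  proof (rule ccontr)
    assume nz: "lookup (sf_eval N (p lam)) a \<noteq> 0"
    have lam: "is_partition lam" "length lam = s" using that(1) by (auto simp: L_def)
    have "0 \<notin> keys (exps_of_partition lam)" using exps_of_partition_props(1)[OF lam(1)] lam(1) by (simp add: is_partition_def)
    from sf_eval_mon_support[OF this nz[unfolded p_def]] that(3)
    have *: "exps_partition N a \<noteq> lam" "\<forall>u>0. card {i\<in>keys a. lookup a i = u} = lookup (exps_of_partition lam) u"
      using exps_of_partition_props(2)[OF lam(1)] lam(2) by auto
    have "exps_partition N a = lam"
    proof (rule partition_eqI_count[OF is_partition_exps lam(1)])
      fix u :: nat assume u: "u > 0"
      have "i < N" if "lookup a i \<noteq> 0" for i
        using \<open>keys a \<subseteq> {..<N}\<close> that by (metis in_keys_iff lessThan_iff subsetD)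
      hence "{i\<in>{..<N}. lookup a i = u} = {i\<in>keys a. lookup a i = u}" using u by (auto simp: in_keys_iff)
      thus "count (mset (exps_partition N a)) u = count (mset lam) u"
        using *(2) u by (simp add: count_exps_partition lookup_exps_of_partition)
    qed
    thus False using *(1) by simp
  qed
  define r where "r lam = Poly_Mapping.nth lam" for lam :: "nat list"
  have r: "keys (r lam) \<subseteq> {..<N}" "exps_partition N (r lam) = lam" if "lam \<in> L" for lam
    using exps_partition_nth[of lam N] partition_length_le[of lam N] that by (auto simp: r_def L_def)
  have rnz: "lookup (sf_eval N (p lam)) (r lam) \<noteq> 0" if lam: "lam \<in> L" for lam
  proof -
    have pl: "is_partition lam" "length lam = s" "length lam \<le> N" using lam partition_length_le[of lam N] by (auto simp: L_def)
    have "0 \<notin> keys (exps_of_partition lam)" using exps_of_partition_props(1)[OF pl(1)] pl(1) by (simp add: is_partition_def)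
    then obtain a where a: "lookup (sf_eval N (p lam)) a \<noteq> 0" "card (keys a) = s"
      using sf_eval_mon_support_exists[of "exps_of_partition lam" N] exps_of_partition_props(2)[OF pl(1)] pl
      unfolding p_def by auto
    have ka: "keys a \<subseteq> {..<N}" using sf_eval_mon_degree a(1) unfolding p_def by blast
    have "exps_partition N a = lam" using p0[OF lam ka] a by auto
    hence "lookup (sf_eval N (p lam)) a = lookup (sf_eval N (p lam)) (r lam)"
      using r[OF lam] ka by (intro symm_lookup_eq[OF symm_sf_eval]) auto
    thus ?thesis using a(1) by simp
  qed
  \<comment> \<open>On the representatives \<open>r lam\<close> the system is diagonal, so each
    coefficient of \<open>q\<close> is a quotient by a nonzero diagonal entry.\<close>
  define q where "q = (\<Sum>lam\<in>L. cconst (lookup f (r lam) / lookup (sf_eval N (p lam)) (r lam)) * p lam)"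
  have hq: "homog_symfun N q" unfolding q_def by (intro homog_sum homog_scale hp)
  have lq: "lookup (sf_eval N q) a = (\<Sum>lam\<in>L. lookup f (r lam) / lookup (sf_eval N (p lam)) (r lam) * lookup (sf_eval N (p lam)) a)" for a
    unfolding q_def clin_sum[OF clin_sf_eval] sf_eval_scale lookup_sum lookup_cconst_mult ..
  have "\<exists>g. homog_symfun N g \<and> sf_eval N g = f - sf_eval N q"
  proof (rule Suc.IH)
    show "symm N (f - sf_eval N q)" by (intro symm_diff Suc.prems(1) symm_sf_eval)
    fix a assume a: "a \<in> keys (f - sf_eval N q)"
    hence "a \<in> keys f \<or> a \<in> keys (sf_eval N q)" by (auto simp: in_keys_iff lookup_minus)
    hence ka: "keys a \<subseteq> {..<N}" "(\<Sum>i<N. lookup a i) = N"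
      using Suc.prems(2) sf_eval_degree[OF hq] by blast+
    have "card (keys a) < s"
    proof (rule ccontr)
      assume "\<not> card (keys a) < s"
      then consider "card (keys a) > s" | "card (keys a) = s" by linarith
      hence "lookup (f - sf_eval N q) a = 0"
      proof cases
        case 1
        hence "lookup f a = 0" using Suc.prems(2)[of a] by (auto simp: in_keys_iff)
        moreover have "lookup (sf_eval N q) a = 0"
          unfolding lq by (rule sum.neutral) (use p0 ka(1) 1 in auto)
        ultimately show ?thesis by (simp add: lookup_minus)
      next
        case 2
        define lam where "lam = exps_partition N a"
        have lam: "lam \<in> L"
          using exps_partition_in_partitions[OF ka(2)] length_exps_partition_eq_card[OF ka(1)] 2 by (simp add: L_def lam_def)
        have eq: "lookup h a = lookup h (r lam)" if "symm N h" for h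
          by (rule symm_lookup_eq[OF that ka(1)]) (use r[OF lam] in \<open>simp_all add: lam_def\<close>)
        have "lookup (sf_eval N q) a = (\<Sum>mu\<in>L. if mu = lam then lookup f (r lam) else 0)"
          unfolding lq
        proof (rule sum.cong)
          fix mu assume mu: "mu \<in> L"
          show "lookup f (r mu) / lookup (sf_eval N (p mu)) (r mu) * lookup (sf_eval N (p mu)) a = (if mu = lam then lookup f (r lam) else 0)"
          proof (cases "mu = lam")
            case True thus ?thesis using rnz[OF mu] eq[OF symm_sf_eval] by simp
          next
            case False thus ?thesis using p0[OF mu ka(1)] 2 lam_def by simp
          qed
        qed simp
        hence "lookup (sf_eval N q) a = lookup f (r lam)" using finL lam by simp
        thus ?thesis using eq[OF Suc.prems(1)] by (simp add: lookup_minus)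
      qed
      thus False using a by (simp add: in_keys_iff)
    qed
    thus "keys a \<subseteq> {..<N} \<and> (\<Sum>i<N. lookup a i) = N \<and> card (keys a) < s" using ka by blast
  qed
  then obtain g where "homog_symfun N g" "sf_eval N g = f - sf_eval N q" by blast
  hence "homog_symfun N (g + q)" "sf_eval N (g + q) = f"
    using hq by (simp_all add: homog_add clin_add[OF clin_sf_eval])
  thus ?case by blast
qed

theorem sf_eval_surjective:
  assumes "symm N f" "\<And>a. a \<in> keys f \<Longrightarrow> keys a \<subseteq> {..<N} \<and> (\<Sum>i<N. lookup a i) = N"
  shows "\<exists>g. homog_symfun N g \<and> sf_eval N g = f"
proof (rule sf_eval_surjective_aux[OF assms(1)])
  fix a assume "a \<in> keys f"
  from assms(2)[OF this] show "keys a \<subseteq> {..<N} \<and> (\<Sum>i<N. lookup a i) = N \<and> card (keys a) < Suc N"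
    using card_mono[of "{..<N}" "keys a"] by auto
qed

section \<open>Eigenvectors of the Hamiltonian\<close>

lemma finite_exps_fiber: "finite {a. keys a \<subseteq> {..<N} \<and> exps_partition N a = mu}"
proof (rule finite_imageD)
  let ?g = "\<lambda>a. map (lookup a) [0..<N]"
  have le: "lookup a i \<le> sum_list (exps_partition N a)" if "i < N" for a i
    unfolding sum_list_exps_partition by (rule member_le_sum) (use that in auto)
  show "finite (?g ` {a. keys a \<subseteq> {..<N} \<and> exps_partition N a = mu})"
  proof (rule finite_subset)
    show "?g ` {a. keys a \<subseteq> {..<N} \<and> exps_partition N a = mu} \<subseteq> {xs. set xs \<subseteq> {..sum_list mu} \<and> length xs \<le> N}"
      using le by auto
    show "finite {xs. set xs \<subseteq> {..sum_list mu} \<and> length xs \<le> N}" by (rule finite_lists_length_le) simp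
  qed
  show "inj_on ?g {a. keys a \<subseteq> {..<N} \<and> exps_partition N a = mu}"
  proof (rule inj_onI)
    fix a b :: "nat \<Rightarrow>\<^sub>0 nat"
    assume ab: "a \<in> {a. keys a \<subseteq> {..<N} \<and> exps_partition N a = mu}" "b \<in> {a. keys a \<subseteq> {..<N} \<and> exps_partition N a = mu}" and eq: "?g a = ?g b"
    show "a = b"
    proof (rule poly_mapping_eqI)
      fix i show "lookup a i = lookup b i"
      proof (cases "i < N")
        case True thus ?thesis using arg_cong[OF eq, of "\<lambda>xs. xs ! i"] by simp
      next
        case False
        hence "i \<notin> keys a" "i \<notin> keys b" using ab by auto
        thus ?thesis by (simp add: in_keys_iff)
      qed
    qed
  qed
qed

lemma lookup_msym: "lookup (msym N mu) a = (if keys a \<subseteq> {..<N} \<and> exps_partition N a = mu then 1 else 0)"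
proof -
  have "lookup (msym N mu) a = (\<Sum>b\<in>{a. keys a \<subseteq> {..<N} \<and> exps_partition N a = mu}. if b = a then 1 else 0)"
    unfolding msym_def lookup_sum by (rule sum.cong) (auto simp: lookup_single when_def)
  thus ?thesis using finite_exps_fiber[of N mu] by simp
qed

lemma keys_map_key_subset:
  assumes "p permutes {..<N}" "keys a \<subseteq> {..<N}"
  shows "keys (Poly_Mapping.map_key p a) \<subseteq> {..<N}"
proof
  fix i assume "i \<in> keys (Poly_Mapping.map_key p a)"
  hence "p i \<in> keys a" using permutes_inj[OF assms(1)] by (simp add: in_keys_iff lookup_map_key)
  thus "i \<in> {..<N}" using assms permutes_in_image[OF assms(1), of i] by blast
qed

lemma symmI:
  assumes "\<And>p a. p permutes {..<N} \<Longrightarrow> keys a \<subseteq> {..<N} \<Longrightarrow> lookup f (Poly_Mapping.map_key p a) = lookup f a"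
    and "\<And>a. a \<in> keys f \<Longrightarrow> keys a \<subseteq> {..<N}"
  shows "symm N f"
  unfolding symm_def
proof (intro allI impI poly_mapping_eqI)
  fix p a assume p: "p permutes {..<N}"
  show "lookup (pact p f) a = lookup f a"
  proof (cases "keys a \<subseteq> {..<N}")
    case True
    thus ?thesis using assms(1)[OF p] p by (simp add: lookup_pact permutes_bij)
  next
    case False
    have "\<not> keys (Poly_Mapping.map_key p a) \<subseteq> {..<N}"
    proof
      assume "keys (Poly_Mapping.map_key p a) \<subseteq> {..<N}"
      from keys_map_key_subset[OF permutes_inv[OF p] this]
      have "keys (Poly_Mapping.map_key (inv p) (Poly_Mapping.map_key p a)) \<subseteq> {..<N}" .
      moreover have "Poly_Mapping.map_key (inv p) (Poly_Mapping.map_key p a) = a"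
        using permutes_inj[OF p] permutes_inj[OF permutes_inv[OF p]]
        by (intro poly_mapping_eqI) (simp add: lookup_map_key permutes_inverses(1)[OF p])
      ultimately show False using False by simp
    qed
    hence "lookup f (Poly_Mapping.map_key p a) = 0" using assms(2) by (auto simp: in_keys_iff)
    moreover have "lookup f a = 0" using assms(2) False by (auto simp: in_keys_iff)
    ultimately show ?thesis using p by (simp add: lookup_pact permutes_bij)
  qed
qed

lemma symm_msym: "symm N (msym N mu)"
proof (rule symmI)
  fix p and a :: "nat \<Rightarrow>\<^sub>0 nat" assume "p permutes {..<N}" "keys a \<subseteq> {..<N}"
  thus "lookup (msym N mu) (Poly_Mapping.map_key p a) = lookup (msym N mu) a"
    by (simp add: lookup_msym exps_partition_map_key keys_map_key_subset)
qed (auto simp: in_keys_iff lookup_msym split: if_splits)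

text \<open>The monomial symmetric function written in power sums; for a partition,
  \<open>sf_eval_surjective\<close> provides the preimage in as many variables as the
  degree.\<close>

definition msym_lift :: "nat list \<Rightarrow> cpoly" where
  "msym_lift mu = (SOME g. homog_symfun (sum_list mu) g \<and> sf_eval (sum_list mu) g = msym (sum_list mu) mu)"

lemma msym_lift_spec:
  assumes "mu \<in> partitions_of N"
  shows "homog_symfun N (msym_lift mu)" "sf_eval N (msym_lift mu) = msym N mu"
proof -
  have "\<exists>g. homog_symfun N g \<and> sf_eval N g = msym N mu"
  proof (rule sf_eval_surjective[OF symm_msym])
    fix a assume "a \<in> keys (msym N mu)"
    hence "keys a \<subseteq> {..<N}" "exps_partition N a = mu" by (auto simp: in_keys_iff lookup_msym split: if_splits)
    thus "keys a \<subseteq> {..<N} \<and> (\<Sum>i<N. lookup a i) = N"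
      using sum_list_exps_partition[of N a] assms by simp
  qed
  from someI_ex[OF this] show "homog_symfun N (msym_lift mu)" "sf_eval N (msym_lift mu) = msym N mu"
    using assms by (simp_all add: msym_lift_def)
qed

text \<open>The coefficient of the monomial symmetric function of \<open>lam\<close>.\<close>
definition mcoeff :: "nat list \<Rightarrow> cpoly \<Rightarrow> complex" where
  "mcoeff lam f = lookup (sf_eval (sum_list lam) f) (Poly_Mapping.nth lam)"

lemma lookup_sf_eval_mcoeff:
  assumes "keys a \<subseteq> {..<N}" "exps_partition N a = lam" "sum_list lam = N"
  shows "lookup (sf_eval N f) a = mcoeff lam f"
proof -
  have "lam \<in> partitions_of N" using assms is_partition_exps[of N a] by auto
  hence "keys (Poly_Mapping.nth lam) \<subseteq> {..<N}" "exps_partition N (Poly_Mapping.nth lam) = lam"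
    using exps_partition_nth[of lam N] partition_length_le[of lam N] by auto
  thus ?thesis unfolding mcoeff_def assms(3)
    by (intro symm_lookup_eq[OF symm_sf_eval]) (use assms in auto)
qed

lemma partition_representative:
  assumes "lam \<in> partitions_of N"
  obtains a where "keys a \<subseteq> {..<N}" "exps_partition N a = lam"
proof (rule that)
  have "is_partition lam" "length lam \<le> N" using partition_length_le[OF assms] assms by simp_all
  thus "keys (Poly_Mapping.nth lam) \<subseteq> {..<N}" "exps_partition N (Poly_Mapping.nth lam) = lam"
    by (rule exps_partition_nth)+
qed

lemma mcoeff_add: "mcoeff lam (f + g) = mcoeff lam f + mcoeff lam g"
  by (simp add: mcoeff_def clin_add[OF clin_sf_eval] lookup_add)

lemma mcoeff_diff: "mcoeff lam (f - g) = mcoeff lam f - mcoeff lam g"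
  by (simp add: mcoeff_def clin_diff[OF clin_sf_eval] lookup_minus)

lemma mcoeff_scale: "mcoeff lam (cconst c * f) = c * mcoeff lam f"
  by (simp add: mcoeff_def sf_eval_scale)

lemma mcoeff_msym_lift:
  assumes "lam \<in> partitions_of N" "mu \<in> partitions_of N"
  shows "mcoeff lam (msym_lift mu) = (if lam = mu then 1 else 0)"
proof -
  obtain a where a: "keys a \<subseteq> {..<N}" "exps_partition N a = lam" by (rule partition_representative[OF assms(1)])
  have "mcoeff lam (msym_lift mu) = lookup (msym N mu) a"
    using lookup_sf_eval_mcoeff[OF a, of "msym_lift mu"] msym_lift_spec(2)[OF assms(2)] assms(1) by simp
  thus ?thesis using a by (simp add: lookup_msym)
qed

text \<open>The span of the monomial symmetric functions of \<open>D\<close> within degree N,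
  phrased by vanishing coefficients so that it can be checked at each partition separately.\<close>

definition in_span :: "nat \<Rightarrow> nat list set \<Rightarrow> cpoly \<Rightarrow> bool" where
  "in_span N D f \<longleftrightarrow> homog_symfun N f \<and> (\<forall>lam\<in>partitions_of N. mcoeff lam f \<noteq> 0 \<longrightarrow> lam \<in> D)"

lemma in_span_all: "homog_symfun N f \<Longrightarrow> in_span N (partitions_of N) f"
  by (simp add: in_span_def)

lemma in_span_diff: "in_span N D f \<Longrightarrow> in_span N D g \<Longrightarrow> in_span N D (f - g)"
  by (auto simp: in_span_def mcoeff_diff homog_diff)

lemma in_span_add: "in_span N D f \<Longrightarrow> in_span N D g \<Longrightarrow> in_span N D (f + g)"
  by (auto simp: in_span_def mcoeff_add homog_add)

lemma in_span_scale: "in_span N D f \<Longrightarrow> in_span N D (cconst c * f)"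
  by (auto simp: in_span_def mcoeff_scale homog_scale)

lemma in_span_mono: "in_span N D f \<Longrightarrow> D \<subseteq> E \<Longrightarrow> in_span N E f"
  by (auto simp: in_span_def)

lemma keys_sf_eval_partition:
  assumes "homog_symfun N f" "a \<in> keys (sf_eval N f)"
  shows "exps_partition N a \<in> partitions_of N" "mcoeff (exps_partition N a) f \<noteq> 0"
proof -
  note deg = sf_eval_degree[OF assms]
  show p: "exps_partition N a \<in> partitions_of N" by (rule exps_partition_in_partitions[OF deg(2)])
  show "mcoeff (exps_partition N a) f \<noteq> 0"
    using lookup_sf_eval_mcoeff[OF deg(1) refl, of f] p assms(2) by (simp add: in_keys_iff)
qed

lemma in_span_empty:
  assumes "in_span N {} f"
  shows "f = 0"
proof (rule sf_eval_injective)
  show h: "homog_symfun N f" using assms by (simp add: in_span_def)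
  have "keys (sf_eval N f) = {}"
    using keys_sf_eval_partition[OF h] assms unfolding in_span_def by blast
  thus "sf_eval N f = 0" by simp
qed

abbreviation below :: "nat list \<Rightarrow> nat list set" where
  "below lam \<equiv> {mu. is_partition mu \<and> dominated mu lam}"

abbreviation strictly_below :: "nat list \<Rightarrow> nat list set" where
  "strictly_below lam \<equiv> {mu. is_partition mu \<and> dominated mu lam \<and> mu \<noteq> lam}"

lemma below_subset: "lam \<in> partitions_of N \<Longrightarrow> below lam \<subseteq> partitions_of N"
  by (auto simp: dominated_def)

text \<open>Bridge between the two views of dominance: coefficients at partitions for linear algebra
  in \<Lambda>, subset sums of exponents for Dunkl operators.\<close>

lemma in_span_below_iff:
  assumes "lam \<in> partitions_of N" "homog_symfun N f"
  shows "in_span N (below lam) f \<longleftrightarrow> dom_bounded N (part_sums lam) (sf_eval N f)"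
proof
  assume s: "in_span N (below lam) f"
  show "dom_bounded N (part_sums lam) (sf_eval N f)"
    unfolding dom_bounded_def
  proof
    fix a assume a: "a \<in> keys (sf_eval N f)"
    have "dominated (exps_partition N a) lam"
      using keys_sf_eval_partition[OF assms(2) a] s unfolding in_span_def by blast
    thus "vec_bounded N (part_sums lam) a"
      using dominated_exps_iff[of a N lam] sf_eval_degree[OF assms(2) a] assms(1) by simp
  qed
next
  assume b: "dom_bounded N (part_sums lam) (sf_eval N f)"
  have "mu \<in> below lam" if mu: "mu \<in> partitions_of N" "mcoeff mu f \<noteq> 0" for mu
  proof -
    obtain a where a: "keys a \<subseteq> {..<N}" "exps_partition N a = mu" by (rule partition_representative[OF mu(1)])
    have key: "a \<in> keys (sf_eval N f)" using lookup_sf_eval_mcoeff[OF a, of f] mu by (simp add: in_keys_iff)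
    hence "vec_bounded N (part_sums lam) a" using b by (simp add: dom_bounded_def)
    thus ?thesis using dominated_exps_iff[of a N lam] sf_eval_degree[OF assms(2) key] assms(1) a mu(1) by simp
  qed
  thus "in_span N (below lam) f" using assms(2) by (simp add: in_span_def)
qed

section \<open>Triangular linear algebra along the dominance order\<close>

definition down_closed :: "nat \<Rightarrow> nat list set \<Rightarrow> bool" where
  "down_closed N D \<longleftrightarrow> D \<subseteq> partitions_of N \<and> (\<forall>lam\<in>D. below lam \<subseteq> D)"

text \<open>Induction along an unspecified linear extension of dominance: a nonempty down-closed set
  has a maximal element, and removing it leaves a down-closed set.\<close>

lemma down_closed_induct [consumes 1, case_names empty insert]:
  assumes "down_closed N D"
    and "P {}"
    and step: "\<And>D lam. down_closed N D \<Longrightarrow> lam \<in> partitions_of N \<Longrightarrow> lam \<notin> D \<Longrightarrow> strictly_below lam \<subseteq> D \<Longrightarrow> P D \<Longrightarrow> P (insert lam D)"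
  shows "P D"
  using assms(1)
proof (induction "card D" arbitrary: D)
  case 0
  hence "D = {}" using finite_subset[OF _ finite_partitions] unfolding down_closed_def by auto
  thus ?case using assms(2) by simp
next
  case (Suc c)
  have fin: "finite D" using Suc.prems finite_subset[OF _ finite_partitions] unfolding down_closed_def by auto
  have ne: "D \<noteq> {}" using Suc.hyps(2) by auto
  have part: "is_partition x" if "x \<in> D" for x using Suc.prems that by (auto simp: down_closed_def)
  have "\<exists>m\<in>D. \<forall>x\<in>D. dominated m x \<longrightarrow> x = m"
    using fin ne part
  proof (induction D rule: finite_ne_induct)
    case (insert y F)
    then obtain m where m: "m \<in> F" "\<forall>x\<in>F. dominated m x \<longrightarrow> x = m" by auto
    show ?case
    proof (cases "dominated m y")
      case True
      have "x = y" if "x \<in> insert y F" "dominated y x" for x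
      proof (cases "x = y")
        case False
        hence "x = m" using m(2) that dominated_trans[OF True that(2)] by auto
        hence "dominated y m" using that(2) by simp
        thus ?thesis using dominated_antisym[of y m] True insert.prems m(1) \<open>x = m\<close> by auto
      qed simp
      thus ?thesis by blast
    next
      case False
      thus ?thesis using m by blast
    qed
  qed auto
  then obtain lam where lam: "lam \<in> D" "\<And>x. x \<in> D \<Longrightarrow> dominated lam x \<Longrightarrow> x = lam" by blast
  have dc: "down_closed N (D - {lam})"
    unfolding down_closed_def
  proof (intro conjI ballI subsetI)
    fix x mu assume x: "x \<in> D - {lam}" and mu: "mu \<in> below x"
    have "mu \<in> D" using Suc.prems x mu unfolding down_closed_def by blast
    moreover have "mu \<noteq> lam" using lam(2)[of x] x mu by auto
    ultimately show "mu \<in> D - {lam}" by simp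
  qed (use Suc.prems in \<open>auto simp: down_closed_def\<close>)
  have "card (D - {lam}) = c" using lam(1) fin Suc.hyps(2) by simp
  hence P: "P (D - {lam})" using Suc.hyps(1)[of "D - {lam}"] dc by simp
  have "below lam \<subseteq> D" using Suc.prems lam(1) unfolding down_closed_def by blast
  hence "strictly_below lam \<subseteq> D - {lam}" by blast
  moreover have "lam \<in> partitions_of N" using Suc.prems lam(1) unfolding down_closed_def by blast
  ultimately have "P (insert lam (D - {lam}))" by (intro step[OF dc] P) auto
  thus ?case using lam(1) by (simp add: insert_absorb)
qed

lemma down_closed_strictly_below:
  assumes "lam \<in> partitions_of N"
  shows "down_closed N (strictly_below lam)"
  unfolding down_closed_def
proof (intro conjI ballI subsetI)
  fix x mu assume x: "x \<in> strictly_below lam" and mu: "mu \<in> below x"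
  have "dominated mu lam" using x mu dominated_trans by blast
  moreover have "mu \<noteq> lam" using x mu assms dominated_antisym[of x lam] by auto
  ultimately show "mu \<in> strictly_below lam" using mu by simp
qed (use assms in \<open>auto simp: dominated_def\<close>)

lemma down_closed_all: "down_closed N (partitions_of N)"
  by (auto simp: down_closed_def dominated_def)

definition jack_triangular :: "nat list \<Rightarrow> cpoly \<Rightarrow> bool" where
  "jack_triangular lam P \<longleftrightarrow> in_span (sum_list lam) (below lam) P \<and> mcoeff lam P = 1"

text \<open>Subtracting \<open>mcoeff lam f\<close> times \<open>J lam\<close> clears the
  coefficient at a maximal \<open>lam\<close> and changes the others only below it.\<close>

lemma triangular_expansion:
  assumes tri: "\<And>lam. lam \<in> partitions_of N \<Longrightarrow> jack_triangular lam (J lam)"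
    and D: "down_closed N D" and f: "in_span N D f"
  shows "\<exists>c. f = (\<Sum>mu\<in>D. cconst (c mu) * J mu)"
  using D f
proof (induction D arbitrary: f rule: down_closed_induct)
  case empty
  thus ?case using in_span_empty by auto
next
  case (insert D lam)
  note J = tri[OF insert(2), unfolded jack_triangular_def]
  have N: "sum_list lam = N" using insert(2) by simp
  have finD: "finite D" using insert(1) finite_subset[OF _ finite_partitions] unfolding down_closed_def by auto
  define f1 where "f1 = f - cconst (mcoeff lam f) * J lam"
  have "in_span N D f1"
    unfolding in_span_def
  proof (intro conjI ballI impI)
    show "homog_symfun N f1"
      using insert(6) J N unfolding f1_def in_span_def by (intro homog_diff homog_scale) auto
    fix mu assume mu: "mu \<in> partitions_of N" "mcoeff mu f1 \<noteq> 0"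
    have "mu \<noteq> lam" using mu(2) J by (auto simp: f1_def mcoeff_diff mcoeff_scale)
    moreover have "mcoeff mu f \<noteq> 0 \<or> mcoeff mu (J lam) \<noteq> 0"
      using mu(2) by (auto simp: f1_def mcoeff_diff mcoeff_scale)
    hence "mu \<in> insert lam D \<or> mu \<in> below lam" using insert(6) J N mu(1) unfolding in_span_def by blast
    ultimately show "mu \<in> D" using insert(4) by blast
  qed
  from insert(5)[OF this] obtain c where c: "f1 = (\<Sum>mu\<in>D. cconst (c mu) * J mu)" by blast
  define c' where "c' = c(lam := mcoeff lam f)"
  have "(\<Sum>mu\<in>D. cconst (c' mu) * J mu) = f1" unfolding c
    by (rule sum.cong) (use insert(3) in \<open>auto simp: c'_def\<close>)
  hence "(\<Sum>mu\<in>insert lam D. cconst (c' mu) * J mu) = f"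
    using finD insert(3) by (simp add: c'_def f1_def)
  thus ?case by metis
qed

text \<open>Parameters for which the Hamiltonian has pairwise distinct eigenvalues in degree N;
  \<open>jack_operator_exists\<close> provides them.\<close>

locale jack_operator =
  fixes \<alpha> t :: real and N K :: nat
  assumes alpha_pos: "\<alpha> > 0"
    and inj_eigenvalue: "inj_on (ham_eigenvalue \<alpha> N K t) (partitions_of N)"
begin

abbreviation H :: "cpoly \<Rightarrow> cpoly" where
  "H \<equiv> hamiltonian (of_real \<alpha>) N K (of_real t)"

abbreviation ev :: "nat list \<Rightarrow> complex" where
  "ev lam \<equiv> of_real (ham_eigenvalue \<alpha> N K t lam)"

lemma ev_eq_iff: "lam \<in> partitions_of N \<Longrightarrow> mu \<in> partitions_of N \<Longrightarrow> ev lam = ev mu \<longleftrightarrow> lam = mu"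
  using inj_eigenvalue by (auto simp: inj_on_def)

lemma H_triangular:
  assumes "lam \<in> partitions_of N" "in_span N (below lam) f"
  shows "in_span N (below lam) (H f)" "mcoeff lam (H f) = ev lam * mcoeff lam f"
proof -
  have h: "homog_symfun N f" using assms(2) by (simp add: in_span_def)
  have db: "dom_bounded N (part_sums lam) (sf_eval N f)" using in_span_below_iff[OF assms(1) h] assms(2) by simp
  show "in_span N (below lam) (H f)"
    using in_span_below_iff[OF assms(1) homog_hamiltonian[OF h]] dom_bounded_hamiltonian[OF h db] by simp
  obtain a where a: "keys a \<subseteq> {..<N}" "exps_partition N a = lam" by (rule partition_representative[OF assms(1)])
  have N: "sum_list lam = N" using assms(1) by simp
  have "lookup (sf_eval N (H f)) a = ev lam * mcoeff lam f"
    by (rule lookup_hamiltonian_leading[OF h db _ a N]) (rule lookup_sf_eval_mcoeff[OF _ _ N])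
  thus "mcoeff lam (H f) = ev lam * mcoeff lam f" using lookup_sf_eval_mcoeff[OF a N, of "H f"] by simp
qed

lemma in_span_msym_lift: "lam \<in> partitions_of N \<Longrightarrow> in_span N (below lam) (msym_lift lam)"
  using msym_lift_spec(1) mcoeff_msym_lift[of _ N lam] dominated_refl
  by (auto simp: in_span_def)

text \<open>On the span of \<open>D\<close> the operator H - e is triangular with nonzero diagonal
  entries \<open>ev lam - e\<close>, so back substitution from a maximal element solves the
  equation.\<close>

lemma H_minus_surjective:
  assumes "down_closed N D" "in_span N D f" "\<And>lam. lam \<in> D \<Longrightarrow> ev lam \<noteq> e"
  shows "\<exists>h. in_span N D h \<and> H h - cconst e * h = f"
  using assms
proof (induction D arbitrary: f rule: down_closed_induct)
  case empty
  hence "f = 0" by (intro in_span_empty)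
  thus ?case using empty by (intro exI[of _ 0]) (simp add: clin_0[OF clin_hamiltonian])
next
  case (insert D lam)
  let ?M = "msym_lift lam"
  define c where "c = mcoeff lam f / (ev lam - e)"
  have ne: "ev lam - e \<noteq> 0" using insert(7)[of lam] by simp
  note M = in_span_msym_lift[OF insert(2)]
  note HM = H_triangular[OF insert(2) M]
  have mM: "mcoeff lam ?M = 1" using mcoeff_msym_lift[OF insert(2,2)] by simp
  have bl: "below lam \<subseteq> insert lam D" using insert(4) by blast
  define f1 where "f1 = f - cconst c * (H ?M - cconst e * ?M)"
  have s: "in_span N (insert lam D) f1"
    unfolding f1_def by (intro in_span_diff in_span_scale insert(6) in_span_mono[OF _ bl] HM(1) M)
  have "mcoeff lam f1 = 0"
    using ne by (simp add: f1_def mcoeff_diff mcoeff_scale HM(2) mM c_def)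
  hence "in_span N D f1" using s unfolding in_span_def by auto
  from insert(5)[OF this insert(7)] obtain h where h: "in_span N D h" "H h - cconst e * h = f1" by auto
  have "in_span N (insert lam D) (h + cconst c * ?M)"
    by (intro in_span_add in_span_scale in_span_mono[OF h(1)] in_span_mono[OF M bl]) auto
  moreover have "H (h + cconst c * ?M) - cconst e * (h + cconst c * ?M) = f"
  proof -
    have "H (h + cconst c * ?M) - cconst e * (h + cconst c * ?M) = (H h - cconst e * h) + cconst c * (H ?M - cconst e * ?M)"
      by (simp add: clin_add[OF clin_hamiltonian] clin_scale[OF clin_hamiltonian] algebra_simps)
    thus ?thesis by (simp add: h(2) f1_def)
  qed
  ultimately show ?case by blast
qed

text \<open>H - ev lam sends the monomial function of \<open>lam\<close> strictly below
  \<open>lam\<close>, where all eigenvalues differ from \<open>ev lam\<close> and the operator is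
  onto. A correction h from there with the same image is subtracted, which does not touch the
  leading coefficient.\<close>

lemma eigenvector_exists:
  assumes lam: "lam \<in> partitions_of N"
  shows "\<exists>P. jack_triangular lam P \<and> H P = cconst (ev lam) * P"
proof -
  let ?M = "msym_lift lam"
  note M = in_span_msym_lift[OF lam]
  note HM = H_triangular[OF lam M]
  have mM: "mcoeff lam ?M = 1" using mcoeff_msym_lift[OF lam lam] by simp
  define f where "f = H ?M - cconst (ev lam) * ?M"
  have s: "in_span N (below lam) f" unfolding f_def by (intro in_span_diff in_span_scale HM(1) M)
  have "mcoeff lam f = 0" by (simp add: f_def mcoeff_diff mcoeff_scale HM(2) mM)
  with s have sb: "in_span N (strictly_below lam) f" unfolding in_span_def by auto
  have "ev mu \<noteq> ev lam" if "mu \<in> strictly_below lam" for mu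
  proof -
    have "mu \<in> partitions_of N" using that lam by (auto simp: dominated_def)
    thus ?thesis using ev_eq_iff[OF _ lam] that by blast
  qed
  from H_minus_surjective[OF down_closed_strictly_below[OF lam] sb this]
  obtain h where h: "in_span N (strictly_below lam) h" "H h - cconst (ev lam) * h = f" by blast
  have "in_span N (below lam) (?M - h)"
    by (intro in_span_diff M in_span_mono[OF h(1)]) auto
  moreover have "mcoeff lam h = 0" using h(1) lam unfolding in_span_def by blast
  hence "mcoeff lam (?M - h) = 1" by (simp add: mcoeff_diff mM)
  moreover have "H (?M - h) = cconst (ev lam) * (?M - h)"
  proof -
    have "H (?M - h) - cconst (ev lam) * (?M - h) = f - (H h - cconst (ev lam) * h)"
      by (simp add: clin_diff[OF clin_hamiltonian] f_def algebra_simps)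
    thus ?thesis by (simp add: h(2))
  qed
  ultimately show ?thesis using lam by (auto simp: jack_triangular_def)
qed

lemma eigenvectors_orthogonal:
  assumes "lam \<in> partitions_of N" "mu \<in> partitions_of N" "lam \<noteq> mu"
    "H P = cconst (ev lam) * P" "H Q = cconst (ev mu) * Q"
  shows "jack_scal (of_real \<alpha>) P Q = 0"
proof -
  have "ev lam * jack_scal (of_real \<alpha>) P Q = ev mu * jack_scal (of_real \<alpha>) P Q"
    using hamiltonian_adjoint[of "of_real \<alpha>" N K "of_real t" P Q] assms(4,5)
    by (simp add: jack_scal_scale_left jack_scal_scale_right)
  thus ?thesis using ev_eq_iff[OF assms(1,2)] assms(3) by simp
qed

end

section \<open>Existence and uniqueness of the Jack family\<close>

lemma part_le_sum_list: "part lam i \<le> sum_list lam"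
  by (auto simp: part_def intro: member_le_sum_list)

lemma sum_mults:
  assumes "sum_list lam = N"
  shows "(\<Sum>u\<le>N. mults N lam u) = N"
proof -
  have "{i\<in>{..<N}. part lam (Suc i) < Suc N} = {..<N}"
    using part_le_sum_list[of lam] assms by (auto simp: less_Suc_eq_le)
  thus ?thesis
    using sum_by_value[where a = "\<lambda>i. part lam (Suc i)" and s = "Suc N" and h = "\<lambda>_. 1 :: nat" and N = N]
    by (simp add: mults_def lessThan_Suc_atMost)
qed

lemma count_mset_mults:
  assumes "lam \<in> partitions_of N" "u > 0"
  shows "count (mset lam) u = mults N lam u"
proof -
  obtain a where "keys a \<subseteq> {..<N}" "exps_partition N a = lam" by (rule partition_representative[OF assms(1)])
  thus ?thesis using count_exps_partition[OF assms(2), of N a] mults_exps_partition[of N a u] by simp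
qed

lemma eps_partition_separates:
  assumes "\<alpha> > 0" "lam \<in> partitions_of N" "mu \<in> partitions_of N" "lam \<noteq> mu"
  shows "\<exists>l. eps \<alpha> (mults N lam) N l \<noteq> eps \<alpha> (mults N mu) N l"
proof (rule ccontr)
  assume "\<nexists>l. eps \<alpha> (mults N lam) N l \<noteq> eps \<alpha> (mults N mu) N l"
  hence eq: "eps \<alpha> (mults N lam) N l = eps \<alpha> (mults N mu) N l" for l by blast
  have sums: "(\<Sum>u\<le>N. mults N lam u) = N" "(\<Sum>u\<le>N. mults N mu u) = N"
    by (rule sum_mults, use assms(2,3) in simp)+
  have "lam = mu"
  proof (rule partition_eqI_count)
    fix u :: nat assume u: "u > 0"
    show "count (mset lam) u = count (mset mu) u"
    proof (cases "u \<le> N")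
      case True
      thus ?thesis using eps_separates[OF assms(1) sums eq True] count_mset_mults[OF assms(2) u] count_mset_mults[OF assms(3) u] by simp
    next
      case False
      hence "u \<notin> set lam" "u \<notin> set mu" using assms(2,3) member_le_sum_list[of u lam] member_le_sum_list[of u mu] by auto
      thus ?thesis by (simp add: count_mset count_list_0_iff)
    qed
  qed (use assms in auto)
  thus False using assms(4) by simp
qed

text \<open>Any two distinct partitions of N are told apart by some coefficient \<open>eps\<close>,
  and \<open>K\<close> is taken beyond one such coefficient for every pair. The eigenvalues are then
  distinct polynomials in \<open>t\<close>, and \<open>t\<close> avoids the finitely many roots of
  their differences.\<close>

lemma jack_operator_exists:
  assumes "\<alpha> > 0"
  shows "\<exists>t K. jack_operator \<alpha> t N K"
proof -
  define Q where "Q = {(lam, mu). lam \<in> partitions_of N \<and> mu \<in> partitions_of N \<and> lam \<noteq> mu}"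
  have finQ: "finite Q" unfolding Q_def
    by (rule finite_subset[of _ "partitions_of N \<times> partitions_of N"]) (auto intro: finite_cartesian_product finite_partitions)
  have "\<forall>q\<in>Q. \<exists>l. eps \<alpha> (mults N (fst q)) N l \<noteq> eps \<alpha> (mults N (snd q)) N l"
    using eps_partition_separates[OF assms] by (auto simp: Q_def)
  then obtain l where l: "\<And>q. q \<in> Q \<Longrightarrow> eps \<alpha> (mults N (fst q)) N (l q) \<noteq> eps \<alpha> (mults N (snd q)) N (l q)"
    by metis
  define K where "K = Suc (Max (insert 0 (l ` Q)))"
  have lK: "l q < K" if "q \<in> Q" for q
    unfolding K_def less_Suc_eq_le by (rule Max_ge) (use finQ that in auto)
  define p where "p lam = (\<Sum>l<K. monom (eps \<alpha> (mults N lam) N l) l)" for lam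
  have coeff: "coeff (p lam) l = eps \<alpha> (mults N lam) N l" if "l < K" for lam l
    using that by (simp add: p_def coeff_sum)
  have poly: "poly (p lam) t = ham_eigenvalue \<alpha> N K t lam" for lam t
    by (simp add: p_def poly_sum poly_monom ham_eigenvalue_def mult.commute)
  have "finite (\<Union>q\<in>Q. {t. poly (p (fst q) - p (snd q)) t = 0})"
  proof (intro finite_UN_I finQ poly_roots_finite)
    fix q assume q: "q \<in> Q"
    show "p (fst q) - p (snd q) \<noteq> 0"
    proof
      assume "p (fst q) - p (snd q) = 0"
      hence "coeff (p (fst q)) (l q) = coeff (p (snd q)) (l q)" by simp
      thus False using l[OF q] coeff[OF lK[OF q]] by simp
    qed
  qed
  then obtain t where t: "t \<notin> (\<Union>q\<in>Q. {t. poly (p (fst q) - p (snd q)) t = 0})"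
    using ex_new_if_finite[OF infinite_UNIV_char_0] by blast
  have "inj_on (ham_eigenvalue \<alpha> N K t) (partitions_of N)"
  proof (rule inj_onI, rule ccontr)
    fix lam mu assume *: "lam \<in> partitions_of N" "mu \<in> partitions_of N" "ham_eigenvalue \<alpha> N K t lam = ham_eigenvalue \<alpha> N K t mu" "lam \<noteq> mu"
    hence "(lam, mu) \<in> Q" by (auto simp: Q_def)
    thus False using t *(3) by (force simp: poly)
  qed
  thus ?thesis using assms by (auto simp: jack_operator_def)
qed

section \<open>Nondegeneracy and uniqueness\<close>

lemma jack_scal_different_degree:
  assumes "homog_symfun M f" "homog_symfun N g" "M \<noteq> N"
  shows "jack_scal \<alpha> f g = 0"
proof -
  have "keys f \<inter> keys g = {}" using assms by (auto simp: homog_symfun_def)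
  thus ?thesis by (simp add: jack_scal_def)
qed

lemma jweight_nonzero: "0 \<notin> keys v \<Longrightarrow> \<alpha> \<noteq> 0 \<Longrightarrow> jweight \<alpha> v \<noteq> 0"
  unfolding zee_def by (auto simp: prod_zero_iff)

lemma jack_triangular_nonzero: "jack_triangular lam P \<Longrightarrow> P \<noteq> 0"
  by (auto simp: jack_triangular_def mcoeff_def clin_0[OF clin_sf_eval])

lemma jack_norm_nonzero:
  assumes \<alpha>: "\<alpha> \<noteq> 0" and tri: "\<And>lam. lam \<in> partitions_of N \<Longrightarrow> jack_triangular lam (J lam)"
    and orth: "\<And>lam mu. lam \<in> partitions_of N \<Longrightarrow> mu \<in> partitions_of N \<Longrightarrow> lam \<noteq> mu \<Longrightarrow> jack_scal \<alpha> (J lam) (J mu) = 0"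
    and lam: "lam \<in> partitions_of N"
  shows "jack_scal \<alpha> (J lam) (J lam) \<noteq> 0"
proof
  assume z: "jack_scal \<alpha> (J lam) (J lam) = 0"
  have J: "homog_symfun N (J lam)" using tri[OF lam] lam by (simp add: jack_triangular_def in_span_def)
  have all: "jack_scal \<alpha> (J lam) g = 0" if g: "homog_symfun N g" for g
  proof -
    obtain c where c: "g = (\<Sum>mu\<in>partitions_of N. cconst (c mu) * J mu)"
      using triangular_expansion[OF tri down_closed_all in_span_all[OF g]] by blast
    have "jack_scal \<alpha> (J lam) (J mu) = 0" if "mu \<in> partitions_of N" for mu
      using orth[OF lam that] z by (cases "mu = lam") auto
    thus ?thesis unfolding c by (simp add: jack_scal_sum_right jack_scal_scale_right)
  qed
  have "keys (J lam) \<noteq> {}" using jack_triangular_nonzero[OF tri[OF lam]] by simp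
  then obtain v where v: "v \<in> keys (J lam)" by blast
  hence hv: "0 \<notin> keys v" "wdeg v = N" using J by (auto simp: homog_symfun_def)
  have "jack_scal \<alpha> (J lam) (mon v) = lookup (J lam) v * jweight \<alpha> v"
    using jack_scal_superset[of "{v}" "J lam" "mon v" \<alpha>] by simp
  moreover have "homog_symfun N (mon v)" using hv by (simp add: homog_symfun_def)
  ultimately show False using all[of "mon v"] v jweight_nonzero[OF hv(1) \<alpha>] by (simp add: in_keys_iff)
qed

text \<open>In as many variables as the degree, every partition of it has a representative monomial,
  so the expansion demanded in \<open>jackP\<close> can be compared coefficient by
  coefficient.\<close>

lemma jack_triangular_iff:
  assumes lam: "is_partition lam"
  shows "homog_symfun (sum_list lam) P \<and>
        (\<exists>u. sf_eval (sum_list lam) P =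
               msym (sum_list lam) lam +
               (\<Sum>mu \<in> strictly_below lam. cconst (u mu) * msym (sum_list lam) mu))
     \<longleftrightarrow> jack_triangular lam P"
proof -
  define N where "N = sum_list lam"
  have lamN: "lam \<in> partitions_of N" using lam by (simp add: N_def)
  have sub: "strictly_below lam \<subseteq> partitions_of N" by (auto simp: dominated_def N_def)
  hence fin: "finite (strictly_below lam)" by (rule finite_subset[OF _ finite_partitions])
  have look: "lookup (msym N lam + (\<Sum>mu \<in> strictly_below lam. cconst (u mu) * msym N mu)) a =
      (if exps_partition N a = lam then 1 else if exps_partition N a \<in> strictly_below lam then u (exps_partition N a) else 0)"
    if "keys a \<subseteq> {..<N}" for u a
  proof -
    have "lookup (\<Sum>mu \<in> strictly_below lam. cconst (u mu) * msym N mu) a =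
        (\<Sum>mu \<in> strictly_below lam. if mu = exps_partition N a then u (exps_partition N a) else 0)"
      unfolding lookup_sum lookup_cconst_mult by (rule sum.cong) (auto simp: lookup_msym that)
    also have "\<dots> = (if exps_partition N a \<in> strictly_below lam then u (exps_partition N a) else 0)"
      using fin by (simp only: sum.delta)
    finally show ?thesis by (auto simp: lookup_add lookup_msym that)
  qed
  show ?thesis
    unfolding N_def[symmetric]
  proof
    assume *: "homog_symfun N P \<and> (\<exists>u. sf_eval N P = msym N lam + (\<Sum>mu \<in> strictly_below lam. cconst (u mu) * msym N mu))"
    then obtain u where u: "sf_eval N P = msym N lam + (\<Sum>mu \<in> strictly_below lam. cconst (u mu) * msym N mu)" by blast
    have mc: "mcoeff mu P = (if mu = lam then 1 else if mu \<in> strictly_below lam then u mu else 0)" if mu: "mu \<in> partitions_of N" for mu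
    proof -
      obtain a where a: "keys a \<subseteq> {..<N}" "exps_partition N a = mu" by (rule partition_representative[OF mu])
      have "mcoeff mu P = lookup (sf_eval N P) a" using lookup_sf_eval_mcoeff[OF a, of P] mu by simp
      thus ?thesis unfolding u look[OF a(1)] a(2) .
    qed
    have "in_span N (below lam) P"
      unfolding in_span_def using * mc lam dominated_refl by (auto split: if_splits)
    thus "jack_triangular lam P" using mc[OF lamN] by (simp add: jack_triangular_def N_def)
  next
    assume "jack_triangular lam P"
    hence s: "homog_symfun N P" "\<And>mu. mu \<in> partitions_of N \<Longrightarrow> mcoeff mu P \<noteq> 0 \<Longrightarrow> mu \<in> below lam" and one: "mcoeff lam P = 1"
      unfolding jack_triangular_def in_span_def N_def by blast+
    have "sf_eval N P = msym N lam + (\<Sum>mu \<in> strictly_below lam. cconst (mcoeff mu P) * msym N mu)"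
    proof (rule poly_mapping_eqI)
      fix a
      show "lookup (sf_eval N P) a = lookup (msym N lam + (\<Sum>mu \<in> strictly_below lam. cconst (mcoeff mu P) * msym N mu)) a"
      proof (cases "keys a \<subseteq> {..<N}")
        case True
        show ?thesis
        proof (cases "sum_list (exps_partition N a) = N")
          case sumN: True
          have mu: "exps_partition N a \<in> partitions_of N" using sumN by (simp add: is_partition_exps)
          have "lookup (sf_eval N P) a = mcoeff (exps_partition N a) P"
            by (rule lookup_sf_eval_mcoeff[OF True refl sumN])
          thus ?thesis unfolding look[OF True] using one s(2)[OF mu] by auto
        next
          case False
          hence "a \<notin> keys (sf_eval N P)" using sf_eval_degree(2)[OF s(1), of a N] by (auto simp: sum_list_exps_partition)
          moreover have "exps_partition N a \<noteq> lam" "exps_partition N a \<notin> strictly_below lam" using False sub N_def by auto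
          ultimately show ?thesis unfolding look[OF True] by (simp only: in_keys_iff if_False not_not)
        qed
      next
        case False
        hence "a \<notin> keys (sf_eval N P)" using sf_eval_degree(1)[OF s(1), of a N] by auto
        thus ?thesis using False by (simp add: lookup_add lookup_sum lookup_msym in_keys_iff)
      qed
    qed
    thus "homog_symfun N P \<and> (\<exists>u. sf_eval N P = msym N lam + (\<Sum>mu \<in> strictly_below lam. cconst (u mu) * msym N mu))"
      using s(1) by (intro conjI exI[of _ "\<lambda>mu. mcoeff mu P"])
  qed
qed

definition jack_family :: "complex \<Rightarrow> (nat list \<Rightarrow> cpoly) \<Rightarrow> bool" where
  "jack_family \<alpha> P \<longleftrightarrow> (\<forall>lam. \<not> is_partition lam \<longrightarrow> P lam = 0) \<and>
     (\<forall>lam. is_partition lam \<longrightarrow> jack_triangular lam (P lam)) \<and>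
     (\<forall>lam mu. is_partition lam \<longrightarrow> is_partition mu \<longrightarrow> lam \<noteq> mu \<longrightarrow> jack_scal \<alpha> (P lam) (P mu) = 0)"

lemma jackP_eq_The: "jackP \<alpha> = (THE P. jack_family \<alpha> P)"
proof -
  have "(\<lambda>P. (\<forall>lam. \<not> is_partition lam \<longrightarrow> P lam = 0) \<and>
     (\<forall>lam. is_partition lam \<longrightarrow>
        homog_symfun (sum_list lam) (P lam) \<and>
        (\<exists>u. sf_eval (sum_list lam) (P lam) =
               msym (sum_list lam) lam +
               (\<Sum>mu \<in> strictly_below lam. cconst (u mu) * msym (sum_list lam) mu))) \<and>
     (\<forall>lam mu. is_partition lam \<longrightarrow> is_partition mu \<longrightarrow> lam \<noteq> mu \<longrightarrow>
        jack_scal \<alpha> (P lam) (P mu) = 0)) = jack_family \<alpha>"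
    unfolding jack_family_def by (intro ext) (simp only: jack_triangular_iff cong: imp_cong)
  thus ?thesis unfolding jackP_def by simp
qed

text \<open>Gram-Schmidt: the difference of the two members at \<open>lam\<close> expands in the
  \<open>J nu\<close> strictly below \<open>lam\<close>. There P nu = J nu by induction, so both
  members are orthogonal to \<open>J nu\<close>; as the norms are nonzero, every coefficient
  vanishes.\<close>

lemma jack_family_unique:
  assumes \<alpha>: "\<alpha> \<noteq> 0" and P: "jack_family \<alpha> P" and J: "jack_family \<alpha> J"
  shows "P = J"
proof (rule ext)
  fix lam
  show "P lam = J lam"
  proof (induction "card (below lam)" arbitrary: lam rule: less_induct)
    case less
    show ?case
    proof (cases "is_partition lam")
      case False thus ?thesis using P J by (simp add: jack_family_def)
    next
      case lam: True
      define N where "N = sum_list lam"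
      have lamN: "lam \<in> partitions_of N" using lam by (simp add: N_def)
      have tri: "jack_triangular mu (P mu)" "jack_triangular mu (J mu)" if "mu \<in> partitions_of N" for mu
        using P J that by (auto simp: jack_family_def)
      have orth: "jack_scal \<alpha> (J mu) (J nu) = 0" if "mu \<in> partitions_of N" "nu \<in> partitions_of N" "mu \<noteq> nu" for mu nu
        using J that by (auto simp: jack_family_def)
      have IH: "P mu = J mu" if mu: "mu \<in> strictly_below lam" for mu
      proof (rule less)
        have "below mu \<subseteq> below lam" using mu dominated_trans by blast
        moreover have "lam \<in> below lam" using lam dominated_refl by simp
        moreover have "lam \<notin> below mu" using mu lam dominated_antisym by blast
        ultimately have "below mu \<subset> below lam" by blast
        thus "card (below mu) < card (below lam)"
          by (intro psubset_card_mono finite_subset[OF below_subset[OF lamN] finite_partitions])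
      qed
      define f where "f = P lam - J lam"
      have s: "in_span N (below lam) f"
        using tri[OF lamN] unfolding f_def jack_triangular_def N_def by (intro in_span_diff) auto
      have "mcoeff lam f = 0" using tri[OF lamN] by (simp add: f_def mcoeff_diff jack_triangular_def)
      with s have sb: "in_span N (strictly_below lam) f" unfolding in_span_def by auto
      obtain c where c: "f = (\<Sum>mu\<in>strictly_below lam. cconst (c mu) * J mu)"
        using triangular_expansion[OF tri(2) down_closed_strictly_below[OF lamN] sb] by blast
      have sub: "strictly_below lam \<subseteq> partitions_of N" using below_subset[OF lamN] by blast
      have fin: "finite (strictly_below lam)" by (rule finite_subset[OF sub finite_partitions])
      have "c nu = 0" if nu: "nu \<in> strictly_below lam" for nu
      proof -
        have nuN: "nu \<in> partitions_of N" using nu sub by blast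
        have "jack_scal \<alpha> (J nu) f = (\<Sum>mu\<in>strictly_below lam. c mu * jack_scal \<alpha> (J nu) (J mu))"
          unfolding c by (simp add: jack_scal_sum_right jack_scal_scale_right)
        also have "\<dots> = (\<Sum>mu\<in>strictly_below lam. if mu = nu then c nu * jack_scal \<alpha> (J nu) (J nu) else 0)"
          by (rule sum.cong) (use orth nuN sub in auto)
        also have "\<dots> = c nu * jack_scal \<alpha> (J nu) (J nu)" using fin nu by (simp only: sum.delta if_True)
        finally have "c nu * jack_scal \<alpha> (J nu) (J nu) = jack_scal \<alpha> (J nu) f" by simp
        also have "\<dots> = jack_scal \<alpha> (P nu) (P lam) - jack_scal \<alpha> (J nu) (J lam)"
          using IH[OF nu] by (simp add: f_def jack_scal_diff_right)
        also have "\<dots> = 0" using P J nu lam by (auto simp: jack_family_def)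
        finally show ?thesis using jack_norm_nonzero[OF \<alpha> tri(2) orth nuN] by simp
      qed
      hence "f = 0" unfolding c by (intro sum.neutral) auto
      thus ?thesis by (simp add: f_def)
    qed
  qed
qed

text \<open>The family is assembled degree by degree, with \<open>t\<close> and \<open>K\<close>
  depending on the degree; members of different degrees are orthogonal because they share no
  monomial. Uniqueness then identifies it with \<open>jackP\<close>.\<close>

theorem jackP_eigenvectors:
  fixes \<alpha> :: real
  assumes \<alpha>: "\<alpha> > 0"
  shows "\<exists>t K. (\<forall>N. jack_operator \<alpha> (t N) N (K N)) \<and>
    (\<forall>N. \<forall>lam\<in>partitions_of N. jack_triangular lam (jackP (of_real \<alpha>) lam) \<and>
      hamiltonian (of_real \<alpha>) N (K N) (of_real (t N)) (jackP (of_real \<alpha>) lam) =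
        cconst (of_real (ham_eigenvalue \<alpha> N (K N) (t N) lam)) * jackP (of_real \<alpha>) lam)"
proof -
  have "\<forall>N. \<exists>tk. jack_operator \<alpha> (fst tk) N (snd tk)" using jack_operator_exists[OF \<alpha>] by simp
  then obtain tk where tk: "\<And>N. jack_operator \<alpha> (fst (tk N)) N (snd (tk N))" by metis
  define t where "t N = fst (tk N)" for N
  define K where "K N = snd (tk N)" for N
  have op: "jack_operator \<alpha> (t N) N (K N)" for N using tk by (simp add: t_def K_def)
  define good where "good lam P \<longleftrightarrow> jack_triangular lam P \<and>
     hamiltonian (of_real \<alpha>) (sum_list lam) (K (sum_list lam)) (of_real (t (sum_list lam))) P =
        cconst (of_real (ham_eigenvalue \<alpha> (sum_list lam) (K (sum_list lam)) (t (sum_list lam)) lam)) * P" for lam P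
  have "\<exists>P. good lam P" if "is_partition lam" for lam
    using jack_operator.eigenvector_exists[OF op[of "sum_list lam"], of lam] that by (simp add: good_def)
  then obtain J0 where J0: "\<And>lam. is_partition lam \<Longrightarrow> good lam (J0 lam)" by metis
  define J where "J lam = (if is_partition lam then J0 lam else 0)" for lam
  have J: "good lam (J lam)" if "is_partition lam" for lam using J0[OF that] that by (simp add: J_def)
  have "jack_scal (of_real \<alpha>) (J lam) (J mu) = 0" if "is_partition lam" "is_partition mu" "lam \<noteq> mu" for lam mu
  proof (cases "sum_list lam = sum_list mu")
    case True
    show ?thesis
      by (rule jack_operator.eigenvectors_orthogonal[OF op[of "sum_list lam"], of lam mu])
        (use that J[OF that(1)] J[OF that(2)] True in \<open>auto simp: good_def\<close>)
  next
    case False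
    thus ?thesis using J[OF that(1)] J[OF that(2)]
      by (intro jack_scal_different_degree) (auto simp: good_def jack_triangular_def in_span_def)
  qed
  moreover have "J lam = 0" if "\<not> is_partition lam" for lam using that by (simp add: J_def)
  ultimately have fam: "jack_family (of_real \<alpha>) J" using J by (auto simp: jack_family_def good_def)
  have "jackP (of_real \<alpha>) = J"
    unfolding jackP_eq_The
  proof (rule the_equality)
    show "P = J" if "jack_family (of_real \<alpha>) P" for P
      using jack_family_unique[OF _ that fam] \<alpha> by simp
  qed (rule fam)
  thus ?thesis using op J unfolding good_def by (intro exI[of _ t] exI[of _ K]) auto
qed

section \<open>The Vandermonde determinant\<close>

abbreviation perms :: "nat \<Rightarrow> (nat \<Rightarrow> nat) set" where
  "perms n \<equiv> {p. p permutes {1..n}}"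

definition cvec :: "nat \<Rightarrow> nat \<Rightarrow> (nat \<Rightarrow>\<^sub>0 nat)" where
  "cvec n c = (\<Sum>i<n. single i c)"

text \<open>Variables are numbered from 0 while permutations act on 1..n, hence
  \<open>Suc i\<close>; the exponents run through 0, ..., n - 1. \<open>rexp\<close> is
  complementary: together they give every variable the exponent n - 1.\<close>

definition vexp :: "nat \<Rightarrow> (nat \<Rightarrow> nat) \<Rightarrow> (nat \<Rightarrow>\<^sub>0 nat)" where
  "vexp n p = (\<Sum>i<n. single i (p (Suc i) - 1))"

definition rexp :: "nat \<Rightarrow> (nat \<Rightarrow> nat) \<Rightarrow> (nat \<Rightarrow>\<^sub>0 nat)" where
  "rexp n p = (\<Sum>i<n. single i (n - p (Suc i)))"

text \<open>\<open>vandermonde_rev\<close> is the image of \<open>vandermonde\<close> under \<open>x\<^sub>i \<mapsto> 1 / x\<^sub>i\<close>, made polynomial by a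
  power of \<open>x\<^sub>1 \<cdots> x\<^sub>n\<close>.\<close>
definition vandermonde :: "nat \<Rightarrow> cpoly" where
  "vandermonde n = (\<Sum>p\<in>perms n. cconst (of_int (sign p)) * mon (vexp n p))"

definition vandermonde_rev :: "nat \<Rightarrow> cpoly" where
  "vandermonde_rev n = (\<Sum>p\<in>perms n. cconst (of_int (sign p)) * mon (rexp n p))"

lemma lookup_sum_single:
  "lookup (\<Sum>i<n. single i (f i)) l = (if l < n then f l else (0::nat))" for n :: nat
proof -
  have "lookup (\<Sum>i<n. single i (f i)) l = (\<Sum>i<n. if i = l then f l else 0)"
    unfolding lookup_sum by (rule sum.cong) (auto simp: lookup_single when_def)
  thus ?thesis by simp
qed

lemma lookup_cvec: "lookup (cvec n c) l = (if l < n then c else 0)"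
  by (simp add: cvec_def lookup_sum_single)

lemma lookup_vexp: "lookup (vexp n p) l = (if l < n then p (Suc l) - 1 else 0)"
  by (simp add: vexp_def lookup_sum_single)

lemma lookup_rexp: "lookup (rexp n p) l = (if l < n then n - p (Suc l) else 0)"
  by (simp add: rexp_def lookup_sum_single)

lemma keys_vexp: "keys (vexp n p) \<subseteq> {..<n}"
  by (auto simp: in_keys_iff lookup_vexp split: if_splits)

lemma finite_perms: "finite (perms n)"
  by (simp add: finite_permutations)

lemma perms_range: "p \<in> perms n \<Longrightarrow> k < n \<Longrightarrow> 1 \<le> p (Suc k) \<and> p (Suc k) \<le> n"
  using permutes_in_image[of p "{1..n}" "Suc k"] by auto

lemma sw_vandermonde:
  assumes "i < n" "j < n" "i \<noteq> j"
  shows "sw i j (vandermonde n) = - vandermonde n"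
proof -
  let ?\<tau> = "transpose (Suc i) (Suc j)"
  have \<tau>: "?\<tau> permutes {1..n}" by (rule permutes_swap_id) (use assms in auto)
  have bij: "bij_betw (\<lambda>p. p \<circ> ?\<tau>) (perms n) (perms n)"
    by (rule bij_betw_byWitness[of _ "\<lambda>p. p \<circ> ?\<tau>"]) (use \<tau> permutes_compose in \<open>auto simp: comp_assoc\<close>)
  have sgn: "sign (p \<circ> ?\<tau>) = - sign p" if "p \<in> perms n" for p
    using that \<tau> assms(3) by (simp add: sign_compose permutation_permutes[THEN iffD2, OF exI] sign_swap_id
        permutes_imp_permutation[of "{1..n}"])
  have e: "Poly_Mapping.map_key (transpose i j) (vexp n p) = vexp n (p \<circ> ?\<tau>)" for p
  proof (rule poly_mapping_eqI)
    fix k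
    have "Suc (transpose i j k) = ?\<tau> (Suc k)" by (auto simp: transpose_def)
    moreover have "transpose i j k < n \<longleftrightarrow> k < n" using assms by (auto simp: transpose_def)
    ultimately show "lookup (Poly_Mapping.map_key (transpose i j) (vexp n p)) k = lookup (vexp n (p \<circ> ?\<tau>)) k"
      by (simp add: lookup_map_key lookup_vexp)
  qed
  have "sw i j (vandermonde n) = (\<Sum>p\<in>perms n. cconst (of_int (sign p)) * mon (vexp n (p \<circ> ?\<tau>)))"
    unfolding vandermonde_def clin_sum[OF clin_pact] clin_scale[OF clin_pact] pact_mon inv_transpose_eq e ..
  also have "\<dots> = (\<Sum>p\<in>perms n. - (cconst (of_int (sign (p \<circ> ?\<tau>))) * mon (vexp n (p \<circ> ?\<tau>))))"
    by (rule sum.cong) (auto simp: sgn cconst_uminus)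
  also have "\<dots> = - (\<Sum>p\<in>perms n. cconst (of_int (sign (p \<circ> ?\<tau>))) * mon (vexp n (p \<circ> ?\<tau>)))"
    by (rule sum_negf)
  also have "(\<Sum>p\<in>perms n. cconst (of_int (sign (p \<circ> ?\<tau>))) * mon (vexp n (p \<circ> ?\<tau>))) = vandermonde n"
    unfolding vandermonde_def by (rule sum.reindex_bij_betw[OF bij])
  finally show ?thesis .
qed

section \<open>Staircase exponents and the logarithmic derivative\<close>

definition staircase :: "nat \<Rightarrow> (nat \<Rightarrow>\<^sub>0 nat) \<Rightarrow> bool" where
  "staircase n a \<longleftrightarrow> keys a \<subseteq> {..<n} \<and> bij_betw (lookup a) {..<n} {..<n}"

lemma staircase_vexp:
  assumes "p \<in> perms n"
  shows "staircase n (vexp n p)"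
  unfolding staircase_def
proof
  have "inj_on (lookup (vexp n p)) {..<n}"
  proof (rule inj_onI)
    fix k l assume kl: "k \<in> {..<n}" "l \<in> {..<n}" "lookup (vexp n p) k = lookup (vexp n p) l"
    hence "p (Suc k) - 1 = p (Suc l) - 1" by (simp add: lookup_vexp)
    hence "p (Suc k) = p (Suc l)"
      using perms_range[OF assms, of k] perms_range[OF assms, of l] kl(1,2) by simp linarith
    moreover have "inj p" using assms permutes_inj by blast
    ultimately show "k = l" by (auto dest: injD)
  qed
  moreover have "lookup (vexp n p) ` {..<n} \<subseteq> {..<n}"
  proof
    fix x assume "x \<in> lookup (vexp n p) ` {..<n}"
    then obtain k where "k < n" "x = p (Suc k) - 1" by (auto simp: lookup_vexp)
    thus "x \<in> {..<n}" using perms_range[OF assms, of k] by auto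
  qed
  ultimately show "bij_betw (lookup (vexp n p)) {..<n} {..<n}"
    by (simp add: bij_betw_def endo_inj_surj)
qed (rule keys_vexp)

lemma keys_vandermonde: "a \<in> keys (vandermonde n) \<Longrightarrow> staircase n a"
proof -
  assume "a \<in> keys (vandermonde n)"
  hence "(\<Sum>p\<in>perms n. lookup (cconst (of_int (sign p)) * mon (vexp n p)) a) \<noteq> 0"
    unfolding in_keys_iff vandermonde_def lookup_sum .
  then obtain p where p: "p \<in> perms n" "lookup (cconst (of_int (sign p)) * mon (vexp n p)) a \<noteq> 0"
    by (rule sum.not_neutral_contains_not_neutral)
  hence "a = vexp n p" by (auto simp: lookup_single when_def split: if_splits)
  thus ?thesis using staircase_vexp[OF p(1)] by simp
qed

lemma staircase_exps_partition:
  assumes "staircase n a" "staircase n b"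
  shows "exps_partition n a = exps_partition n b"
proof (rule exps_cong_mset)
  have "mset (map (lookup a) [0..<n]) = mset_set {..<n}" if "staircase n a" for a
  proof -
    have "mset (map (lookup a) [0..<n]) = image_mset (lookup a) (mset_set {..<n})"
      by (simp add: lessThan_atLeast0)
    also have "\<dots> = mset_set (lookup a ` {..<n})"
      by (rule image_mset_mset_set) (use that in \<open>simp add: staircase_def bij_betw_def\<close>)
    finally show ?thesis using that by (simp add: staircase_def bij_betw_def)
  qed
  thus "mset (map (lookup a) [0..<n]) = mset (map (lookup b) [0..<n])" using assms by simp
qed

lemma staircase_sum: "staircase n a \<Longrightarrow> (\<Sum>l<n. lookup a l) = (\<Sum>k<n. k)"
  unfolding staircase_def using sum.reindex_bij_betw[of "lookup a" "{..<n}" "{..<n}" "\<lambda>k. k"] by simp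

text \<open>The n - 1 distinct entries away from \<open>i\<close> miss exactly one value below n,
  and the prescribed sum forces the entry at \<open>i\<close> to be that value.\<close>

lemma staircaseI:
  assumes "keys a \<subseteq> {..<n}" "i < n" "\<And>l. l < n \<Longrightarrow> lookup a l < n" "(\<Sum>l<n. lookup a l) = (\<Sum>k<n. k)"
    and inj: "inj_on (lookup a) ({..<n} - {i})"
  shows "staircase n a"
proof -
  define A where "A = lookup a ` ({..<n} - {i})"
  have A: "A \<subseteq> {..<n}" using assms(3) by (auto simp: A_def)
  have cA: "card A = n - 1" unfolding A_def card_image[OF inj] using assms(2) by simp
  have finA: "finite A" by (simp add: A_def)
  have "card ({..<n} - A) = 1" using A cA assms(2) finA by (simp add: card_Diff_subset)
  then obtain v where v: "{..<n} - A = {v}" by (meson card_1_singletonE)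
  hence ins: "{..<n} = insert v A" "v \<notin> A" using A by auto
  have "(\<Sum>k<n. k) = v + \<Sum>A" using ins finA by simp
  moreover have "(\<Sum>l<n. lookup a l) = lookup a i + (\<Sum>l\<in>{..<n} - {i}. lookup a l)"
    using assms(2) by (subst sum.remove[of _ i]) auto
  moreover have "(\<Sum>l\<in>{..<n} - {i}. lookup a l) = \<Sum>A"
    unfolding A_def using sum.reindex[OF inj, of "\<lambda>k. k"] by simp
  ultimately have "lookup a i = v" using assms(4) by simp
  hence "lookup a ` insert i ({..<n} - {i}) = {..<n}" using ins(1) unfolding image_insert A_def[symmetric] by simp
  moreover have "insert i ({..<n} - {i}) = {..<n}" using assms(2) by auto
  ultimately have img: "lookup a ` {..<n} = {..<n}" by (simp only:)
  hence "inj_on (lookup a) {..<n}" by (intro eq_card_imp_inj_on) auto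
  thus ?thesis using img assms(1) by (simp add: staircase_def bij_betw_def)
qed

abbreviation stair_bound :: "nat \<Rightarrow> nat \<Rightarrow> nat" where
  "stair_bound n \<equiv> part_sums (exps_partition n (vexp n id))"

lemma id_perms: "id \<in> perms n" by (simp add: permutes_id)

lemma staircase_extremal: "staircase n a \<Longrightarrow> extremal n (stair_bound n) a"
  using extremal_exps_partition[of a n] staircase_exps_partition[OF _ staircase_vexp[OF id_perms], of n a]
  by (simp add: staircase_def)

lemma dom_bounded_vandermonde: "dom_bounded n (stair_bound n) (vandermonde n)"
  unfolding dom_bounded_def
proof
  fix a assume "a \<in> keys (vandermonde n)"
  hence s: "staircase n a" by (rule keys_vandermonde)
  show "vec_bounded n (stair_bound n) a"
    unfolding vec_bounded_def
    using sum_le_part_sum[of _ n a] staircase_exps_partition[OF s staircase_vexp[OF id_perms]] s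
    by (simp add: staircase_def)
qed

lemma stair_bound_1: "n > 0 \<Longrightarrow> stair_bound n 1 < n"
proof -
  assume n: "n > 0"
  obtain I where I: "I \<subseteq> {..<n}" "card I = 1" "(\<Sum>i\<in>I. lookup (vexp n id) i) = stair_bound n 1"
    by (rule part_sum_attained[of 1 n "vexp n id"]) (use n in auto)
  then obtain i where "I = {i}" by (meson card_1_singletonE)
  thus ?thesis using I n by (auto simp: lookup_vexp)
qed

lemma sw_dd:
  assumes "i \<noteq> j" "i \<noteq> k" "i \<noteq> l"
  shows "sw k l (dd i j f) = dd i (transpose k l j) (sw k l f)"
proof -
  let ?\<sigma> = "transpose k l" and ?j = "transpose k l j"
  have ij: "i \<noteq> ?j" using assms by (auto simp: transpose_def)
  have conj: "sw k l (sw i j f) = sw i ?j (sw k l f)"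
  proof (rule poly_mapping_eqI)
    fix a
    have "transpose i j \<circ> ?\<sigma> = ?\<sigma> \<circ> transpose i ?j"
      using assms by (auto simp: fun_eq_iff transpose_def)
    hence "Poly_Mapping.map_key (transpose i j) (Poly_Mapping.map_key ?\<sigma> a) =
        Poly_Mapping.map_key ?\<sigma> (Poly_Mapping.map_key (transpose i ?j) a)" for a :: "nat \<Rightarrow>\<^sub>0 nat"
      using assms by (intro poly_mapping_eqI) (auto simp: lookup_map_key transpose_def)
    thus "lookup (sw k l (sw i j f)) a = lookup (sw i ?j (sw k l f)) a"
      by (simp add: lookup_pact)
  qed
  have Xi: "sw k l (X i) = X i" using assms by (simp add: pact_X transpose_def)
  have Xj: "sw k l (X j) = X ?j" by (simp add: pact_X)
  have "(X i - X ?j) * sw k l (dd i j f) = sw k l ((X i - X j) * dd i j f)"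
    by (simp add: pact_mult clin_diff[OF clin_pact] Xi Xj)
  also have "\<dots> = X i * (sw k l f - sw i ?j (sw k l f))"
    unfolding dd_eq[OF assms(1)] by (simp add: pact_mult clin_diff[OF clin_pact] Xi conj)
  finally show ?thesis using dd_unique[OF ij] by metis
qed

lemma keys_dd_degree:
  assumes "a \<in> keys (dd i j f)" "i < n" "j < n" "i \<noteq> j" "\<And>e. e \<in> keys f \<Longrightarrow> (\<Sum>l<n. lookup e l) = M"
  shows "(\<Sum>l<n. lookup a l) = M"
proof -
  obtain e c d where e: "e \<in> keys f" "a = upd2 i j e c d" "c + d = lookup e i + lookup e j"
    using assms(1) by (rule keys_ddE)
  have "(\<Sum>l\<in>{..<n} - {i, j}. lookup a l) = (\<Sum>l\<in>{..<n} - {i, j}. lookup e l)"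
    by (rule sum.cong) (auto simp: e(2) lookup_upd2)
  moreover have "lookup a i = c" "lookup a j = d" using assms(4) by (auto simp: e(2) lookup_upd2)
  ultimately have "(\<Sum>l<n. lookup a l) = (\<Sum>l<n. lookup e l)"
    using sum_split_two[of "{..<n}" i j "lookup a"] sum_split_two[of "{..<n}" i j "lookup e"] assms(2-4) e(3) by simp
  thus ?thesis using assms(5)[OF e(1)] by simp
qed

text \<open>Logarithmic derivative of the Vandermonde determinant: both sides are alternating in the
  variables other than \<open>x\<^sub>i\<close>, which leaves only the monomials of the Vandermonde determinant itself.\<close>
lemma theta_vandermonde:
  assumes i: "i < n"
  shows "(\<Sum>j\<in>{..<n} - {i}. dd i j (vandermonde n)) = cconst 2 * theta i (vandermonde n)"
proof (rule poly_mapping_eqI)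
  fix a
  define V where "V = vandermonde n"
  define T where "T = (\<Sum>j\<in>{..<n} - {i}. dd i j V)"
  have Tb: "dom_bounded n (stair_bound n) T"
    unfolding T_def V_def using i by (intro dom_bounded_sum dom_bounded_dd dom_bounded_vandermonde) auto
  have Tdeg: "(\<Sum>l<n. lookup b l) = (\<Sum>k<n. k)" if b: "b \<in> keys T" for b
  proof -
    have "(\<Sum>j\<in>{..<n} - {i}. lookup (dd i j V) b) \<noteq> 0" using b by (simp add: in_keys_iff T_def lookup_sum)
    then obtain j where j: "j \<in> {..<n} - {i}" "lookup (dd i j V) b \<noteq> 0" by (rule sum.not_neutral_contains_not_neutral)
    show ?thesis
      by (rule keys_dd_degree[of b i j V]) (use j i keys_vandermonde staircase_sum in \<open>auto simp: in_keys_iff[of b] V_def\<close>)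
  qed
  have anti: "sw k l T = - T" if kl: "k < n" "l < n" "k \<noteq> l" "k \<noteq> i" "l \<noteq> i" for k l
  proof -
    have dd_neg: "dd i j (- V) = - dd i j V" for j by (rule clin_uminus[OF clin_dd])
    have bij: "bij_betw (transpose k l) ({..<n} - {i}) ({..<n} - {i})"
      using kl by (intro permutes_imp_bij permutes_swap_id) auto
    have "sw k l T = (\<Sum>j\<in>{..<n} - {i}. dd i (transpose k l j) (sw k l V))"
      unfolding T_def clin_sum[OF clin_pact] by (rule sum.cong[OF refl], rule sw_dd) (use kl in auto)
    also have "\<dots> = - (\<Sum>j\<in>{..<n} - {i}. dd i (transpose k l j) V)"
      using sw_vandermonde[OF kl(1-3)] by (simp add: V_def[symmetric] dd_neg sum_negf)
    also have "(\<Sum>j\<in>{..<n} - {i}. dd i (transpose k l j) V) = T"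
      unfolding T_def by (rule sum.reindex_bij_betw[OF bij])
    finally show ?thesis .
  qed
  \<comment> \<open>The bound keeps all exponents below n, alternation makes those of the variables
    other than x_i distinct, and the degree fixes the exponent of x_i.\<close>
  have stair: "staircase n b" if b: "b \<in> keys T" for b
  proof (rule staircaseI[OF _ i])
    have vb: "vec_bounded n (stair_bound n) b" using Tb b by (simp add: dom_bounded_def)
    thus "keys b \<subseteq> {..<n}" by (simp add: vec_bounded_def)
    show "lookup b l < n" if l: "l < n" for l
    proof -
      have "(\<Sum>l\<in>{l}. lookup b l) \<le> stair_bound n (card {l})"
        using vb l unfolding vec_bounded_def by (metis empty_subsetI insert_subset lessThan_iff)
      thus ?thesis using stair_bound_1[of n] l by simp
    qed
    show "(\<Sum>l<n. lookup b l) = (\<Sum>k<n. k)" by (rule Tdeg[OF b])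
    show "inj_on (lookup b) ({..<n} - {i})"
    proof (rule inj_onI, rule ccontr)
      fix k l assume kl: "k \<in> {..<n} - {i}" "l \<in> {..<n} - {i}" "lookup b k = lookup b l" "k \<noteq> l"
      have "Poly_Mapping.map_key (transpose k l) b = b"
        using kl(3) by (intro poly_mapping_eqI) (auto simp: lookup_map_key transpose_def)
      hence "lookup (sw k l T) b = lookup T b" by (simp add: lookup_pact)
      moreover have "lookup (sw k l T) b = - lookup T b" using anti[of k l] kl by simp
      ultimately show False using b by (simp add: in_keys_iff)
    qed
  qed
  show "lookup (\<Sum>j\<in>{..<n} - {i}. dd i j (vandermonde n)) a = lookup (cconst 2 * theta i (vandermonde n)) a"
    unfolding V_def[symmetric] T_def[symmetric]
  proof (cases "staircase n a")
    case False
    hence "lookup T a = 0" "lookup V a = 0" using stair keys_vandermonde unfolding V_def in_keys_iff by blast+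
    thus "lookup T a = lookup (cconst 2 * theta i V) a" by (simp add: lookup_theta)
  next
    case True
    \<comment> \<open>The factor 2 arises because V changes sign under the transposition, so its two
      contributions add up.\<close>
    have dd: "lookup (dd i j V) a = (if lookup a j < lookup a i then 2 * lookup V a else 0)" if j: "j \<in> {..<n} - {i}" for j
    proof -
      have "lookup V (Poly_Mapping.map_key (transpose i j) a) = lookup (sw i j V) a" by (simp add: lookup_pact)
      also have "\<dots> = - lookup V a" using sw_vandermonde[of i n j] i j unfolding V_def by auto
      finally show ?thesis
        using lookup_dd_extremal[OF dom_bounded_vandermonde staircase_extremal[OF True] i, of j] j
        unfolding V_def[symmetric] by auto
    qed
    have "lookup T a = (\<Sum>j\<in>{..<n} - {i}. if lookup a j < lookup a i then 2 * lookup V a else 0)"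
      unfolding T_def lookup_sum by (rule sum.cong) (simp_all only: dd)
    also have "\<dots> = of_nat (card {j\<in>{..<n} - {i}. lookup a j < lookup a i}) * (2 * lookup V a)"
      by (simp add: sum.inter_filter[symmetric])
    \<comment> \<open>A staircase takes each value 0, ..., n - 1 once, so exactly
      \<open>lookup a i\<close> of its entries are smaller.\<close>
    also have "card {j\<in>{..<n} - {i}. lookup a j < lookup a i} = lookup a i"
    proof -
      have inj: "inj_on (lookup a) {..<n}" and img: "lookup a ` {..<n} = {..<n}"
        using True by (auto simp: staircase_def bij_betw_def)
      have ai: "lookup a i < n" using img i by blast
      have "lookup a ` {j\<in>{..<n} - {i}. lookup a j < lookup a i} = {..<lookup a i}"
      proof (intro equalityI subsetI)
        fix u assume u: "u \<in> {..<lookup a i}"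
        hence "u \<in> lookup a ` {..<n}" using img ai by auto
        then obtain j where "j < n" "u = lookup a j" by auto
        thus "u \<in> lookup a ` {j\<in>{..<n} - {i}. lookup a j < lookup a i}" using u by (intro image_eqI[of _ _ j]) auto
      qed auto
      moreover have "inj_on (lookup a) {j\<in>{..<n} - {i}. lookup a j < lookup a i}"
        by (rule inj_on_subset[OF inj]) auto
      ultimately show ?thesis using card_image by fastforce
    qed
    finally show "lookup T a = lookup (cconst 2 * theta i V) a" by (simp add: lookup_theta)
  qed
qed

section \<open>The torus scalar product\<close>

text \<open>Replacing the values p by n + 1 - p turns one kind of exponent vector into the other and
  multiplies every sign by the same constant.\<close>

lemma vandermonde_rev_eq:
  obtains s :: int where "s = 1 \<or> s = -1" "vandermonde_rev n = cconst (of_int s) * vandermonde n"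
proof -
  define r where "r k = (if k \<in> {1..n} then Suc n - k else k)" for k
  have rr: "r (r k) = k" for k by (auto simp: r_def)
  have r: "r permutes {1..n}"
    by (rule bij_imp_permutes[OF bij_betw_byWitness[of _ r]]) (auto simp: rr, auto simp: r_def)
  have bij: "bij_betw (\<lambda>p. r \<circ> p) (perms n) (perms n)"
    by (rule bij_betw_byWitness[of _ "\<lambda>p. r \<circ> p"]) (use r permutes_compose in \<open>auto simp: fun_eq_iff rr\<close>)
  have sgn: "sign p = sign r * sign (r \<circ> p)" if "p \<in> perms n" for p
  proof -
    have "sign (r \<circ> p) = sign r * sign p"
      using that r by (intro sign_compose) (auto intro: permutes_imp_permutation[of "{1..n}"])
    thus ?thesis by (simp add: mult.assoc[symmetric] sign_idempotent)
  qed
  have e: "rexp n p = vexp n (r \<circ> p)" if "p \<in> perms n" for p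
  proof (rule poly_mapping_eqI)
    fix k show "lookup (rexp n p) k = lookup (vexp n (r \<circ> p)) k"
      using perms_range[OF that, of k] by (auto simp: lookup_rexp lookup_vexp r_def)
  qed
  have "vandermonde_rev n = (\<Sum>p\<in>perms n. cconst (of_int (sign r)) * (cconst (of_int (sign (r \<circ> p))) * mon (vexp n (r \<circ> p))))"
    unfolding vandermonde_rev_def
  proof (rule sum.cong)
    fix p assume p: "p \<in> perms n"
    show "cconst (of_int (sign p)) * mon (rexp n p) = cconst (of_int (sign r)) * (cconst (of_int (sign (r \<circ> p))) * mon (vexp n (r \<circ> p)))"
      unfolding e[OF p] mult.assoc[symmetric] cconst_mult[symmetric] of_int_mult[symmetric] sgn[OF p, symmetric] ..
  qed simp
  also have "\<dots> = cconst (of_int (sign r)) * (\<Sum>p\<in>perms n. cconst (of_int (sign (r \<circ> p))) * mon (vexp n (r \<circ> p)))"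
    by (simp only: sum_distrib_left)
  also have "(\<Sum>p\<in>perms n. cconst (of_int (sign (r \<circ> p))) * mon (vexp n (r \<circ> p))) = vandermonde n"
    unfolding vandermonde_def by (rule sum.reindex_bij_betw[OF bij])
  finally show ?thesis using that[of "sign r"] by (simp add: sign_def)
qed

text \<open>The weight \<open>\<Prod>\<^sub>i\<^sub>\<noteq>\<^sub>j (1 - x\<^sub>i / x\<^sub>j)\<^sup>m\<close> of the torus scalar product, up to a power of \<open>x\<^sub>1 \<cdots> x\<^sub>n\<close>.\<close>
definition weight :: "nat \<Rightarrow> nat \<Rightarrow> cpoly" where
  "weight n m = vandermonde n ^ m * vandermonde_rev n ^ m"

text \<open>The constant term of \<open>f (x\<^sub>1 \<cdots> x\<^sub>n)\<^sup>-\<^sup>R\<close> against the weight of the torus scalar product.\<close>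
definition torus :: "nat \<Rightarrow> nat \<Rightarrow> nat \<Rightarrow> cpoly \<Rightarrow> complex" where
  "torus n m R f = lookup (f * weight n m) (cvec n (R + m * (n - 1)))"

lemma torus_scale: "torus n m R (cconst c * f) = c * torus n m R f"
  unfolding torus_def mult.assoc by (rule lookup_cconst_mult)

lemma torus_sum: "torus n m R (\<Sum>x\<in>A. f x) = (\<Sum>x\<in>A. torus n m R (f x))"
  by (simp add: torus_def sum_distrib_right lookup_sum)

lemma torus_add: "torus n m R (f + g) = torus n m R f + torus n m R g"
  by (simp add: torus_def distrib_right lookup_add)

lemma lookup_sw_cvec: "i < n \<Longrightarrow> j < n \<Longrightarrow> lookup (sw i j f) (cvec n c) = lookup f (cvec n c)"
proof -
  assume "i < n" "j < n"
  hence "Poly_Mapping.map_key (transpose i j) (cvec n c) = cvec n c"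
    by (intro poly_mapping_eqI) (auto simp: lookup_map_key lookup_cvec transpose_def)
  thus ?thesis by (simp add: lookup_pact)
qed

lemma theta_power: "theta i (f ^ k) = of_nat k * f ^ (k - 1) * theta i f"
proof (induction k)
  case (Suc k)
  show ?case
  proof (cases k)
    case (Suc l)
    thus ?thesis using Suc.IH by (simp add: theta_mult distrib_right distrib_left mult_ac)
  qed (simp add: theta_1)
qed (simp add: theta_1)

lemma torus_identity:
  fixes A B p Ws :: "'a :: comm_ring_1"
  assumes "(A - B) * p = A * (f - s)" "(A - B) * W' = A * W"
  shows "(A - B) * (p * W) = (A - B) * ((f - s) * W')"
proof -
  have "(A - B) * (p * W) = ((A - B) * p) * W" by (simp only: mult.assoc)
  also have "\<dots> = (f - s) * (A * W)" unfolding assms(1) by (simp only: mult_ac)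
  also have "\<dots> = (A - B) * ((f - s) * W')" unfolding assms(2)[symmetric] by (simp only: mult_ac)
  finally show ?thesis .
qed

text \<open>Let W be the weight, W'_j = x_i W / (x_i - x_j), and let \<phi> and q_j be the constant
  terms of f W and f W'_j. As W'_j and its transpose add up to W, the divided difference in j
  contributes 2 q_j - \<phi>. Integration by parts, with the Euler operator sending W to 2 m times
  the sum of the W'_j, gives (R + m (n - 1)) \<phi> minus 2 m times the sum of the q_j. The factor
  \<alpha> = 1/m is exactly what makes the q_j cancel, leaving R/m.\<close>

lemma torus_dunkl:
  assumes m: "m > 0" and i: "i < n"
  shows "torus n m R (dunkl (1 / of_nat m) n i f) = of_nat R / of_nat m * torus n m R f"
proof -
  obtain s0 :: int where rev: "vandermonde_rev n = cconst (of_int s0) * vandermonde n" by (rule vandermonde_rev_eq)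
  define V where "V = vandermonde n"
  define S where "S = cconst (of_int s0) ^ m"
  define W where "W = weight n m"
  define C where "C = cvec n (R + m * (n - 1))"
  have W: "W = S * V ^ (2 * m)"
    unfolding W_def weight_def rev power_mult_distrib S_def V_def mult_2 power_add by (simp only: mult_ac)
  have Sc: "S = cconst (of_int s0 ^ m)" unfolding S_def by (induction m) (simp_all add: cconst_mult)
  \<comment> \<open>This is x_i V / (x_i - x_j), since V minus its transpose is 2 V; written in this
    way, the quotient stays inside the polynomial ring.\<close>
  define Z where "Z j = cconst (1 / 2) * dd i j V" for j
  define W' where "W' j = S * V ^ (2 * m - 1) * Z j" for j
  have half: "cconst (1 / 2) * (cconst 2 * g) = g" for g
  proof -
    have "(2 :: complex) \<noteq> 0" by simp
    from mult_cancel_cconst[OF this, of g] show ?thesis unfolding inverse_eq_divide .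
  qed
  have two: "cconst 2 * V = V - (- V)"
  proof -
    have "cconst (1 + 1) * V = V - (- V)"
      unfolding cconst_add cconst_1 by (simp only: distrib_right mult_1 diff_minus_eq_add)
    thus ?thesis by (simp only: one_add_one)
  qed
  have W': "(X i - X j) * W' j = X i * W" if j: "j < n" "j \<noteq> i" for j
  proof -
    have ij: "i \<noteq> j" using j by auto
    have sv: "sw i j V = - V" unfolding V_def by (rule sw_vandermonde[OF i j(1) ij])
    have "(X i - X j) * Z j = cconst (1 / 2) * ((X i - X j) * dd i j V)"
      unfolding Z_def by (rule mult.left_commute)
    also have "\<dots> = cconst (1 / 2) * (X i * (cconst 2 * V))"
      unfolding dd_eq[OF ij] sv two ..
    also have "\<dots> = X i * (cconst (1 / 2) * (cconst 2 * V))" by (rule mult.left_commute)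
    finally have Z: "(X i - X j) * Z j = X i * V" unfolding half .
    have "(X i - X j) * W' j = S * V ^ (2 * m - 1) * ((X i - X j) * Z j)"
      unfolding W'_def by (rule mult.left_commute)
    also have "\<dots> = X i * (S * (V ^ (2 * m - 1) * V))"
      unfolding Z by (simp only: mult_ac)
    also have "V ^ (2 * m - 1) * V = V ^ (2 * m)" by (rule power_minus_mult) (use m in simp)
    finally show ?thesis by (simp only: W)
  qed
  have swW: "sw i j W = W" if j: "j < n" "j \<noteq> i" for j
  proof -
    have "sw i j (V ^ (2 * m)) = (- V) ^ (2 * m)"
      using sw_vandermonde[OF i j(1) j(2)[symmetric]] by (simp only: pact_power[OF bij_transpose] V_def)
    also have "\<dots> = V ^ (2 * m)" by (simp only: power_mult power2_minus)
    finally show ?thesis unfolding W Sc clin_scale[OF clin_pact] by (simp only:)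
  qed
  have thetaV: "theta i V = (\<Sum>j\<in>{..<n} - {i}. Z j)"
    unfolding Z_def sum_distrib_left[symmetric] V_def theta_vandermonde[OF i] half ..
  have thetaW: "theta i W = cconst (2 * of_nat m) * (\<Sum>j\<in>{..<n} - {i}. W' j)"
  proof -
    have "theta i W = S * (of_nat (2 * m) * V ^ (2 * m - 1) * theta i V)"
      unfolding W Sc clin_scale[OF clin_theta] theta_power ..
    also have "of_nat (2 * m) = cconst (2 * of_nat m)" using cconst_of_nat[of "2 * m"] by simp
    finally show ?thesis unfolding thetaV W'_def sum_distrib_left by (simp only: mult_ac)
  qed
  define \<phi> where "\<phi> = torus n m R f"
  define q where "q j = lookup (f * W' j) C" for j
  have \<phi>: "lookup (f * W) C = \<phi>" by (simp add: \<phi>_def torus_def W_def C_def)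
  have dd: "torus n m R (dd i j f) = 2 * q j - \<phi>" if j: "j \<in> {..<n} - {i}" for j
  proof -
    have j': "j < n" "j \<noteq> i" "i \<noteq> j" using j by auto
    have ne: "X i - X j \<noteq> 0" by (rule X_diff_nonzero[OF j'(3)])
    have "(X i - X j) * (dd i j f * W) = (X i - X j) * ((f - sw i j f) * W' j)"
      by (rule torus_identity[OF dd_eq[OF j'(3)] W'[OF j'(1,2)]])
    hence "dd i j f * W = (f - sw i j f) * W' j" unfolding mult_left_cancel[OF ne] .
    hence e: "dd i j f * W = f * W' j - sw i j f * W' j" unfolding left_diff_distrib .
    have "(X j - X i) * sw i j (W' j) = sw i j ((X i - X j) * W' j)"
      by (simp add: pact_mult clin_diff[OF clin_pact] pact_X)
    also have "\<dots> = X j * W" unfolding W'[OF j'(1,2)] by (simp add: pact_mult pact_X swW[OF j'(1,2)])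
    finally have "(X i - X j) * sw i j (W' j) = - (X j * W)" by (simp add: algebra_simps)
    hence "(X i - X j) * (W' j + sw i j (W' j)) = (X i - X j) * W"
      unfolding distrib_left W'[OF j'(1,2)] by (simp add: left_diff_distrib)
    hence "W' j + sw i j (W' j) = W" unfolding mult_left_cancel[OF ne] .
    hence sum: "sw i j (W' j) = W - W' j" by (metis add_diff_cancel_left')
    \<comment> \<open>The transposition may be moved from f to W'_j because the exponent vector
      \<open>C\<close> is constant on the variables.\<close>
    have "sw i j f * W' j = sw i j (f * sw i j (W' j))"
    proof -
      have "sw i j (sw i j (W' j)) = W' j"
        by (rule poly_mapping_eqI) (simp add: lookup_pact map_key_compose map_key_id [folded id_def])
      thus ?thesis by (simp add: pact_mult)
    qed
    hence "lookup (sw i j f * W' j) C = lookup (f * sw i j (W' j)) C"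
      unfolding C_def using lookup_sw_cvec[OF i j'(1)] by simp
    also have "\<dots> = \<phi> - q j" unfolding sum by (simp add: right_diff_distrib lookup_minus \<phi> q_def)
    finally show ?thesis
      unfolding torus_def W_def[symmetric] C_def[symmetric] e by (simp add: lookup_minus q_def)
  qed
  \<comment> \<open>Integration by parts: at \<open>C\<close> the Euler operator acts as the
    exponent R + m (n - 1) of x_i.\<close>
  have th: "torus n m R (theta i f) = of_nat (R + m * (n - 1)) * \<phi> - 2 * of_nat m * (\<Sum>j\<in>{..<n} - {i}. q j)"
  proof -
    have "theta i f * W = theta i (f * W) - cconst (2 * of_nat m) * (\<Sum>j\<in>{..<n} - {i}. f * W' j)"
      unfolding theta_mult thetaW sum_distrib_left by (simp add: mult.left_commute)
    moreover have "lookup C i = R + m * (n - 1)" using i by (simp add: C_def lookup_cvec)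
    ultimately show ?thesis
      unfolding torus_def W_def[symmetric] C_def[symmetric]
      by (simp add: lookup_minus lookup_theta \<phi> lookup_sum q_def)
  qed
  have card: "of_nat (card ({..<n} - {i})) = (of_nat (n - 1) :: complex)" using i by simp
  have "torus n m R (dunkl (1 / of_nat m) n i f) = 1 / of_nat m * torus n m R (theta i f) + (\<Sum>j\<in>{..<n} - {i}. torus n m R (dd i j f))"
    unfolding dunkl_def torus_add torus_scale torus_sum ..
  also have "(\<Sum>j\<in>{..<n} - {i}. torus n m R (dd i j f)) = 2 * (\<Sum>j\<in>{..<n} - {i}. q j) - of_nat (n - 1) * \<phi>"
    by (simp add: dd sum_subtractf sum_distrib_left card)
  finally show ?thesis
    unfolding th \<phi>_def[symmetric] using m by (simp add: field_simps)
qed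

lemma torus_dunkl_shift_pow:
  assumes "m > 0" "i < n"
  shows "torus n m R ((dunkl_shift (1 / of_nat m) N n i ^^ l) f) =
     (of_nat R / of_nat m + of_nat N - of_nat n) ^ l * torus n m R f"
proof (induction l)
  case (Suc l)
  have step: "torus n m R (dunkl_shift (1 / of_nat m) N n i g) = (of_nat R / of_nat m + of_nat N - of_nat n) * torus n m R g" for g
    unfolding dunkl_shift_def torus_add torus_scale torus_dunkl[OF assms] by (simp add: algebra_simps)
  show ?case by (simp add: step Suc.IH)
qed simp

text \<open>The scalar e does not depend on f. Hence the pairing of an eigenvector can be nonzero
  only if its eigenvalue is e.\<close>

lemma torus_hamiltonian:
  assumes "m > 0" "homog_symfun N f"
  shows "\<exists>e. \<forall>f. homog_symfun N f \<longrightarrow> torus n m R (sf_eval n (hamiltonian (1 / of_nat m) N K t f)) = e * torus n m R (sf_eval n f)"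
proof (intro exI allI impI)
  fix f assume f: "homog_symfun N f"
  let ?b = "of_nat R / of_nat m + of_nat N - of_nat n :: complex"
  have "torus n m R (sf_eval n (hamiltonian (1 / of_nat m) N K t f)) =
     (\<Sum>l<K. t ^ l * (\<Sum>i<n. ?b ^ l * (of_nat R / of_nat m * torus n m R (sf_eval n f))))"
    unfolding sf_eval_hamiltonian[OF f] torus_sum torus_scale
    by (intro sum.cong refl arg_cong2[of _ _ _ _ times]) (simp_all add: torus_dunkl_shift_pow[OF assms(1)] torus_dunkl[OF assms(1)])
  also have "\<dots> = (\<Sum>l<K. t ^ l * (\<Sum>i<n. ?b ^ l * (of_nat R / of_nat m))) * torus n m R (sf_eval n f)"
    by (simp add: sum_distrib_right sum_distrib_left mult.assoc)
  finally show "torus n m R (sf_eval n (hamiltonian (1 / of_nat m) N K t f)) =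
     (\<Sum>l<K. t ^ l * (\<Sum>i<n. ?b ^ l * (of_nat R / of_nat m))) * torus n m R (sf_eval n f)" .
qed

section \<open>Expansion of the weight and its constant term\<close>

lemma mon_sum: "mon (\<Sum>x\<in>A. f x) = (\<Prod>x\<in>A. mon (f x))"
proof (induction A rule: infinite_finite_induct)
  case (insert x F)
  thus ?case by (simp add: mon_mult[symmetric])
qed auto

lemma cconst_prod: "cconst (\<Prod>x\<in>A. f x) = (\<Prod>x\<in>A. cconst (f x))"
  by (induction A rule: infinite_finite_induct) (auto simp: cconst_mult)

lemma prod_alternating_expansion:
  "(\<Prod>j<M. \<Sum>p\<in>perms n. cconst (of_int (sign p)) * mon (E j p)) =
   (\<Sum>s\<in>PiE {..<M} (\<lambda>_. perms n). cconst (\<Prod>j<M. of_int (sign (s j))) * mon (\<Sum>j<M. E j (s j)))"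
  for M :: nat
  by (subst prod_sum_PiE) (simp_all add: finite_permutations prod.distrib cconst_prod mon_sum)

lemma vexp_add_rexp: "p \<in> perms n \<Longrightarrow> vexp n p + rexp n p = cvec n (n - 1)"
proof (rule poly_mapping_eqI)
  fix k assume "p \<in> perms n"
  thus "lookup (vexp n p + rexp n p) k = lookup (cvec n (n - 1)) k"
    using perms_range[of p n k] by (auto simp: lookup_add lookup_vexp lookup_rexp lookup_cvec)
qed

lemma sum_cvec: "(\<Sum>j<m. cvec n c) = cvec n (m * c)" for m :: nat
  by (rule poly_mapping_eqI, unfold lookup_sum) (simp add: lookup_cvec)

lemma vandermonde_nonzero: "vandermonde n \<noteq> 0"
proof -
  have inj: "p = id" if p: "p \<in> perms n" "vexp n p = vexp n id" for p
  proof
    fix k show "p k = id k"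
    proof (cases "k \<in> {1..n}")
      case True
      then obtain l where l: "k = Suc l" "l < n" by (cases k) auto
      have "lookup (vexp n p) l = lookup (vexp n id) l" using p(2) by simp
      hence "p (Suc l) - 1 = l" using l by (simp add: lookup_vexp)
      thus ?thesis using l perms_range[OF p(1), of l] by simp arith
    next
      case False thus ?thesis using p(1) by (auto simp: permutes_def)
    qed
  qed
  have "lookup (vandermonde n) (vexp n id) = (\<Sum>p\<in>perms n. if p = id then 1 else 0)"
    unfolding vandermonde_def lookup_sum
  proof (rule sum.cong)
    fix p assume p: "p \<in> perms n"
    show "lookup (cconst (of_int (sign p)) * mon (vexp n p)) (vexp n id) = (if p = id then 1 else 0)"
      using inj[OF p] by (cases "p = id") (auto simp: lookup_single when_def)
  qed simp
  also have "\<dots> = 1" using finite_perms id_perms by simp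
  finally show ?thesis by auto
qed

text \<open>The m-th power of the reversed determinant has the coefficients of
  \<open>vandermonde n ^ m\<close> at complementary exponents. The constant term is therefore the
  sum of the squares of the integers \<open>Y a\<close>, not all of which vanish because the
  determinant is nonzero.\<close>

lemma torus_one_nonzero: "lookup (weight n m) (cvec n (m * (n - 1))) \<noteq> 0"
proof -
  define S where "S = PiE {..<m} (\<lambda>_. perms n)"
  define E where "E s = (\<Sum>j<m. vexp n (s j))" for s :: "nat \<Rightarrow> nat \<Rightarrow> nat"
  define E' where "E' s = (\<Sum>j<m. rexp n (s j))" for s :: "nat \<Rightarrow> nat \<Rightarrow> nat"
  define z where "z s = (\<Prod>j<m. sign (s j))" for s :: "nat \<Rightarrow> nat \<Rightarrow> nat"
  define C where "C = cvec n (m * (n - 1))"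
  have finS: "finite S" unfolding S_def by (rule finite_PiE) (auto simp: finite_permutations)
  have V: "vandermonde n ^ m = (\<Sum>s\<in>S. cconst (of_int (z s)) * mon (E s))"
    using prod_alternating_expansion[where n = n and E = "\<lambda>_. vexp n" and M = m] by (simp add: vandermonde_def S_def E_def z_def)
  have V': "vandermonde_rev n ^ m = (\<Sum>s\<in>S. cconst (of_int (z s)) * mon (E' s))"
    using prod_alternating_expansion[where n = n and E = "\<lambda>_. rexp n" and M = m] by (simp add: vandermonde_rev_def S_def E'_def z_def)
  have EE: "E s + E' s = C" if "s \<in> S" for s
  proof -
    have "E s + E' s = (\<Sum>j<m. vexp n (s j) + rexp n (s j))" by (simp add: E_def E'_def sum.distrib)
    also have "\<dots> = (\<Sum>j<m. cvec n (n - 1))"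
      by (rule sum.cong[OF refl], rule vexp_add_rexp) (use that in \<open>auto simp: S_def PiE_def Pi_def\<close>)
    finally show ?thesis unfolding C_def sum_cvec .
  qed
  define Y where "Y a = (\<Sum>s\<in>{s\<in>S. E s = a}. z s)" for a
  have Y: "lookup (vandermonde n ^ m) a = of_int (Y a)" for a
  proof -
    have "lookup (vandermonde n ^ m) a = (\<Sum>s\<in>S. if E s = a then of_int (z s) else 0)"
      unfolding V lookup_sum by (rule sum.cong) (auto simp: lookup_single when_def)
    thus ?thesis unfolding Y_def of_int_sum by (simp add: sum.inter_filter[OF finS])
  qed
  have "lookup (weight n m) C = (\<Sum>s\<in>S. of_int (z s) * lookup (mon (E' s) * vandermonde n ^ m) C)"
    unfolding weight_def V' sum_distrib_left lookup_sum
    by (rule sum.cong) (simp_all add: mult.left_commute mult.commute[of "vandermonde n ^ m"])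
  also have "\<dots> = (\<Sum>s\<in>S. of_int (z s * Y (E s)))"
  proof (rule sum.cong)
    fix s assume s: "s \<in> S"
    have "\<forall>i. lookup (E' s) i \<le> lookup C i" unfolding EE[OF s, symmetric] by (simp add: lookup_add)
    moreover have "C - E' s = E s" unfolding EE[OF s, symmetric] by simp
    ultimately show "of_int (z s) * lookup (mon (E' s) * vandermonde n ^ m) C = of_int (z s * Y (E s))"
      unfolding lookup_single_mult by (simp add: Y)
  qed simp
  also have "\<dots> = of_int (\<Sum>s\<in>S. z s * Y (E s))" by (simp only: of_int_sum)
  also have "(\<Sum>s\<in>S. z s * Y (E s)) = (\<Sum>a\<in>E ` S. \<Sum>s\<in>{s\<in>S. E s = a}. z s * Y (E s))"
    by (rule sum.image_gen[OF finS])
  also have "\<dots> = (\<Sum>a\<in>E ` S. Y a ^ 2)"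
  proof (rule sum.cong)
    fix a
    have "(\<Sum>s\<in>{s\<in>S. E s = a}. z s * Y (E s)) = (\<Sum>s\<in>{s\<in>S. E s = a}. z s * Y a)"
      by (rule sum.cong) auto
    thus "(\<Sum>s\<in>{s\<in>S. E s = a}. z s * Y (E s)) = Y a ^ 2"
      by (simp add: Y_def power2_eq_square sum_distrib_right)
  qed simp
  finally have w: "lookup (weight n m) C = of_int (\<Sum>a\<in>E ` S. Y a ^ 2)" .
  have "vandermonde n ^ m \<noteq> 0" using vandermonde_nonzero by simp
  then obtain a where a: "Y a \<noteq> 0" using Y by (metis lookup_zero of_int_0 poly_mapping_eqI)
  have "a \<in> E ` S"
  proof (rule ccontr)
    assume "a \<notin> E ` S"
    hence empty: "{s\<in>S. E s = a} = {}" by auto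
    have "Y a = 0" unfolding Y_def empty by simp
    thus False using a by simp
  qed
  hence "(\<Sum>a\<in>E ` S. Y a ^ 2) > 0"
    using finS a by (intro sum_pos2[of _ a]) auto
  thus ?thesis unfolding w[unfolded C_def] of_int_eq_0_iff by simp
qed

lemma torus_mon_cvec: "torus n m R (mon (cvec n R)) = lookup (weight n m) (cvec n (m * (n - 1)))"
proof -
  have "cvec n (R + m * (n - 1)) - cvec n R = cvec n (m * (n - 1))"
    by (rule poly_mapping_eqI) (simp add: lookup_minus lookup_cvec)
  thus ?thesis unfolding torus_def lookup_single_mult by (simp add: lookup_cvec)
qed

section \<open>Hyperdeterminants and rectangular Jack polynomials\<close>

lemma finite_degree_exponents: "finite {a. keys a \<subseteq> {..<n} \<and> (\<Sum>k<n. lookup a k) = N}" for n N :: nat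
proof (rule finite_subset)
  show "{a. keys a \<subseteq> {..<n} \<and> (\<Sum>k<n. lookup a k) = N} \<subseteq>
      (\<Union>mu\<in>partitions_of N. {a. keys a \<subseteq> {..<n} \<and> exps_partition n a = mu})"
    using exps_partition_in_partitions by auto
  show "finite (\<Union>mu\<in>partitions_of N. {a. keys a \<subseteq> {..<n} \<and> exps_partition n a = mu})"
    by (intro finite_UN_I finite_partitions finite_exps_fiber)
qed

lemma lookup_S_component:
  "lookup (S_component d n R N) a =
     (if keys a \<subseteq> {..<n} \<and> (\<Sum>k<n. lookup a k) = N then \<Prod>k<n. shiftF_coeff d R (lookup a k) else 0)"
proof -
  have "lookup (S_component d n R N) a =
      (\<Sum>b\<in>{a. keys a \<subseteq> {..<n} \<and> (\<Sum>k<n. lookup a k) = N}. if b = a then S_coeff d n R a else 0)"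
    unfolding S_component_def lookup_sum by (rule sum.cong) (auto simp: lookup_single when_def)
  thus ?thesis using finite_degree_exponents[of n N] by (auto simp: S_coeff_def)
qed

lemma symm_S_component: "symm n (S_component d n R N)"
proof (rule symmI)
  fix p and a :: "nat \<Rightarrow>\<^sub>0 nat" assume p: "p permutes {..<n}" and a: "keys a \<subseteq> {..<n}"
  note bij = permutes_imp_bij[OF p]
  have l: "lookup (Poly_Mapping.map_key p a) k = lookup a (p k)" for k by (simp add: lookup_map_key permutes_inj[OF p])
  have "(\<Sum>k<n. lookup a (p k)) = (\<Sum>k<n. lookup a k)" by (rule sum.reindex_bij_betw[OF bij])
  moreover have "(\<Prod>k<n. shiftF_coeff d R (lookup a (p k))) = (\<Prod>k<n. shiftF_coeff d R (lookup a k))"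
    by (rule prod.reindex_bij_betw[OF bij, of "\<lambda>k. shiftF_coeff d R (lookup a k)"])
  ultimately show "lookup (S_component d n R N) (Poly_Mapping.map_key p a) = lookup (S_component d n R N) a"
    unfolding lookup_S_component l using a keys_map_key_subset[OF p a] by simp
qed (auto simp: in_keys_iff lookup_S_component split: if_splits)

lemma rexp_vexp_sums:
  assumes "p \<in> perms n"
  shows "(\<Sum>k<n. lookup (rexp n p) k) + (\<Sum>k<n. k) = n * (n - 1)" "(\<Sum>k<n. lookup (vexp n p) k) = (\<Sum>k<n. k)"
proof -
  show v: "(\<Sum>k<n. lookup (vexp n p) k) = (\<Sum>k<n. k)" by (rule staircase_sum[OF staircase_vexp[OF assms]])
  have "(\<Sum>k<n. lookup (vexp n p) k) + (\<Sum>k<n. lookup (rexp n p) k) = (\<Sum>k<n. lookup (cvec n (n - 1)) k)"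
    unfolding sum.distrib[symmetric] lookup_add[symmetric] vexp_add_rexp[OF assms] ..
  thus "(\<Sum>k<n. lookup (rexp n p) k) + (\<Sum>k<n. k) = n * (n - 1)" by (simp add: v lookup_cvec)
qed

lemma sum_upto_double: "(\<Sum>j<2 * m. if j < m then f j else g j) = (\<Sum>j<m. f j) + (\<Sum>j<m. g (m + j))" for m :: nat
proof -
  have split: "{..<2 * m} = {..<m} \<union> {m..<2 * m}" by (rule ivl_disj_un_one(2)[symmetric]) simp
  have "(\<Sum>j<2 * m. if j < m then f j else g j) = (\<Sum>j<m. if j < m then f j else g j) + (\<Sum>j\<in>{m..<2 * m}. if j < m then f j else g j)"
    unfolding split by (rule sum.union_disjoint) auto
  also have "(\<Sum>j\<in>{m..<2 * m}. if j < m then f j else g j) = (\<Sum>j<m. g (m + j))"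
    by (rule sum.reindex_bij_witness[of _ "\<lambda>j. m + j" "\<lambda>j. j - m"]) auto
  finally show ?thesis by simp
qed

text \<open>The first m permutations feed the reversed determinant, the other m the determinant
  itself. With this choice the exponent of x_i in a term of the weight is m (n - 1) minus the index
  at which the coefficient is taken. The exponent left for \<open>S\<close> is R plus that index,
  which is the shift built into \<open>shiftF_coeff\<close>.\<close>

lemma hyperdet_eq_torus:
  "torus n m R (S_component d n R (n * R)) = of_nat (fact n) * hyperdet m n (trunc_coeffs R d)"
proof -
  define PS where "PS = PiE {..<2 * m} (\<lambda>_. perms n)"
  define E where "E j p = (if j < m then rexp n p else vexp n p)" for j and p :: "nat \<Rightarrow> nat"
  define F where "F s = (\<Sum>j<2 * m. E j (s j))" for s :: "nat \<Rightarrow> nat \<Rightarrow> nat"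
  define C where "C = cvec n (R + m * (n - 1))"
  define S where "S = S_component d n R (n * R)"
  have "(\<Prod>j<2 * m. \<Sum>p\<in>perms n. cconst (of_int (sign p)) * mon (E j p)) = weight n m"
  proof -
    have "(\<Prod>j<2 * m. \<Sum>p\<in>perms n. cconst (of_int (sign p)) * mon (E j p)) =
        (\<Prod>j<2 * m. if j < m then vandermonde_rev n else vandermonde n)"
      by (rule prod.cong) (auto simp: E_def vandermonde_def vandermonde_rev_def)
    also have "\<dots> = (\<Prod>j\<in>{..<2 * m} \<inter> {j. j < m}. vandermonde_rev n) * (\<Prod>j\<in>{..<2 * m} \<inter> - {j. j < m}. vandermonde n)"
      by (rule prod.If_cases) simp
    also have "{..<2 * m} \<inter> {j. j < m} = {..<m}" by auto
    also have "{..<2 * m} \<inter> - {j. j < m} = {m..<2 * m}" by auto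
    finally show ?thesis by (simp add: weight_def mult.commute)
  qed
  hence W: "weight n m = (\<Sum>s\<in>PS. cconst (\<Prod>j<2 * m. of_int (sign (s j))) * mon (F s))"
    unfolding prod_alternating_expansion F_def PS_def by simp
  have summand: "lookup (mon (F s) * S) C = (\<Prod>i\<in>{1..n}. trunc_coeffs R d ((\<Sum>j<m. int (s j i)) - (\<Sum>j<m. int (s (m + j) i))))"
    if s: "s \<in> PS" for s
  proof -
    have sp: "s j \<in> perms n" if "j < 2 * m" for j using s that by (auto simp: PS_def PiE_def Pi_def)
    have Fk: "lookup (F s) k = (\<Sum>j<m. lookup (rexp n (s j)) k) + (\<Sum>j<m. lookup (vexp n (s (m + j))) k)" for k
    proof -
      have "lookup (F s) k = (\<Sum>j<2 * m. if j < m then lookup (rexp n (s j)) k else lookup (vexp n (s j)) k)"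
        unfolding F_def lookup_sum E_def by (rule sum.cong) auto
      thus ?thesis unfolding sum_upto_double .
    qed
    have arg: "int (m * (n - 1)) - int (lookup (F s) k) = (\<Sum>j<m. int (s j (Suc k))) - (\<Sum>j<m. int (s (m + j) (Suc k)))"
      if k: "k < n" for k
    proof -
      have "(\<Sum>j<m. int (lookup (rexp n (s j)) k)) = (\<Sum>j<m. int n - int (s j (Suc k)))"
        by (rule sum.cong) (use perms_range[OF sp, of _ k] k in \<open>auto simp: lookup_rexp\<close>)
      moreover have "(\<Sum>j<m. int (lookup (vexp n (s (m + j))) k)) = (\<Sum>j<m. int (s (m + j) (Suc k)) - 1)"
        by (rule sum.cong) (use perms_range[OF sp, of _ k] k in \<open>auto simp: lookup_vexp\<close>)
      moreover have "int (m * (n - 1)) = int m * int n - int m" using k by (cases n) (auto simp: algebra_simps)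
      ultimately show ?thesis by (simp add: Fk sum_subtractf)
    qed
    \<comment> \<open>Each of the m pairs of permutations has degree n (n - 1), so the complementary
      monomial automatically has degree n R; the component of that degree is all that the constant
      term sees.\<close>
    have Ftotal: "(\<Sum>k<n. lookup (F s) k) = m * (n * (n - 1))"
    proof -
      have "(\<Sum>k<n. lookup (F s) k) = (\<Sum>j<m. \<Sum>k<n. lookup (rexp n (s j)) k) + (\<Sum>j<m. \<Sum>k<n. lookup (vexp n (s (m + j))) k)"
        unfolding Fk sum.distrib by (intro arg_cong2[of _ _ _ _ "(+)"] sum.swap)
      also have "(\<Sum>j<m. \<Sum>k<n. lookup (vexp n (s (m + j))) k) = (\<Sum>j<m. \<Sum>k<n. k)"
        by (rule sum.cong) (use rexp_vexp_sums(2)[OF sp] in auto)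
      also have "(\<Sum>j<m. \<Sum>k<n. lookup (rexp n (s j)) k) + (\<Sum>j<m. \<Sum>k<n. k) = (\<Sum>j<m. (\<Sum>k<n. lookup (rexp n (s j)) k) + (\<Sum>k<n. k))"
        by (rule sum.distrib[symmetric])
      also have "\<dots> = (\<Sum>j<m. n * (n - 1))"
        by (rule sum.cong) (use rexp_vexp_sums(1)[OF sp] in auto)
      finally show ?thesis by simp
    qed
    have Fz: "lookup (F s) k = 0" if "k \<ge> n" for k using that by (simp add: Fk lookup_rexp lookup_vexp)
    have Clk: "lookup C k = (if k < n then R + m * (n - 1) else 0)" for k by (simp add: C_def lookup_cvec)
    have rhs: "(\<Prod>i\<in>{1..n}. trunc_coeffs R d ((\<Sum>j<m. int (s j i)) - (\<Sum>j<m. int (s (m + j) i)))) =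
        (\<Prod>k<n. trunc_coeffs R d (int (m * (n - 1)) - int (lookup (F s) k)))"
    proof -
      have "(\<Prod>i\<in>{1..n}. trunc_coeffs R d ((\<Sum>j<m. int (s j i)) - (\<Sum>j<m. int (s (m + j) i)))) =
        (\<Prod>k<n. trunc_coeffs R d ((\<Sum>j<m. int (s j (Suc k))) - (\<Sum>j<m. int (s (m + j) (Suc k)))))"
        using prod.atLeast1_atMost_eq[of "\<lambda>i. trunc_coeffs R d ((\<Sum>j<m. int (s j i)) - (\<Sum>j<m. int (s (m + j) i)))" n] by simp
      also have "\<dots> = (\<Prod>k<n. trunc_coeffs R d (int (m * (n - 1)) - int (lookup (F s) k)))"
        by (rule prod.cong) (simp_all only: arg lessThan_iff)
      finally show ?thesis .
    qed
    show ?thesis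
    proof (cases "\<forall>k. lookup (F s) k \<le> lookup C k")
      case True
      have b: "lookup (C - F s) k = R + m * (n - 1) - lookup (F s) k" if "k < n" for k
        using that by (simp add: lookup_minus Clk)
      have "keys (C - F s) \<subseteq> {..<n}" by (auto simp: in_keys_iff lookup_minus Clk split: if_splits)
      moreover have "(\<Sum>k<n. lookup (C - F s) k) = n * R"
      proof -
        have "(\<Sum>k<n. lookup (C - F s) k) + (\<Sum>k<n. lookup (F s) k) = (\<Sum>k<n. lookup C k)"
          unfolding sum.distrib[symmetric] by (rule sum.cong) (use True in \<open>auto simp: lookup_minus\<close>)
        also have "\<dots> = n * R + m * (n * (n - 1))" by (simp add: Clk algebra_simps)
        finally show ?thesis unfolding Ftotal by simp
      qed
      ultimately have "lookup (mon (F s) * S) C = (\<Prod>k<n. shiftF_coeff d R (lookup (C - F s) k))"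
        unfolding lookup_single_mult S_def lookup_S_component using True by simp
      also have "\<dots> = (\<Prod>k<n. trunc_coeffs R d (int (m * (n - 1)) - int (lookup (F s) k)))"
      proof (rule prod.cong)
        fix k assume k: "k \<in> {..<n}"
        have "lookup (F s) k \<le> R + m * (n - 1)" using True k by (auto simp: Clk dest: spec[of _ k])
        hence "int (lookup (C - F s) k) - int R = int (m * (n - 1)) - int (lookup (F s) k)"
          using b[of k] k by (simp add: of_nat_diff)
        thus "shiftF_coeff d R (lookup (C - F s) k) = trunc_coeffs R d (int (m * (n - 1)) - int (lookup (F s) k))"
          unfolding shiftF_coeff_def by (simp only:)
      qed simp
      finally show ?thesis unfolding rhs .
    next
      \<comment> \<open>An exponent beyond that of \<open>C\<close> belongs to an index below -R,
        where the truncated coefficient is zero, so both sides vanish.\<close>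
      case False
      then obtain k where k: "\<not> lookup (F s) k \<le> lookup C k" by blast
      hence kn: "k < n" using Fz[of k] by (cases "k < n") auto
      have gt: "lookup (F s) k > R + m * (n - 1)" using k kn by (simp add: Clk)
      have "int (lookup (F s) k) > int R + int (m * (n - 1))" using gt by (simp only: of_nat_add[symmetric] of_nat_less_iff)
      hence "\<not> - int R \<le> int (m * (n - 1)) - int (lookup (F s) k)" by linarith
      hence "trunc_coeffs R d (int (m * (n - 1)) - int (lookup (F s) k)) = 0"
        unfolding trunc_coeffs_def by (simp only: if_False)
      hence "(\<Prod>k<n. trunc_coeffs R d (int (m * (n - 1)) - int (lookup (F s) k))) = 0"
        using kn by (intro prod_zero) auto
      moreover have "lookup (mon (F s) * S) C = 0" unfolding lookup_single_mult if_not_P[OF False] ..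
      ultimately show ?thesis unfolding rhs by simp
    qed
  qed
  have "torus n m R S = (\<Sum>s\<in>PS. (\<Prod>j<2 * m. of_int (sign (s j))) * lookup (mon (F s) * S) C)"
  proof -
    have "S * (cconst c * g) = cconst c * (g * S)" for c g by (simp only: mult_ac)
    thus ?thesis unfolding torus_def W C_def[symmetric] sum_distrib_left lookup_sum
      by (simp only: lookup_cconst_mult)
  qed
  also have "\<dots> = (\<Sum>s\<in>PS. (\<Prod>j<2 * m. of_int (sign (s j))) *
      (\<Prod>i\<in>{1..n}. trunc_coeffs R d ((\<Sum>j<m. int (s j i)) - (\<Sum>j<m. int (s (m + j) i)))))"
    by (rule sum.cong) (simp_all only: summand)
  finally show ?thesis unfolding S_def hyperdet_def PS_def by simp
qed

section \<open>Jack polynomials of degree n R in n variables\<close>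

lemma exps_partition_more_variables:
  assumes "keys a \<subseteq> {..<n}" "n \<le> N"
  shows "exps_partition N a = exps_partition n a"
proof (rule partition_eqI_count[OF is_partition_exps is_partition_exps])
  fix u :: nat assume u: "u > 0"
  have "i < n" if "lookup a i = u" for i
    using assms(1) u that by (metis in_keys_iff lessThan_iff less_numeral_extra(3) subsetD)
  hence "{i\<in>{..<N}. lookup a i = u} = {i\<in>{..<n}. lookup a i = u}" using assms(2) by fastforce
  thus "count (mset (exps_partition N a)) u = count (mset (exps_partition n a)) u"
    using u by (simp add: count_exps_partition)
qed

text \<open>For \<open>R = 0\<close> there are more variables than the degree, so both cases of the comparison occur.\<close>
lemma lookup_sf_eval_rect_degree:
  assumes f: "homog_symfun (n * R) f"
  shows "lookup (sf_eval n f) a =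
    (if keys a \<subseteq> {..<n} \<and> (\<Sum>k<n. lookup a k) = n * R then mcoeff (exps_partition n a) f else 0)"
proof (cases "keys a \<subseteq> {..<n} \<and> (\<Sum>k<n. lookup a k) = n * R")
  case True
  define k where "k = min n (n * R)"
  have ka: "keys a \<subseteq> {..<k}"
  proof (cases "R = 0")
    case True2: True
    have "keys a = {}"
    proof (rule equals0I)
      fix i assume i: "i \<in> keys a"
      hence "lookup a i \<le> (\<Sum>k<n. lookup a k)" using True by (intro member_le_sum) auto
      thus False using i True True2 by (simp add: in_keys_iff)
    qed
    thus ?thesis by simp
  next
    case False
    thus ?thesis using True by (simp add: k_def min_def)
  qed
  have "lookup (sf_eval n f) a = lookup (sf_eval k f) a" by (rule sf_eval_restrict[OF f _ ka]) (simp add: k_def)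
  also have "\<dots> = lookup (sf_eval (n * R) f) a" by (rule sf_eval_restrict[OF f _ ka, symmetric]) (simp add: k_def)
  also have e: "exps_partition (n * R) a = exps_partition n a"
    using exps_partition_more_variables[OF ka, of n] exps_partition_more_variables[OF ka, of "n * R"] by (simp add: k_def)
  have "keys a \<subseteq> {..<n * R}" using ka by (auto simp: k_def)
  hence "lookup (sf_eval (n * R) f) a = mcoeff (exps_partition n a) f"
    by (rule lookup_sf_eval_mcoeff[OF _ e]) (use True in \<open>simp add: sum_list_exps_partition\<close>)
  finally show ?thesis using True by simp
next
  case False
  hence "a \<notin> keys (sf_eval n f)" using sf_eval_degree[OF f, of a n] by blast
  thus ?thesis unfolding if_not_P[OF False] by (simp only: in_keys_iff not_not)
qed

lemma rect_props:
  "is_partition (rect n R)" "sum_list (rect n R) = n * R" "length (rect n R) \<le> n"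
  "1 \<le> i \<Longrightarrow> i \<le> n \<Longrightarrow> part (rect n R) i = R"
  by (auto simp: rect_def is_partition_def part_def sum_list_replicate sorted_wrt_iff_nth_less)

text \<open>Only exponents dominated by the rectangle survive. Each of these is at most R and they
  sum to n R, so all of them equal R.\<close>

lemma sf_eval_jack_rect:
  assumes P: "jack_triangular (rect n R) P"
  shows "sf_eval n P = mon (cvec n R)"
proof (rule poly_mapping_eqI)
  fix a
  have h: "homog_symfun (n * R) P" using P by (simp add: jack_triangular_def in_span_def rect_props)
  have rect: "exps_partition n (cvec n R) = rect n R"
  proof (rule partition_eqI_count[OF is_partition_exps rect_props(1)])
    fix u :: nat assume u: "u > 0"
    have "{i\<in>{..<n}. lookup (cvec n R) i = u} = (if u = R then {..<n} else {})" by (auto simp: lookup_cvec)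
    thus "count (mset (exps_partition n (cvec n R))) u = count (mset (rect n R)) u"
      using u by (auto simp: count_exps_partition rect_def)
  qed
  have kc: "keys (cvec n R) \<subseteq> {..<n}" by (auto simp: in_keys_iff lookup_cvec split: if_splits)
  have sc: "(\<Sum>k<n. lookup (cvec n R) k) = n * R" by (simp add: lookup_cvec)
  show "lookup (sf_eval n P) a = lookup (mon (cvec n R)) a"
  proof (cases "a = cvec n R")
    case True
    thus ?thesis unfolding lookup_sf_eval_rect_degree[OF h] True using kc sc rect P
      by (simp add: jack_triangular_def)
  next
    case False
    have "lookup (sf_eval n P) a = 0"
    proof (rule ccontr)
      assume nz: "lookup (sf_eval n P) a \<noteq> 0"
      hence a: "keys a \<subseteq> {..<n}" "(\<Sum>k<n. lookup a k) = n * R" "mcoeff (exps_partition n a) P \<noteq> 0"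
        unfolding lookup_sf_eval_rect_degree[OF h] by (auto split: if_splits)
      have "exps_partition n a \<in> partitions_of (n * R)" by (rule exps_partition_in_partitions[OF a(2)])
      hence "dominated (exps_partition n a) (rect n R)"
        using P a(3) unfolding jack_triangular_def in_span_def rect_props(2) by blast
      hence vb: "vec_bounded n (part_sums (rect n R)) a" using dominated_exps_iff[OF a(1)] a(2) rect_props(2) by simp
      have le: "lookup a i \<le> R" if i: "i < n" for i
      proof -
        have "(\<Sum>l\<in>{i}. lookup a l) \<le> part_sums (rect n R) (card {i})"
          using vb i unfolding vec_bounded_def by (metis empty_subsetI insert_subset lessThan_iff)
        thus ?thesis using i rect_props(4)[of 1 n R] by simp
      qed
      have "lookup a i = R" if i: "i < n" for i
      proof (rule ccontr)
        assume "lookup a i \<noteq> R"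
        hence "(\<Sum>k<n. lookup a k) < (\<Sum>k<n. R)"
          using le i by (intro sum_strict_mono_ex1) (auto intro!: bexI[of _ i] simp: le_neq_implies_less)
        thus False using a(2) by simp
      qed
      moreover have "lookup a i = 0" if "\<not> i < n" for i using a(1) that by (auto simp: in_keys_iff)
      ultimately have "a = cvec n R" by (intro poly_mapping_eqI) (auto simp: lookup_cvec)
      thus False using False by simp
    qed
    thus ?thesis using False by (simp add: lookup_single when_def)
  qed
qed

text \<open>A monomial in n variables has all of its degree n R in the first n parts. Dominance
  passes this on to \<open>lam\<close>, which leaves nothing for part n + 1.\<close>

lemma sf_eval_jack_few_variables:
  assumes lam: "lam \<in> partitions_of (n * R)" and P: "jack_triangular lam P" and len: "length lam > n"
  shows "sf_eval n P = 0"
proof (rule poly_mapping_eqI)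
  fix a
  have h: "homog_symfun (n * R) P" using P lam by (simp add: jack_triangular_def in_span_def)
  have "mcoeff (exps_partition n a) P = 0" if a: "keys a \<subseteq> {..<n}" "(\<Sum>k<n. lookup a k) = n * R"
  proof (rule ccontr)
    assume nz: "mcoeff (exps_partition n a) P \<noteq> 0"
    have "exps_partition n a \<in> partitions_of (n * R)" by (rule exps_partition_in_partitions[OF a(2)])
    moreover have "in_span (n * R) (below lam) P" using P lam by (simp add: jack_triangular_def)
    ultimately have "exps_partition n a \<in> below lam" using nz unfolding in_span_def by blast
    hence "dominated (exps_partition n a) lam" by blast
    hence "part_sums (exps_partition n a) n \<le> part_sums lam n" unfolding dominated_def by blast
    hence "n * R \<le> part_sums lam n"
      using part_sum_all[OF length_exps_partition, of n a] a(2) by (simp add: sum_list_exps_partition)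
    moreover have "part_sums lam n + part lam (Suc n) = part_sums lam (Suc n)" by simp
    moreover have "part_sums lam (Suc n) \<le> sum_list lam" by (rule part_sum_le)
    moreover have "part lam (Suc n) \<noteq> 0"
    proof -
      have "part lam (Suc n) = lam ! n" using len by (simp add: part_def)
      moreover have "0 \<notin> set lam" using lam by (simp add: is_partition_def)
      ultimately show ?thesis using nth_mem[OF len] by metis
    qed
    ultimately show False using lam by simp
  qed
  thus "lookup (sf_eval n P) a = lookup 0 a" unfolding lookup_sf_eval_rect_degree[OF h] by simp
qed

section \<open>The products \<open>jack_c\<close> and \<open>jack_c'\<close> of the
  rectangle\<close>

lemma conj_part_ge:
  assumes "is_partition lam" "(i, j) \<in> cells lam"
  shows "i \<le> conj_part lam j"
proof -
  have ij: "1 \<le> i" "i \<le> length lam" "j \<le> part lam i" using assms(2) by (auto simp: cells_def)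
  have "{1..i} \<subseteq> {i. 1 \<le> i \<and> i \<le> length lam \<and> j \<le> part lam i}"
  proof
    fix k assume k: "k \<in> {1..i}"
    have "part lam (Suc (i - 1)) \<le> part lam (Suc (k - 1))" by (rule part_antimono[OF assms(1)]) (use k in auto)
    thus "k \<in> {i. 1 \<le> i \<and> i \<le> length lam \<and> j \<le> part lam i}" using k ij by auto
  qed
  moreover have "finite {i. 1 \<le> i \<and> i \<le> length lam \<and> j \<le> part lam i}"
    by (rule finite_subset[of _ "{1..length lam}"]) auto
  ultimately have "card {1..i} \<le> conj_part lam j" unfolding conj_part_def by (intro card_mono)
  thus ?thesis by simp
qed

lemma finite_cells: "finite (cells lam)"
proof -
  have "cells lam \<subseteq> {1..length lam} \<times> {1..sum_list lam}"
    by (auto simp: cells_def intro: le_trans[OF _ part_le_sum_list])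
  thus ?thesis by (rule finite_subset) simp
qed

text \<open>Arms and legs are nonnegative inside the diagram, so every factor is a positive real
  number.\<close>

lemma jack_c_nonzero:
  assumes m: "m > 0" and lam: "is_partition lam"
  shows "jack_c (1 / of_nat m) lam \<noteq> 0" "jack_c' (1 / of_nat m) lam \<noteq> 0"
proof -
  have cell: "j \<le> part lam i \<and> i \<le> conj_part lam j" if "(i, j) \<in> cells lam" for i j
    using conj_part_ge[OF lam that] that by (auto simp: cells_def)
  have c: "1 / of_nat m * (of_nat (part lam i) - of_nat j) + of_nat (conj_part lam j) - of_nat i + (1 :: complex) =
      of_real (1 / real m * real (part lam i - j) + real (conj_part lam j - i) + 1 :: real)"
    and c': "1 / of_nat m * (of_nat (part lam i) - of_nat j + 1) + of_nat (conj_part lam j) - (of_nat i :: complex) =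
      of_real (1 / real m * (real (part lam i - j) + 1) + real (conj_part lam j - i) :: real)"
    if "(i, j) \<in> cells lam" for i j
    using cell[OF that] by (simp_all add: of_nat_diff)
  have "0 \<notin> (\<lambda>(i, j). 1 / of_nat m * (of_nat (part lam i) - of_nat j) + of_nat (conj_part lam j) - of_nat i + 1 :: complex) ` cells lam"
  proof
    assume "0 \<in> (\<lambda>(i, j). 1 / of_nat m * (of_nat (part lam i) - of_nat j) + of_nat (conj_part lam j) - of_nat i + 1 :: complex) ` cells lam"
    then obtain i j where ij: "(i, j) \<in> cells lam" "1 / of_nat m * (of_nat (part lam i) - of_nat j) + of_nat (conj_part lam j) - of_nat i + 1 = (0 :: complex)" by auto
    have "1 / real m * real (part lam i - j) + real (conj_part lam j - i) + 1 > 0"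
      by (intro add_nonneg_pos add_nonneg_nonneg mult_nonneg_nonneg) auto
    thus False using ij(2) unfolding c[OF ij(1)] of_real_eq_0_iff by (simp only: less_irrefl)
  qed
  thus "jack_c (1 / of_nat m) lam \<noteq> 0" unfolding jack_c_def using finite_cells[of lam] by (force simp: prod_zero_iff)
  have "0 \<notin> (\<lambda>(i, j). 1 / of_nat m * (of_nat (part lam i) - of_nat j + 1) + of_nat (conj_part lam j) - of_nat i :: complex) ` cells lam"
  proof
    assume "0 \<in> (\<lambda>(i, j). 1 / of_nat m * (of_nat (part lam i) - of_nat j + 1) + of_nat (conj_part lam j) - of_nat i :: complex) ` cells lam"
    then obtain i j where ij: "(i, j) \<in> cells lam" "1 / of_nat m * (of_nat (part lam i) - of_nat j + 1) + of_nat (conj_part lam j) - of_nat i = (0 :: complex)" by auto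
    have "1 / real m * (real (part lam i - j) + 1) + real (conj_part lam j - i) > 0"
      by (rule add_pos_nonneg[OF mult_pos_pos]) (use m in auto)
    thus False using ij(2) unfolding c'[OF ij(1)] of_real_eq_0_iff by (simp only: less_irrefl)
  qed
  thus "jack_c' (1 / of_nat m) lam \<noteq> 0" unfolding jack_c'_def using finite_cells[of lam] by (force simp: prod_zero_iff)
qed

text \<open>Reversing both coordinates, i to n + 1 - i and j to R + 1 - j, turns the arm into j - 1
  and the leg into i - 1; the factors 1/m of numerator and denominator cancel.\<close>

lemma jack_c_ratio_rect:
  assumes m: "m > 0"
  shows "jack_c (1 / of_nat m) (rect n R) / jack_c' (1 / of_nat m) (rect n R) =
    (\<Prod>i\<in>{1..n}. \<Prod>j\<in>{1..R}. (of_nat (i * m + j - 1) :: complex) / of_nat ((i - 1) * m + j))"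
proof -
  have cells: "cells (rect n R) = {1..n} \<times> {1..R}"
    by (auto simp: cells_def rect_def part_def)
  have conj: "conj_part (rect n R) j = n" if "j \<in> {1..R}" for j
  proof -
    have "{i. 1 \<le> i \<and> i \<le> length (rect n R) \<and> j \<le> part (rect n R) i} = {1..n}"
      using that by (auto simp: rect_def part_def)
    thus ?thesis by (simp add: conj_part_def)
  qed
  have rev: "(\<Prod>(i, j)\<in>{1..n} \<times> {1..R}. g i j) = (\<Prod>i\<in>{1..n}. \<Prod>j\<in>{1..R}. g (n + 1 - i) (R + 1 - j))" for g :: "nat \<Rightarrow> nat \<Rightarrow> complex"
  proof -
    have "(\<Prod>(i, j)\<in>{1..n} \<times> {1..R}. g i j) = (\<Prod>i\<in>{1..n}. \<Prod>j\<in>{1..R}. g i j)"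
      by (simp add: prod.cartesian_product)
    also have "\<dots> = (\<Prod>i\<in>{1..n}. \<Prod>j\<in>{1..R}. g (n + 1 - i) j)"
      by (rule prod.atLeastAtMost_rev)
    also have "\<dots> = (\<Prod>i\<in>{1..n}. \<Prod>j\<in>{1..R}. g (n + 1 - i) (R + 1 - j))"
      by (rule prod.cong[OF refl], rule prod.atLeastAtMost_rev)
    finally show ?thesis .
  qed
  have c: "jack_c (1 / of_nat m) (rect n R) = (\<Prod>i\<in>{1..n}. \<Prod>j\<in>{1..R}. of_nat (i * m + j - 1) / of_nat m)"
  proof -
    have "jack_c (1 / of_nat m) (rect n R) = (\<Prod>(i, j)\<in>{1..n} \<times> {1..R}. 1 / of_nat m * (of_nat R - of_nat j) + of_nat n - of_nat i + 1)"
      unfolding jack_c_def cells by (rule prod.cong) (auto simp: conj rect_props(4))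
    also have "\<dots> = (\<Prod>i\<in>{1..n}. \<Prod>j\<in>{1..R}. 1 / of_nat m * (of_nat R - of_nat (R + 1 - j)) + of_nat n - of_nat (n + 1 - i) + 1)"
      by (rule rev)
    also have "\<dots> = (\<Prod>i\<in>{1..n}. \<Prod>j\<in>{1..R}. of_nat (i * m + j - 1) / of_nat m)"
      using m by (intro prod.cong refl) (auto simp: of_nat_diff field_simps)
    finally show ?thesis .
  qed
  have c': "jack_c' (1 / of_nat m) (rect n R) = (\<Prod>i\<in>{1..n}. \<Prod>j\<in>{1..R}. of_nat ((i - 1) * m + j) / of_nat m)"
  proof -
    have "jack_c' (1 / of_nat m) (rect n R) = (\<Prod>(i, j)\<in>{1..n} \<times> {1..R}. 1 / of_nat m * (of_nat R - of_nat j + 1) + of_nat n - of_nat i)"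
      unfolding jack_c'_def cells by (rule prod.cong) (auto simp: conj rect_props(4))
    also have "\<dots> = (\<Prod>i\<in>{1..n}. \<Prod>j\<in>{1..R}. 1 / of_nat m * (of_nat R - of_nat (R + 1 - j) + 1) + of_nat n - of_nat (n + 1 - i))"
      by (rule rev)
    also have "\<dots> = (\<Prod>i\<in>{1..n}. \<Prod>j\<in>{1..R}. of_nat ((i - 1) * m + j) / of_nat m)"
      using m by (intro prod.cong refl) (auto simp: of_nat_diff field_simps)
    finally show ?thesis .
  qed
  show ?thesis unfolding c c' prod_dividef[symmetric] using m by (intro prod.cong refl) auto
qed

theorem theorem4p3:
  fixes m n R :: nat and d :: "int \<Rightarrow> complex"
  assumes "m > 0" and "n > 0"
    and "hyperdet m n d = hyperdet m n (trunc_coeffs R d)"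
  shows "hyperdet_norm m n d =
           gamma d n m R *
           (\<Prod>i\<in>{1..n}. \<Prod>j\<in>{1..R}.
              (of_nat (i * m + j - 1) :: complex) / of_nat ((i - 1) * m + j))"
proof -
  define \<alpha> where "\<alpha> = 1 / real m"
  have \<alpha>: "\<alpha> > 0" "of_real \<alpha> = (1 / of_nat m :: complex)" using assms(1) by (simp_all add: \<alpha>_def)
  define N where "N = n * R"
  define J where "J = jackP (1 / of_nat m)"
  obtain t K where op: "\<And>N. jack_operator \<alpha> (t N) N (K N)"
    and JP: "\<forall>N. \<forall>lam\<in>partitions_of N. jack_triangular lam (jackP (of_real \<alpha>) lam) \<and>
      hamiltonian (of_real \<alpha>) N (K N) (of_real (t N)) (jackP (of_real \<alpha>) lam) =
        cconst (of_real (ham_eigenvalue \<alpha> N (K N) (t N) lam)) * jackP (of_real \<alpha>) lam"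
    using jackP_eigenvectors[OF \<alpha>(1)] by (elim exE conjE) (rule that, erule spec, assumption)
  define ev where "ev lam = complex_of_real (ham_eigenvalue \<alpha> N (K N) (t N) lam)" for lam
  have tri: "jack_triangular lam (J lam)" if "lam \<in> partitions_of N" for lam
    using bspec[OF spec[OF JP] that] by (simp only: \<alpha>(2) J_def)
  have eig: "hamiltonian (1 / of_nat m) N (K N) (of_real (t N)) (J lam) = cconst (ev lam) * J lam" if "lam \<in> partitions_of N" for lam
    using bspec[OF spec[OF JP] that] by (simp only: \<alpha>(2) J_def ev_def)
  have hJ: "homog_symfun N (J lam)" if "lam \<in> partitions_of N" for lam
    using tri[OF that] that by (simp add: jack_triangular_def in_span_def)
  define r where "r = rect n R"
  have rN: "r \<in> partitions_of N" by (simp add: r_def N_def rect_props)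
  define w where "w = lookup (weight n m) (cvec n (m * (n - 1)))"
  have w: "w \<noteq> 0" unfolding w_def by (rule torus_one_nonzero)
  have Jr: "sf_eval n (J r) = mon (cvec n R)" by (rule sf_eval_jack_rect) (use tri[OF rN] in \<open>simp add: r_def\<close>)
  have tr: "torus n m R (sf_eval n (J r)) = w" unfolding Jr torus_mon_cvec w_def ..
  obtain e where e: "\<And>f. homog_symfun N f \<Longrightarrow>
      torus n m R (sf_eval n (hamiltonian (1 / of_nat m) N (K N) (of_real (t N)) f)) = e * torus n m R (sf_eval n f)"
    using torus_hamiltonian[OF assms(1) hJ[OF rN]] by blast
  \<comment> \<open>Under \<open>torus\<close> the Hamiltonian acts as the scalar \<open>e\<close>,
    and on \<open>J lam\<close> it acts as \<open>ev lam\<close>.\<close>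
  have ee: "ev lam * torus n m R (sf_eval n (J lam)) = e * torus n m R (sf_eval n (J lam))" if "lam \<in> partitions_of N" for lam
    using e[OF hJ[OF that]] unfolding eig[OF that] sf_eval_scale torus_scale .
  \<comment> \<open>The pairing \<open>w\<close> of the rectangle is nonzero, so \<open>e\<close> is
    its eigenvalue, which no other partition of \<open>N\<close> shares.\<close>
  have er: "ev r = e" using ee[OF rN] w unfolding tr by simp
  have orth: "torus n m R (sf_eval n (J lam)) = 0" if "lam \<in> partitions_of N" "lam \<noteq> r" for lam
    using ee[OF that(1)] jack_operator.ev_eq_iff[OF op that(1) rN] that(2) unfolding er[symmetric] ev_def by simp
  define S where "S = S_component d n R N"
  define \<kappa> where "\<kappa> lam = jack_c (1 / of_nat m) lam / jack_c' (1 / of_nat m) lam" for lam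
  have \<kappa>: "\<kappa> lam \<noteq> 0" if "is_partition lam" for lam using jack_c_nonzero[OF assms(1) that] by (simp add: \<kappa>_def)
  have Q: "jackQ_poly (1 / of_nat m) n lam = cconst (\<kappa> lam) * sf_eval n (J lam)" for lam
    by (simp add: jackQ_poly_def jackQ_def sf_eval_scale \<kappa>_def J_def)
  define L where "L = {lam. is_partition lam \<and> sum_list lam = n * R \<and> length lam \<le> n}"
  have LN: "L \<subseteq> partitions_of N" by (auto simp: L_def N_def)
  have finL: "finite L" by (rule finite_subset[OF LN finite_partitions])
  have rL: "r \<in> L" using rect_props by (simp add: L_def r_def)
  \<comment> \<open>\<open>torus\<close> kills every term except that of the rectangle. This gives
    both the uniqueness required by the definite description in \<open>gamma\<close> and its
    value.\<close>
  have unique: "b r = torus n m R S / (\<kappa> r * w)" if b: "S = (\<Sum>lam\<in>L. cconst (b lam) * jackQ_poly (1 / of_nat m) n lam)" for b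
  proof -
    have "torus n m R S = (\<Sum>lam\<in>L. b lam * (\<kappa> lam * torus n m R (sf_eval n (J lam))))"
      unfolding b Q torus_sum torus_scale ..
    also have "\<dots> = (\<Sum>lam\<in>L. if lam = r then b r * (\<kappa> r * w) else 0)"
      by (rule sum.cong) (use orth LN tr in auto)
    also have "\<dots> = b r * (\<kappa> r * w)" using finL rL by simp
    finally show ?thesis using \<kappa>[of r] rN w by simp
  qed
  have "\<exists>b. S = (\<Sum>lam\<in>L. cconst (b lam) * jackQ_poly (1 / of_nat m) n lam)"
  proof -
    \<comment> \<open>Coefficients of a preimage of \<open>S\<close> in \<Lambda>: a partition of
      \<open>N\<close> with more than n parts gets 0, because its monomial does not lie in n
      variables.\<close>
    define s where "s lam = lookup S (Poly_Mapping.nth lam)" for lam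
    define f where "f = (\<Sum>lam\<in>partitions_of N. cconst (s lam) * msym_lift lam)"
    have hf: "homog_symfun N f" unfolding f_def by (intro homog_sum homog_scale msym_lift_spec(1))
    have mf: "mcoeff mu f = s mu" if mu: "mu \<in> partitions_of N" for mu
    proof -
      have "mcoeff mu f = (\<Sum>lam\<in>partitions_of N. s lam * mcoeff mu (msym_lift lam))"
        unfolding f_def mcoeff_def clin_sum[OF clin_sf_eval] sf_eval_scale lookup_sum lookup_cconst_mult ..
      also have "\<dots> = (\<Sum>lam\<in>partitions_of N. if lam = mu then s mu else 0)"
        by (rule sum.cong) (use mcoeff_msym_lift[OF mu] in auto)
      also have "\<dots> = s mu" using finite_partitions mu by (simp only: sum.delta if_True)
      finally show ?thesis .
    qed
    have Sf: "sf_eval n f = S"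
    proof (rule poly_mapping_eqI)
      fix a
      show "lookup (sf_eval n f) a = lookup S a"
      proof (cases "keys a \<subseteq> {..<n} \<and> (\<Sum>k<n. lookup a k) = n * R")
        case True
        have p: "exps_partition n a \<in> partitions_of N" unfolding N_def using True exps_partition_in_partitions by blast
        have "lookup (sf_eval n f) a = s (exps_partition n a)"
          using True mf[OF p] lookup_sf_eval_rect_degree[OF hf[unfolded N_def], of a] by simp
        also have "\<dots> = lookup S a"
          unfolding s_def S_def
          by (rule symm_lookup_eq[OF symm_S_component])
            (use True exps_partition_nth[OF is_partition_exps length_exps_partition] in auto)
        finally show ?thesis .
      next
        case False
        have "lookup S a = 0" unfolding S_def N_def lookup_S_component if_not_P[OF False] ..
        thus ?thesis unfolding lookup_sf_eval_rect_degree[OF hf[unfolded N_def]] if_not_P[OF False] by simp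
      qed
    qed
    obtain c where c: "f = (\<Sum>mu\<in>partitions_of N. cconst (c mu) * J mu)"
      using triangular_expansion[OF tri down_closed_all in_span_all[OF hf]] by blast
    have "S = (\<Sum>mu\<in>partitions_of N. cconst (c mu) * sf_eval n (J mu))"
      unfolding Sf[symmetric] c clin_sum[OF clin_sf_eval] sf_eval_scale ..
    also have "\<dots> = (\<Sum>mu\<in>L. cconst (c mu) * sf_eval n (J mu))"
    proof (rule sum.mono_neutral_right[OF finite_partitions LN], intro ballI)
      fix mu assume mu: "mu \<in> partitions_of N - L"
      hence "sf_eval n (J mu) = 0"
        by (intro sf_eval_jack_few_variables[of mu n R] tri) (auto simp: L_def N_def)
      thus "cconst (c mu) * sf_eval n (J mu) = 0" by simp
    qed
    also have "\<dots> = (\<Sum>mu\<in>L. cconst (c mu / \<kappa> mu) * jackQ_poly (1 / of_nat m) n mu)"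
    proof (rule sum.cong)
      fix mu assume "mu \<in> L"
      hence "\<kappa> mu \<noteq> 0" by (intro \<kappa>) (simp add: L_def)
      thus "cconst (c mu) * sf_eval n (J mu) = cconst (c mu / \<kappa> mu) * jackQ_poly (1 / of_nat m) n mu"
        unfolding Q mult.assoc[symmetric] cconst_mult[symmetric] by simp
    qed simp
    finally show ?thesis by (rule exI[of _ "\<lambda>mu. c mu / \<kappa> mu"])
  qed
  then obtain b where b: "S = (\<Sum>lam\<in>L. cconst (b lam) * jackQ_poly (1 / of_nat m) n lam)" by blast
  have gam: "gamma d n m R = torus n m R S / (\<kappa> r * w)"
    unfolding gamma_def L_def[symmetric] r_def[symmetric] unfolding N_def[symmetric] S_def[symmetric]
  proof (rule the_equality)
    show "\<exists>b. S = (\<Sum>lam\<in>L. cconst (b lam) * jackQ_poly (1 / of_nat m) n lam) \<and> b r = torus n m R S / (\<kappa> r * w)"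
      using b unique[OF b] by blast
  qed (use unique in blast)
  \<comment> \<open>The normalisation is the case R = 0 of \<open>hyperdet_eq_torus\<close> for
    \<open>one_coeffs\<close>, where the series is the constant 1.\<close>
  have one: "hyperdet m n one_coeffs = w / of_nat (fact n)"
  proof -
    have "trunc_coeffs 0 one_coeffs = one_coeffs" by (rule ext) (simp add: trunc_coeffs_def one_coeffs_def)
    moreover have "S_component one_coeffs n 0 (n * 0) = mon (cvec n 0)"
    proof (rule poly_mapping_eqI)
      fix a
      have "keys a \<subseteq> {..<n} \<and> (\<Sum>k<n. lookup a k) = n * 0 \<longleftrightarrow> a = cvec n 0"
      proof
        assume "keys a \<subseteq> {..<n} \<and> (\<Sum>k<n. lookup a k) = n * 0"
        thus "a = cvec n 0" by (intro poly_mapping_eqI) (auto simp: lookup_cvec in_keys_iff)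
      qed (auto simp: lookup_cvec in_keys_iff)
      thus "lookup (S_component one_coeffs n 0 (n * 0)) a = lookup (mon (cvec n 0)) a"
        unfolding lookup_S_component
        by (auto simp: lookup_single when_def shiftF_coeff_def trunc_coeffs_def one_coeffs_def lookup_cvec intro!: prod.neutral)
    qed
    ultimately have "torus n m 0 (mon (cvec n 0)) = of_nat (fact n) * hyperdet m n one_coeffs"
      using hyperdet_eq_torus[of n m 0 one_coeffs] by simp
    thus ?thesis unfolding torus_mon_cvec w_def by (simp add: field_simps)
  qed
  have "torus n m R S = of_nat (fact n) * hyperdet m n d"
    using hyperdet_eq_torus[of n m R d] assms(3) by (simp add: S_def N_def)
  hence "hyperdet_norm m n d = torus n m R S / w"
    unfolding hyperdet_norm_def one by (simp add: field_simps)
  also have "\<dots> = gamma d n m R * \<kappa> r"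
    unfolding gam using \<kappa>[of r] rN w by simp
  finally show ?thesis unfolding \<kappa>_def r_def jack_c_ratio_rect[OF assms(1)] .
qed

end
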